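(* Let $s\in\mathbb{R}$ and let $\Omega\subset\mathbb{R}^n$ be an open set such that $\Omega_e:=\mathbb{R}^n\setminus\overline{\Omega}\ne\emptyset$. Let $L\colon H^s(\mathbb{R}^n)\times H^s(\mathbb{R}^n)\to\mathbb{R}$ be a bounded bilinear form with the following properties: (i) there exists a nonempty open set $W_1\subset\Omega_e$ such that $L$ has the right UCP on $W_1$; (ii) there exists a nonempty open set $W_2\subset\Omega_e$ such that $L$ has the left UCP on $W_2$; (iii) $W_1\cap W_2=\emptyset$. Let $q_j\colon H^s(\mathbb{R}^n)\times H^s(\mathbb{R}^n)\to\mathbb{R}$, $j=1,2$, be local and bounded bilinear forms. Suppose that $B_{L,q_j}:=L+q_j$, $j=1,2$, are (strongly) coercive in $\widetilde{H}^s(\Omega)$. If $\Lambda_{L,q_1}[f][g]=\Lambda_{L,q_2}[f][g]$ for all $f\in C_c^\infty(W_1)$ and $g\in C_c^\infty(W_2)$, then $q_1=q_2$ in $\widetilde{H}^s(\Omega)\times\widetilde{H}^s(\Omega)$.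
   Context: $H^s(\mathbb{R}^n)$ is the $L^2$-based (real) Bessel potential space and $\widetilde{H}^s(\Omega)$ is the closure of $C_c^\infty(\Omega)$ in $H^s(\mathbb{R}^n)$. Let $B\colon H^s(\mathbb{R}^n)\times H^s(\mathbb{R}^n)\to\mathbb{R}$ be a bounded bilinear form and $W\subset\mathbb{R}^n$ open and nonempty. - $B$ has the left UCP on $W$ if: $u\in H^s(\mathbb{R}^n)$, $u|_W=0$ and $B(u,\phi)=0$ for all $\phi\in C_c^\infty(W)$ imply $u\equiv0$. - $B$ has the right UCP on $W$ if: $u\in H^s(\mathbb{R}^n)$, $u|_W=0$ and $B(\phi,u)=0$ for all $\phi\in C_c^\infty(W)$ imply $u\equiv0$. - $B$ is local if $B(u,v)=0$ whenever $u,v\in H^s(\mathbb{R}^n)$ and $\operatorname{supp}(u)\cap\operatorname{supp}(v)=\emptyset$. - $B$ is (strongly) coercive in $\widetilde{H}^s(\Omega)$ if there is $c>0$ with $B(u,u)\ge c\|u\|_{H^s(\mathbb{R}^n)}^2$ for all $u\in\widetilde{H}^s(\Omega)$. If $B$ is bounded and coercive in $\widetilde{H}^s(\Omega)$, then for each $f\in H^s(\mathbb{R}^n)$ there is a unique $u_f\in H^s(\mathbb{R}^n)$ with $u_f-f\in\widetilde{H}^s(\Omega)$ and $B(u_f,\phi)=0$ for all $\phi\in\widetilde{H}^s(\Omega)$. With $X:=H^s(\mathbb{R}^n)/\widetilde{H}^s(\Omega)$, the exterior DN map $\Lambda_B\colon X\to X^*$ is $\Lambda_B[f][g]:=B(u_f,g)$.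 One writes $\Lambda_{L,q}:=\Lambda_{L+q}$. *)

theory Defs
  imports "HOL-Analysis.Analysis"
begin

section \<open>Smooth functions, test functions and the Schwartz space\<close>

text \<open>A list of standard basis vectors plays the role of a multi-index: \<open>partials [b1, ..., bk] f\<close>
  is the iterated partial derivative of \<open>f\<close> in the directions \<open>bk\<close>, ..., \<open>b1\<close> (in this order).
  A function all of whose iterated partial derivatives exist and are again differentiable is
  \<open>C\<^sup>\<infinity>\<close>, and conversely.\<close>

primrec partials :: "'a::euclidean_space list \<Rightarrow> ('a \<Rightarrow> 'b::real_normed_vector) \<Rightarrow> 'a \<Rightarrow> 'b" where
  "partials [] f = f"
| "partials (b # bs) f = (\<lambda>x. frechet_derivative (partials bs f) (at x) b)"

definition smooth :: "('a::euclidean_space \<Rightarrow> 'b::real_normed_vector) \<Rightarrow> bool" where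
  "smooth f \<longleftrightarrow> (\<forall>bs. set bs \<subseteq> Basis \<longrightarrow> (\<forall>x. partials bs f differentiable (at x)))"

definition fun_support :: "('a::euclidean_space \<Rightarrow> 'b::real_normed_vector) \<Rightarrow> 'a set" where
  "fun_support f = closure {x. f x \<noteq> 0}"

definition test_functions :: "'a::euclidean_space set \<Rightarrow> ('a \<Rightarrow> 'b::real_normed_vector) set" where
  "test_functions U = {f. smooth f \<and> compact (fun_support f) \<and> fun_support f \<subseteq> U}"

definition schwartz :: "('a::euclidean_space \<Rightarrow> complex) set" where
  "schwartz = {f. smooth f \<and>
     (\<forall>k bs. set bs \<subseteq> Basis \<longrightarrow> bounded (range (\<lambda>x. (1 + norm x) ^ k *\<^sub>R partials bs f x)))}"

definition schwartz_norm :: "nat \<Rightarrow> ('a::euclidean_space \<Rightarrow> complex) \<Rightarrow> real" where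
  "schwartz_norm N f = (SUP (bs, x) \<in> {bs. set bs \<subseteq> Basis \<and> length bs \<le> N} \<times> UNIV.
     (1 + norm x) ^ N * norm (partials bs f x))"

definition schwartz_null_seq :: "(nat \<Rightarrow> 'a::euclidean_space \<Rightarrow> complex) \<Rightarrow> bool" where
  "schwartz_null_seq f \<longleftrightarrow> range f \<subseteq> schwartz \<and> (\<forall>N. (\<lambda>k. schwartz_norm N (f k)) \<longlonglongrightarrow> 0)"


section \<open>Tempered distributions\<close>

text \<open>Complex-linear functionals on the Schwartz space that are continuous. The Schwartz space
  is metrizable, so sequential continuity at \<open>0\<close> suffices. To make equality of distributions
  agree with equality in HOL, functionals are fixed to \<open>0\<close> outside the Schwartz space.\<close>

definition tempered :: "(('a::euclidean_space \<Rightarrow> complex) \<Rightarrow> complex) \<Rightarrow> bool" where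
  "tempered T \<longleftrightarrow>
     (\<forall>f\<in>schwartz. \<forall>g\<in>schwartz. T (\<lambda>x. f x + g x) = T f + T g) \<and>
     (\<forall>f\<in>schwartz. \<forall>c. T (\<lambda>x. c * f x) = c * T f) \<and>
     (\<forall>f. schwartz_null_seq f \<longrightarrow> (\<lambda>k. T (f k)) \<longlonglongrightarrow> 0) \<and>
     (\<forall>f. f \<notin> schwartz \<longrightarrow> T f = 0)"

typedef (overloaded) ('a::euclidean_space) tempered_dist =
  "{T :: ('a \<Rightarrow> complex) \<Rightarrow> complex. tempered T}"
  morphisms pairing Abs_tempered_dist
  by (rule exI[of _ "\<lambda>_. 0"]) (simp add: tempered_def)

setup_lifting type_definition_tempered_dist

instantiation tempered_dist :: (euclidean_space) real_vector
begin

lift_definition zero_tempered_dist :: "'a tempered_dist" is "\<lambda>_. 0"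
  by (simp add: tempered_def)

lift_definition plus_tempered_dist :: "'a tempered_dist \<Rightarrow> 'a tempered_dist \<Rightarrow> 'a tempered_dist"
  is "\<lambda>S T f. S f + T f"
  by (auto simp: tempered_def algebra_simps intro: tendsto_add_zero)

lift_definition scaleR_tempered_dist :: "real \<Rightarrow> 'a tempered_dist \<Rightarrow> 'a tempered_dist"
  is "\<lambda>r T f. of_real r * T f"
  by (auto simp: tempered_def algebra_simps intro: tendsto_mult_right_zero)

lift_definition uminus_tempered_dist :: "'a tempered_dist \<Rightarrow> 'a tempered_dist"
  is "\<lambda>T f. - T f"
  by (auto simp: tempered_def intro: tendsto_minus_cancel_left[THEN iffD1])

lift_definition minus_tempered_dist :: "'a tempered_dist \<Rightarrow> 'a tempered_dist \<Rightarrow> 'a tempered_dist"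
  is "\<lambda>S T f. S f - T f"
  by (auto simp: tempered_def algebra_simps) (metis diff_zero tendsto_diff)

instance
  by standard (transfer; simp add: fun_eq_iff algebra_simps)+

end

definition real_dist :: "'a::euclidean_space tempered_dist \<Rightarrow> bool" where
  "real_dist u \<longleftrightarrow> (\<forall>f\<in>schwartz. pairing u (\<lambda>x. cnj (f x)) = cnj (pairing u f))"

definition vanishes_on :: "'a::euclidean_space tempered_dist \<Rightarrow> 'a set \<Rightarrow> bool" where
  "vanishes_on u U \<longleftrightarrow> (\<forall>f\<in>test_functions U. pairing u f = 0)"

definition dist_support :: "'a::euclidean_space tempered_dist \<Rightarrow> 'a set" where
  "dist_support u = - \<Union>{U. open U \<and> vanishes_on u U}"

definition dist_of :: "('a::euclidean_space \<Rightarrow> real) \<Rightarrow> 'a tempered_dist" where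
  "dist_of f = Abs_tempered_dist
     (\<lambda>g. if g \<in> schwartz then (LINT x|lborel. complex_of_real (f x) * g x) else 0)"


lemma partials_lin:
  fixes f g :: "'a::euclidean_space \<Rightarrow> complex"
  assumes "smooth f" "smooth g" "set bs \<subseteq> Basis"
  shows "partials bs (\<lambda>x. c * f x + g x) = (\<lambda>x. c * partials bs f x + partials bs g x)"
  using assms(3)
proof (induction bs)
  case (Cons b bs)
  have f: "(partials bs f has_derivative frechet_derivative (partials bs f) (at x)) (at x)"
    and g: "(partials bs g has_derivative frechet_derivative (partials bs g) (at x)) (at x)" for x
    using assms Cons.prems by (auto simp: smooth_def frechet_derivative_works)
  have "((\<lambda>x. c * partials bs f x + partials bs g x) has_derivative
     (\<lambda>h. c * frechet_derivative (partials bs f) (at x) h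
         + frechet_derivative (partials bs g) (at x) h)) (at x)" for x
    by (intro has_derivative_add has_derivative_mult_right f g)
  note eq = frechet_derivative_at[OF this, symmetric]
  have "partials bs (\<lambda>x. c * f x + g x) = (\<lambda>x. c * partials bs f x + partials bs g x)"
    using Cons by simp
  then show ?case by (simp add: eq)
qed simp

lemma schwartz_lin:
  assumes f: "f \<in> schwartz" and g: "g \<in> schwartz"
  shows "(\<lambda>x. c * f x + g x) \<in> schwartz"
proof -
  have s: "smooth f" "smooth g" using f g by (auto simp: schwartz_def)
  have "smooth (\<lambda>x. c * f x + g x)"
    using s unfolding smooth_def
    by (auto simp: partials_lin[OF s] intro!: differentiable_add differentiable_mult)
  moreover have "bounded (range (\<lambda>x. (1 + norm x) ^ k *\<^sub>R partials bs (\<lambda>x. c * f x + g x) x))"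
    if bs: "set bs \<subseteq> Basis" for k bs
  proof -
    have "bounded (range (\<lambda>x. (1 + norm x) ^ k *\<^sub>R partials bs f x))"
      "bounded (range (\<lambda>x. (1 + norm x) ^ k *\<^sub>R partials bs g x))"
      using f g bs by (simp_all add: schwartz_def)
    then obtain M N where
      "norm ((1 + norm x) ^ k *\<^sub>R partials bs f x) \<le> M"
      "norm ((1 + norm x) ^ k *\<^sub>R partials bs g x) \<le> N" for x
      unfolding bounded_iff by blast
    then have "norm (c * ((1 + norm x) ^ k *\<^sub>R partials bs f x)
        + (1 + norm x) ^ k *\<^sub>R partials bs g x) \<le> norm c * M + N" for x
      by (intro norm_triangle_mono norm_mult_ineq[THEN order_trans] mult_left_mono) auto
    then show ?thesis
      unfolding bounded_iff partials_lin[OF s bs]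
      by (intro exI[of _ "norm c * M + N"]) (auto simp: scaleR_add_right)
  qed
  ultimately show ?thesis by (simp add: schwartz_def)
qed

lemma zero_schwartz: "(\<lambda>_::'a::euclidean_space. 0) \<in> schwartz"
proof -
  have "partials bs (\<lambda>_. 0) = (\<lambda>_. 0 :: complex)" for bs :: "'a list"
    by (induction bs) auto
  then show ?thesis by (simp add: schwartz_def smooth_def bounded_iff) auto
qed

lemma schwartz_add: "f \<in> schwartz \<Longrightarrow> g \<in> schwartz \<Longrightarrow> (\<lambda>x. f x + g x) \<in> schwartz"
  using schwartz_lin[of f g 1] by simp

lemma schwartz_mult: "f \<in> schwartz \<Longrightarrow> (\<lambda>x. c * f x) \<in> schwartz"
  using schwartz_lin[OF _ zero_schwartz, of f c] by simp

lemma schwartz_norm_bound: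
  assumes "f \<in> schwartz"
  shows "norm (f x) \<le> schwartz_norm 0 f"
proof -
  have "\<forall>k bs. set bs \<subseteq> Basis \<longrightarrow>
      bounded (range (\<lambda>x. (1 + norm x) ^ k *\<^sub>R partials bs f x))"
    using assms by (simp add: schwartz_def)
  from this[rule_format, of "[]" 0]
  have "bounded (range f)" by simp
  then obtain M where M: "norm (f x) \<le> M" for x
    by (auto simp: bounded_iff)
  have "bdd_above ((\<lambda>(bs, x). (1 + norm x) ^ 0 * norm (partials bs f x)) `
      ({bs. set bs \<subseteq> Basis \<and> length bs \<le> 0} \<times> UNIV))"
    by (rule bdd_aboveI[of _ M]) (auto simp: M)
  from cSUP_upper[OF _ this, of "([], x)"] show ?thesis
    unfolding schwartz_norm_def by simp
qed

lemma smooth_continuous: "smooth f \<Longrightarrow> continuous_on UNIV f"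
  unfolding smooth_def
  by (metis continuous_at_imp_continuous_on differentiable_imp_continuous_within empty_subsetI
      list.set(1) partials.simps(1))

text \<open>The functional in the definition of \<open>dist_of\<close> is a tempered distribution.\<close>

lemma pairing_dist_of:
  fixes f :: "'a::euclidean_space \<Rightarrow> real"
  assumes "f \<in> test_functions U"
  shows "pairing (dist_of f) =
    (\<lambda>g. if g \<in> schwartz then (LINT x|lborel. complex_of_real (f x) * g x) else 0)"
proof -
  let ?T = "\<lambda>g. if g \<in> schwartz then (LINT x|lborel. complex_of_real (f x) * g x) else 0"
  have cf: "continuous_on UNIV f" and K: "compact (fun_support f)"
    using assms smooth_continuous by (auto simp: test_functions_def)
  have "integrable lborel (\<lambda>x. indicator (fun_support f) x *\<^sub>R f x)"
    using K cf by (intro borel_integrable_compact) (auto intro: continuous_on_subset)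
  moreover have "indicator (fun_support f) x *\<^sub>R f x = f x" for x
    using closure_subset[of "{x. f x \<noteq> 0}"] by (auto simp: fun_support_def indicator_def)
  ultimately have intf: "integrable lborel f" by (simp only:)
  have intfg: "integrable lborel (\<lambda>x. complex_of_real (f x) * g x)" if "g \<in> schwartz" for g
  proof (rule Bochner_Integration.integrable_bound)
    show "integrable lborel (\<lambda>x. schwartz_norm 0 g * f x)" using intf by simp
    have "continuous_on UNIV g"
      using that smooth_continuous by (auto simp: schwartz_def)
    then have "continuous_on UNIV (\<lambda>x. complex_of_real (f x) * g x)"
      using cf by (intro continuous_intros)
    then show "(\<lambda>x. complex_of_real (f x) * g x) \<in> borel_measurable lborel"
      by (simp add: borel_measurable_continuous_onI)
    have "norm (complex_of_real (f x) * g x) \<le> norm (schwartz_norm 0 g * f x)" for x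
      using mult_right_mono[OF order_trans[OF schwartz_norm_bound[OF that, of x] abs_ge_self],
          of "\<bar>f x\<bar>"]
      by (simp add: norm_mult abs_mult mult.commute)
    then show "AE x in lborel. norm (complex_of_real (f x) * g x) \<le> norm (schwartz_norm 0 g * f x)"
      by simp
  qed
  have "tempered ?T"
    unfolding tempered_def
  proof (intro conjI ballI allI impI)
    fix g h :: "'a \<Rightarrow> complex" assume "g \<in> schwartz" "h \<in> schwartz"
    then show "?T (\<lambda>x. g x + h x) = ?T g + ?T h"
      using schwartz_add[of g h] by (simp add: distrib_left intfg)
  next
    fix g :: "'a \<Rightarrow> complex" and c assume "g \<in> schwartz"
    then show "?T (\<lambda>x. c * g x) = c * ?T g"
      using schwartz_mult[of g c] by (simp add: mult.left_commute[of _ c])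
  next
    fix g :: "nat \<Rightarrow> 'a \<Rightarrow> complex" assume g: "schwartz_null_seq g"
    then have gs: "g k \<in> schwartz" for k by (auto simp: schwartz_null_seq_def)
    have lim: "(\<lambda>k. schwartz_norm 0 (g k) * (LINT x|lborel. \<bar>f x\<bar>)) \<longlonglongrightarrow> 0"
      using g by (intro tendsto_mult_left_zero) (auto simp: schwartz_null_seq_def)
    have "norm (?T (g k)) \<le> schwartz_norm 0 (g k) * (LINT x|lborel. \<bar>f x\<bar>)" for k
    proof -
      have "norm (?T (g k)) \<le> (LINT x|lborel. norm (complex_of_real (f x) * g k x))"
        using gs by simp
      also have "\<dots> \<le> (LINT x|lborel. schwartz_norm 0 (g k) * \<bar>f x\<bar>)"
        using intf schwartz_norm_bound[OF gs] intfg[OF gs]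
        by (intro integral_mono integrable_norm integrable_mult_right integrable_abs)
           (auto simp: norm_mult mult.commute intro: mult_left_mono)
      finally show ?thesis by simp
    qed
    then show "(\<lambda>k. ?T (g k)) \<longlonglongrightarrow> 0"
      by (intro Lim_null_comparison[OF always_eventually lim]) auto
  qed simp
  then show ?thesis unfolding dist_of_def by (simp add: Abs_tempered_dist_inverse)
qed


section \<open>Fourier transform and Bessel potential spaces\<close>

text \<open>The unitary normalization is used, so that by Plancherel \<open>Hs_norm s u\<close> below is the
  \<open>L\<^sup>2\<close> norm of the Bessel potential of \<open>u\<close> of order \<open>s\<close>.\<close>

definition fourier :: "('a::euclidean_space \<Rightarrow> complex) \<Rightarrow> 'a \<Rightarrow> complex" where
  "fourier f \<xi> = complex_of_real ((2 * pi) powr (- real DIM('a) / 2)) *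
     (LINT x|lborel. cis (- (x \<bullet> \<xi>)) * f x)"

text \<open>The Fourier transform of \<open>u\<close>, i.e. the distribution mapping \<open>f\<close> to \<open>pairing u (fourier f)\<close>,
  is given by the measurable function \<open>F\<close>. Such an \<open>F\<close> is unique almost everywhere.\<close>

definition has_fourier_fun :: "'a::euclidean_space tempered_dist \<Rightarrow> ('a \<Rightarrow> complex) \<Rightarrow> bool" where
  "has_fourier_fun u F \<longleftrightarrow> F \<in> borel_measurable borel \<and>
     (\<forall>f\<in>schwartz. integrable lborel (\<lambda>\<xi>. F \<xi> * f \<xi>) \<and>
        pairing u (fourier f) = (LINT \<xi>|lborel. F \<xi> * f \<xi>))"

definition fourier_fun :: "'a::euclidean_space tempered_dist \<Rightarrow> 'a \<Rightarrow> complex" where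
  "fourier_fun u = (SOME F. has_fourier_fun u F)"

definition bracket :: "'a::euclidean_space \<Rightarrow> real" where
  "bracket \<xi> = sqrt (1 + (norm \<xi>)\<^sup>2)"

definition Hs :: "real \<Rightarrow> 'a::euclidean_space tempered_dist set" where
  "Hs s = {u. real_dist u \<and> (\<exists>F. has_fourier_fun u F \<and>
     integrable lborel (\<lambda>\<xi>. (bracket \<xi> powr s * norm (F \<xi>))\<^sup>2))}"

definition Hs_norm :: "real \<Rightarrow> 'a::euclidean_space tempered_dist \<Rightarrow> real" where
  "Hs_norm s u = sqrt (LINT \<xi>|lborel. (bracket \<xi> powr s * norm (fourier_fun u \<xi>))\<^sup>2)"

definition Htilde :: "real \<Rightarrow> 'a::euclidean_space set \<Rightarrow> 'a tempered_dist set" where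
  "Htilde s \<Omega> = {u \<in> Hs s. \<forall>e>0. \<exists>f\<in>test_functions \<Omega>. Hs_norm s (u - dist_of f) < e}"


section \<open>Bilinear forms\<close>

text \<open>Forms are functions on all tempered distributions of which only the values on the
  Bessel potential space are relevant.\<close>

type_synonym 'a form = "'a tempered_dist \<Rightarrow> 'a tempered_dist \<Rightarrow> real"

definition bounded_bilinear_form :: "real \<Rightarrow> 'a::euclidean_space form \<Rightarrow> bool" where
  "bounded_bilinear_form s B \<longleftrightarrow>
     (\<forall>u\<in>Hs s. \<forall>v\<in>Hs s. \<forall>w\<in>Hs s.
        B (u + v) w = B u w + B v w \<and> B w (u + v) = B w u + B w v) \<and>
     (\<forall>u\<in>Hs s. \<forall>v\<in>Hs s. \<forall>c. B (c *\<^sub>R u) v = c * B u v \<and> B u (c *\<^sub>R v) = c * B u v) \<and>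
     (\<exists>C. \<forall>u\<in>Hs s. \<forall>v\<in>Hs s. \<bar>B u v\<bar> \<le> C * Hs_norm s u * Hs_norm s v)"

definition left_UCP :: "real \<Rightarrow> 'a::euclidean_space form \<Rightarrow> 'a set \<Rightarrow> bool" where
  "left_UCP s B W \<longleftrightarrow> (\<forall>u\<in>Hs s. vanishes_on u W \<longrightarrow>
     (\<forall>f\<in>test_functions W. B u (dist_of f) = 0) \<longrightarrow> u = 0)"

definition right_UCP :: "real \<Rightarrow> 'a::euclidean_space form \<Rightarrow> 'a set \<Rightarrow> bool" where
  "right_UCP s B W \<longleftrightarrow> (\<forall>u\<in>Hs s. vanishes_on u W \<longrightarrow>
     (\<forall>f\<in>test_functions W. B (dist_of f) u = 0) \<longrightarrow> u = 0)"

definition local_form :: "real \<Rightarrow> 'a::euclidean_space form \<Rightarrow> bool" where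
  "local_form s B \<longleftrightarrow> (\<forall>u\<in>Hs s. \<forall>v\<in>Hs s. dist_support u \<inter> dist_support v = {} \<longrightarrow> B u v = 0)"

definition coercive_form :: "real \<Rightarrow> 'a::euclidean_space set \<Rightarrow> 'a form \<Rightarrow> bool" where
  "coercive_form s \<Omega> B \<longleftrightarrow> (\<exists>c>0. \<forall>u\<in>Htilde s \<Omega>. B u u \<ge> c * (Hs_norm s u)\<^sup>2)"

definition add_form :: "'a::euclidean_space form \<Rightarrow> 'a form \<Rightarrow> 'a form" where
  "add_form L q = (\<lambda>u v. L u v + q u v)"


section \<open>The exterior DN map\<close>

definition exterior_solution ::
    "real \<Rightarrow> 'a::euclidean_space set \<Rightarrow> 'a form \<Rightarrow> 'a tempered_dist \<Rightarrow> 'a tempered_dist" where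
  "exterior_solution s \<Omega> B f =
     (THE u. u \<in> Hs s \<and> u - f \<in> Htilde s \<Omega> \<and> (\<forall>v\<in>Htilde s \<Omega>. B u v = 0))"

definition exterior_rel :: "real \<Rightarrow> 'a::euclidean_space set \<Rightarrow> 'a tempered_dist rel" where
  "exterior_rel s \<Omega> = {(f, g). f \<in> Hs s \<and> g \<in> Hs s \<and> f - g \<in> Htilde s \<Omega>}"

abbreviation trace_class ::
    "real \<Rightarrow> 'a::euclidean_space set \<Rightarrow> 'a tempered_dist \<Rightarrow> 'a tempered_dist set" where
  "trace_class s \<Omega> f \<equiv> exterior_rel s \<Omega> `` {f}"

text \<open>The DN map acts on elements of the quotient \<open>Hs s // exterior_rel s \<Omega>\<close>. Its value is the
  common value of \<open>B (exterior_solution s \<Omega> B f) g\<close> over all representatives \<open>f\<close>, \<open>g\<close>.\<close>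

definition DN_map ::
    "real \<Rightarrow> 'a::euclidean_space set \<Rightarrow> 'a form \<Rightarrow> 'a tempered_dist set \<Rightarrow> 'a tempered_dist set \<Rightarrow> real"
  where
  "DN_map s \<Omega> B X Y = (THE r. \<forall>f\<in>X. \<forall>g\<in>Y. B (exterior_solution s \<Omega> B f) g = r)"

end

theory Submission
  imports Defs
begin

text \<open>
  Let \<open>u\<close> solve the exterior problem
  for \<open>L + q\<^sub>1\<close> with datum \<open>f\<close> supported in \<open>W\<^sub>1\<close>, and \<open>u'\<close> the one for \<open>L + q\<^sub>2\<close>. Since the \<open>q\<^sub>j\<close> are local
  and \<open>W\<^sub>2\<close> is disjoint from \<open>W\<^sub>1\<close> and from the closure of \<open>\<Omega>\<close>, testing with \<open>g\<close> supported in \<open>W\<^sub>2\<close> only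
  sees \<open>L\<close>. Equality of the DN data thus gives \<open>L (u - u') g = 0\<close>, and the left UCP yields \<open>u = u'\<close>.
  Hence \<open>(q\<^sub>1 - q\<^sub>2) (u - f) v = 0\<close> for all \<open>v\<close> in \<open>Htilde s \<Omega>\<close>.

  A Runge type argument finishes the proof. For fixed \<open>v\<close>, Lax--Milgram represents the functional
  \<open>(q\<^sub>1 - q\<^sub>2) x v\<close> as \<open>(L + q\<^sub>1) x w\<close> with \<open>w\<close> in \<open>Htilde s \<Omega>\<close>. Taking \<open>x = u - f\<close> gives
  \<open>L f w = 0\<close> for all \<open>f\<close>, so \<open>w = 0\<close> by the right UCP and the functional vanishes.

  The analytic input is that \<open>Hs s\<close> is a complete space of distributions on which \<open>Hs_norm s\<close> controls
  every pairing with a Schwartz function; this rests on Fourier inversion on the Schwartz space and on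
  the almost everywhere uniqueness of the function representing a Fourier transform.
\<close>

section \<open>Schwartz functions\<close>

text \<open>\<open>Hs s\<close> is a subset of a type without a norm, and \<open>Hs_norm s\<close>
  is computed from a representing function picked by \<open>SOME\<close>. Statements about the norm
  therefore rest on almost everywhere uniqueness of that function, which is why Fourier inversion
  precedes the functional analysis. The norm is mostly handled through its square: (a + b)^2 <= 2
  (a^2 + b^2) takes the place of Minkowski's inequality, and the pointwise bound p q <= p^2 + q^2
  takes the place of Cauchy-Schwarz for integrals.

  The forms are not symmetric, so the two slots must be kept apart. Exterior solutions sit in the
  first slot and are tested in the second, so their difference is what the left UCP can see. The
  auxiliary element w sits in the second slot, that is, it solves an adjoint problem; the data f
  supported in \<open>W\<^sub>1\<close> then occupy the first slot, as the right UCP demands. The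
  Runge argument is thus carried out in dual form, and density of the differences u - f in
  \<open>Htilde s \<Omega>\<close> is never stated.\<close>

abbreviation dirderiv :: "'a::euclidean_space \<Rightarrow> ('a \<Rightarrow> 'b::real_normed_vector) \<Rightarrow> 'a \<Rightarrow> 'b" where
  "dirderiv b f \<equiv> (\<lambda>x. frechet_derivative f (at x) b)"

lemma partials_append: "partials bs (partials cs f) = partials (bs @ cs) f"
  by (induction bs) auto

text \<open>Iterated partials of products or composites have unwieldy formulas. A class that is
  stable under a single partial derivative avoids them, since membership then passes to all iterated
  partials by induction.\<close>

lemma partials_in_closed_class:
  assumes "\<And>f b. f \<in> C \<Longrightarrow> b \<in> Basis \<Longrightarrow> dirderiv b f \<in> C" and "f \<in> C" and "set bs \<subseteq> Basis"
  shows "partials bs f \<in> C"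
  using assms(3) by (induction bs) (use assms in auto)

lemma smooth_if_closed_class:
  assumes "\<And>f x. f \<in> C \<Longrightarrow> f differentiable (at x)"
    and "\<And>f b. f \<in> C \<Longrightarrow> b \<in> Basis \<Longrightarrow> dirderiv b f \<in> C" and "f \<in> C"
  shows "smooth f"
  unfolding smooth_def using partials_in_closed_class[of C f] assms by blast

text \<open>Decay is checked for the members of \<open>C\<close> alone, because their derivatives
  are members again. Each application consists in finding a class that is large enough to be
  closed.\<close>

lemma schwartz_if_closed_class:
  assumes diff: "\<And>f x. f \<in> C \<Longrightarrow> f differentiable (at x)"
    and closed: "\<And>f b. f \<in> C \<Longrightarrow> b \<in> Basis \<Longrightarrow> dirderiv b f \<in> C"
    and bound: "\<And>f k. f \<in> C \<Longrightarrow> \<exists>M. \<forall>x. (1 + norm x) ^ k * norm (f x) \<le> M" and "f \<in> C"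
  shows "f \<in> schwartz"
proof -
  have "bounded (range (\<lambda>x. (1 + norm x) ^ k *\<^sub>R partials bs f x))" if "set bs \<subseteq> Basis" for k bs
  proof -
    have "partials bs f \<in> C" using partials_in_closed_class[of C f] assms that by blast
    from bound[OF this, of k] obtain M where "(1 + norm x) ^ k * norm (partials bs f x) \<le> M" for x
      by blast
    then show ?thesis unfolding bounded_iff by (intro exI[of _ M]) (auto simp: abs_mult)
  qed
  then show ?thesis
    using smooth_if_closed_class[of C f] assms by (auto simp: schwartz_def)
qed

section \<open>Closure properties of the Schwartz space\<close>

lemma schwartz_smooth: "f \<in> schwartz \<Longrightarrow> smooth f"
  by (simp add: schwartz_def)

lemma smooth_has_derivative: "smooth f \<Longrightarrow> (f has_derivative frechet_derivative f (at x)) (at x)"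
  unfolding smooth_def
  by (metis empty_subsetI frechet_derivative_works list.set(1) partials.simps(1))

lemma schwartz_continuous: "f \<in> schwartz \<Longrightarrow> continuous_on UNIV f"
  using schwartz_smooth smooth_continuous by blast

lemma schwartz_measurable: "f \<in> schwartz \<Longrightarrow> f \<in> borel_measurable borel"
  by (simp add: schwartz_continuous borel_measurable_continuous_onI)

lemma schwartz_bound:
  assumes "f \<in> schwartz"
  obtains M where "\<And>x. (1 + norm x) ^ k * norm (f x) \<le> M"
proof -
  have "\<forall>k bs. set bs \<subseteq> Basis \<longrightarrow> bounded (range (\<lambda>x. (1 + norm x) ^ k *\<^sub>R partials bs f x))"
    using assms by (simp add: schwartz_def)
  from this[rule_format, of "[]" k]
  have "bounded (range (\<lambda>x. (1 + norm x) ^ k *\<^sub>R f x))" by simp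
  then obtain M where "\<And>x. norm ((1 + norm x) ^ k *\<^sub>R f x) \<le> M" by (auto simp: bounded_iff)
  then show ?thesis using that[of M] by simp
qed

lemma smooth_dirderiv:
  assumes "smooth f" "b \<in> Basis"
  shows "smooth (dirderiv b f)"
proof -
  have "partials bs (dirderiv b f) = partials (bs @ [b]) f" for bs
    using partials_append[of bs "[b]" f] by simp
  then show ?thesis using assms by (auto simp: smooth_def)
qed

lemma schwartz_dirderiv:
  assumes "f \<in> schwartz" "b \<in> Basis"
  shows "dirderiv b f \<in> schwartz"
proof -
  have "partials bs (dirderiv b f) = partials (bs @ [b]) f" for bs
    using partials_append[of bs "[b]" f] by simp
  then show ?thesis using assms smooth_dirderiv[of f b] by (auto simp: schwartz_def)
qed

lemma schwartz_mult_coord: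
  fixes e :: "'a::euclidean_space"
  assumes f: "f \<in> schwartz"
  shows "(\<lambda>x. complex_of_real (x \<bullet> e) * f x) \<in> schwartz"
proof (rule schwartz_if_closed_class)
  \<comment> \<open>The product rule turns the second summand into one of the same shape plus a
    multiple of \<open>g\<close>; the free Schwartz summand \<open>h\<close> absorbs that extra
    term.\<close>
  let ?C = "{\<lambda>x. h x + complex_of_real (x \<bullet> e) * g x | h g. h \<in> schwartz \<and> g \<in> schwartz}"
  have inC: "(\<lambda>x. h x + complex_of_real (x \<bullet> e) * g x) \<in> ?C" if "h \<in> schwartz" "g \<in> schwartz" for h g
    using that by blast
  show "(\<lambda>x. complex_of_real (x \<bullet> e) * f x) \<in> ?C"
    using f zero_schwartz by force
  have der: "((\<lambda>x. h x + complex_of_real (x \<bullet> e) * g x) has_derivative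
     (\<lambda>v. frechet_derivative h (at x) v + (complex_of_real (x \<bullet> e) * frechet_derivative g (at x) v
        + complex_of_real (v \<bullet> e) * g x))) (at x)"
    if "h \<in> schwartz" "g \<in> schwartz" for h g x
    using that[THEN schwartz_smooth, THEN smooth_has_derivative]
    by (auto intro!: derivative_eq_intros)
  {
    fix k f assume "f \<in> ?C"
    then obtain h g where f: "f = (\<lambda>x. h x + complex_of_real (x \<bullet> e) * g x)"
      and hg: "h \<in> schwartz" "g \<in> schwartz" by blast
    show "f differentiable (at x)" for x
      unfolding f differentiable_def using der[OF hg] by blast
    show "dirderiv b f \<in> ?C" if b: "b \<in> Basis" for b
    proof -
      have "dirderiv b f = (\<lambda>x. (complex_of_real (b \<bullet> e) * g x + dirderiv b h x)
          + complex_of_real (x \<bullet> e) * dirderiv b g x)"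
        unfolding f frechet_derivative_at[OF der[OF hg], symmetric] by (simp add: algebra_simps)
      then show ?thesis
        using inC[OF schwartz_lin[OF hg(2) schwartz_dirderiv[OF hg(1) b]] schwartz_dirderiv[OF hg(2) b]]
        by simp
    qed
    obtain M where M: "\<And>x. (1 + norm x) ^ k * norm (h x) \<le> M" using schwartz_bound[OF hg(1), of k] by blast
    \<comment> \<open>One more power of the weight pays for the factor |x \<bullet> e|.\<close>
    obtain N where N: "\<And>x. (1 + norm x) ^ Suc k * norm (g x) \<le> N"
      using schwartz_bound[OF hg(2), of "Suc k"] by blast
    have "(1 + norm x) ^ k * norm (f x) \<le> M + norm e * N" for x
    proof -
      have "\<bar>x \<bullet> e\<bar> \<le> (1 + norm x) * norm e"
        by (meson Cauchy_Schwarz_ineq2 add_increasing mult_right_mono norm_ge_zero order_trans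
            zero_le_one order_refl)
      then have "norm (f x) \<le> norm (h x) + (1 + norm x) * norm e * norm (g x)"
        unfolding f by (intro norm_triangle_mono) (auto simp: norm_mult intro!: mult_right_mono)
      then have "(1 + norm x) ^ k * norm (f x) \<le> (1 + norm x) ^ k * (norm (h x) + (1
        + norm x) * norm e * norm (g x))"
        by (intro mult_left_mono) auto
      also have "\<dots> = (1 + norm x) ^ k * norm (h x) + norm e * ((1 + norm x) ^ Suc k * norm (g x))"
        by (simp add: algebra_simps)
      also have "\<dots> \<le> M + norm e * N"
        by (intro add_mono M mult_left_mono N) auto
      finally show ?thesis .
    qed
    then show "\<exists>M. \<forall>x. (1 + norm x) ^ k * norm (f x) \<le> M" by blast
  }
qed

lemma schwartz_cnj:
  fixes f :: "'a::euclidean_space \<Rightarrow> complex"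
  assumes f: "f \<in> schwartz"
  shows "(\<lambda>x. cnj (f x)) \<in> schwartz"
proof (rule schwartz_if_closed_class)
  let ?C = "{\<lambda>x. cnj (g x) | g :: 'a \<Rightarrow> complex. g \<in> schwartz}"
  show "(\<lambda>x. cnj (f x)) \<in> ?C" using f by blast
  have der: "((\<lambda>x. cnj (g x)) has_derivative (\<lambda>v. cnj (frechet_derivative g (at x) v))) (at x)"
    if "g \<in> schwartz" for g and x :: 'a
    using that[THEN schwartz_smooth, THEN smooth_has_derivative] by (auto intro!: derivative_eq_intros)
  {
    fix k f assume "f \<in> ?C"
    then obtain g where f: "f = (\<lambda>x. cnj (g x))" and g: "g \<in> schwartz" by blast
    show "f differentiable (at x)" for x
      unfolding f differentiable_def using der[OF g] by blast
    show "dirderiv b f \<in> ?C" if b: "b \<in> Basis" for b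
      unfolding f frechet_derivative_at[OF der[OF g], symmetric]
      by (intro CollectI exI[of _ "dirderiv b g"] conjI refl schwartz_dirderiv[OF g b])
    show "\<exists>M. \<forall>x. (1 + norm x) ^ k * norm (f x) \<le> M"
      using schwartz_bound[OF g, of k] unfolding f complex_mod_cnj by metis
  }
qed

lemma schwartz_affine:
  fixes f :: "'a::euclidean_space \<Rightarrow> complex"
  assumes f: "f \<in> schwartz" and c: "c \<noteq> 0"
  shows "(\<lambda>x. f (a + c *\<^sub>R x)) \<in> schwartz"
proof (rule schwartz_if_closed_class)
  \<comment> \<open>The scalar \<open>d\<close> collects the factors \<open>c\<close> produced by
    the chain rule.\<close>
  let ?C = "{\<lambda>x. d * g (a + c *\<^sub>R x) | d (g :: 'a \<Rightarrow> complex). g \<in> schwartz}"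
  show "(\<lambda>x. f (a + c *\<^sub>R x)) \<in> ?C" using f by (intro CollectI exI[of _ 1] exI[of _ f]) auto
  have der: "((\<lambda>x. d * g (a + c *\<^sub>R x)) has_derivative
      (\<lambda>v. d * (c *\<^sub>R frechet_derivative g (at (a + c *\<^sub>R x)) v))) (at x)"
    if "g \<in> schwartz" for d g and x :: 'a
  proof -
    have g: "(g has_derivative frechet_derivative g (at (a + c *\<^sub>R x))) (at (a + c *\<^sub>R x))"
      using that[THEN schwartz_smooth, THEN smooth_has_derivative] .
    have "((\<lambda>x. g (a + c *\<^sub>R x)) has_derivative (\<lambda>v. frechet_derivative g (at (a
      + c *\<^sub>R x)) (c *\<^sub>R v))) (at x)"
      by (rule has_derivative_compose[where f = "\<lambda>x. a + c *\<^sub>R x" and g = g, OF _ g])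
        (auto intro!: derivative_eq_intros)
    moreover have "frechet_derivative g (at (a + c *\<^sub>R x)) (c *\<^sub>R v)
      = c *\<^sub>R frechet_derivative g (at (a + c *\<^sub>R x)) v" for v
      using has_derivative_linear[OF g] by (simp add: linear_cmul)
    ultimately show ?thesis using has_derivative_mult_right by fastforce
  qed
  {
    fix k f assume "f \<in> ?C"
    then obtain g d where f: "f = (\<lambda>x. d * g (a + c *\<^sub>R x))" and g: "g \<in> schwartz" by blast
    show "f differentiable (at x)" for x
      unfolding f differentiable_def using der[OF g] by blast
    show "dirderiv b f \<in> ?C" if b: "b \<in> Basis" for b
      unfolding f frechet_derivative_at[OF der[OF g], symmetric] using schwartz_dirderiv[OF g b]
      by (auto intro!: exI[of _ "d * of_real c"] exI[of _ "dirderiv b g"] simp: scaleR_conv_of_real)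
    \<comment> \<open>Chosen so that 1 + |x| <= K (1 + |a + c x|), starting from |x| <= (|a + c x| +
      |a|) / |c|.\<close>
    define K where "K = 1 + norm a / \<bar>c\<bar> + 1 / \<bar>c\<bar>"
    have K: "K \<ge> 0" by (simp add: K_def)
    have le: "1 + norm x \<le> K * (1 + norm (a + c *\<^sub>R x))" for x
    proof -
      have "norm (c *\<^sub>R x) \<le> norm (a + c *\<^sub>R x) + norm a"
        using norm_triangle_ineq4[of "a + c *\<^sub>R x" a] by simp
      then have "norm x \<le> (norm (a + c *\<^sub>R x) + norm a) / \<bar>c\<bar>"
        using c by (simp add: field_simps)
      moreover have "0 \<le> norm (a + c *\<^sub>R x) + norm (a + c *\<^sub>R x) * norm a / \<bar>c\<bar> + 1 / \<bar>c\<bar>"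
        by (intro add_nonneg_nonneg) auto
      moreover have "K * (1 + norm (a + c *\<^sub>R x)) = 1 + (norm (a + c *\<^sub>R x) + norm a) / \<bar>c\<bar>
          + (norm (a + c *\<^sub>R x) + norm (a + c *\<^sub>R x) * norm a / \<bar>c\<bar> + 1 / \<bar>c\<bar>)"
        by (simp add: K_def algebra_simps add_divide_distrib)
      ultimately show ?thesis by linarith
    qed
    obtain M where M: "\<And>x. (1 + norm x) ^ k * norm (g x) \<le> M" using schwartz_bound[OF g, of k] by blast
    have "(1 + norm x) ^ k * norm (f x) \<le> norm d * K ^ k * M" for x
    proof -
      have "(1 + norm x) ^ k * norm (f x) \<le> (K * (1 + norm (a + c *\<^sub>R x))) ^ k * norm (f x)"
        by (intro mult_right_mono power_mono le) auto
      also have "\<dots> = norm d * K ^ k * ((1 + norm (a + c *\<^sub>R x)) ^ k * norm (g (a + c *\<^sub>R x)))"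
        by (simp add: f norm_mult power_mult_distrib)
      also have "\<dots> \<le> norm d * K ^ k * M"
        by (intro mult_left_mono M) (use K in auto)
      finally show ?thesis .
    qed
    then show "\<exists>M. \<forall>x. (1 + norm x) ^ k * norm (f x) \<le> M" by blast
  }
qed

section \<open>The Gaussian\<close>

definition gauss :: "'a::euclidean_space \<Rightarrow> complex" where
  "gauss x = complex_of_real (exp (- (x \<bullet> x) / 2))"

lemma gauss_has_derivative:
  "(gauss has_derivative (\<lambda>v. - complex_of_real (x \<bullet> v) * gauss x)) (at x)"
  unfolding gauss_def
  by (auto intro!: derivative_eq_intros simp: inner_commute algebra_simps)

text \<open>These are the polynomial multiples of the Gaussian, generated by rules so that closure
  under differentiation and decay both follow by rule induction. This is the class needed for
  \<open>schwartz_if_closed_class\<close>.\<close>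

inductive_set gauss_poly :: "('a::euclidean_space \<Rightarrow> complex) set" where
  gauss: "gauss \<in> gauss_poly"
| coord: "f \<in> gauss_poly \<Longrightarrow> (\<lambda>x. complex_of_real (x \<bullet> e) * f x) \<in> gauss_poly"
| lin: "f \<in> gauss_poly \<Longrightarrow> g \<in> gauss_poly \<Longrightarrow> (\<lambda>x. c * f x + g x) \<in> gauss_poly"

lemma gauss_poly_derivative:
  assumes "f \<in> gauss_poly"
  shows "\<exists>D. \<forall>x. (f has_derivative D x) (at x) \<and> (\<forall>v. (\<lambda>x. D x v) \<in> gauss_poly)"
  using assms
proof induction
  case gauss
  have "(\<lambda>x. - complex_of_real (x \<bullet> v) * gauss x) \<in> gauss_poly" for v :: 'a
    using gauss_poly.coord[OF gauss_poly.gauss, of "- v"] by simp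
  then show ?case
    by (intro exI[of _ "\<lambda>x v. - complex_of_real (x \<bullet> v) * gauss x"]) (auto simp: gauss_has_derivative[simplified])
next
  case (coord f e)
  then obtain D where D: "(f has_derivative D x) (at x)" "(\<lambda>x. D x v) \<in> gauss_poly" for x v by blast
  have "((\<lambda>x. complex_of_real (x \<bullet> e) * f x) has_derivative
      (\<lambda>v. complex_of_real (v \<bullet> e) * f x + complex_of_real (x \<bullet> e) * D x v)) (at x)" for x
    using D by (auto intro!: derivative_eq_intros)
  moreover have "(\<lambda>x. complex_of_real (v \<bullet> e) * f x + complex_of_real (x \<bullet> e) * D x v) \<in> gauss_poly" for v
    using gauss_poly.lin[OF coord.hyps gauss_poly.coord[OF D(2)]] .
  ultimately show ?case by (intro exI[of _ "\<lambda>x v. complex_of_real (v \<bullet> e) * f x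
    + complex_of_real (x \<bullet> e) * D x v"]) auto
next
  case (lin f g c)
  then obtain D E where D: "(f has_derivative D x) (at x)" "(\<lambda>x. D x v) \<in> gauss_poly"
    and E: "(g has_derivative E x) (at x)" "(\<lambda>x. E x v) \<in> gauss_poly" for x v by metis
  have "((\<lambda>x. c * f x + g x) has_derivative (\<lambda>v. c * D x v + E x v)) (at x)" for x
    using D E by (auto intro!: derivative_eq_intros)
  then show ?case using gauss_poly.lin[OF D(2) E(2)] by (intro exI[of _ "\<lambda>x v. c * D x v + E x v"]) auto
qed

lemma exp_ge_power_fact:
  fixes x :: real
  assumes "0 \<le> x"
  shows "x ^ k \<le> fact k * exp x"
proof -
  have "(\<Sum>n\<in>{k}. x ^ n /\<^sub>R fact n) \<le> exp x"
    unfolding exp_def using summable_exp_generic[of x] assms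
    by (intro sum_le_suminf) auto
  then show ?thesis by (simp add: field_simps)
qed

lemma gauss_schwartz: "gauss \<in> schwartz"
proof (rule schwartz_if_closed_class[of gauss_poly])
  show "gauss \<in> gauss_poly" by (rule gauss_poly.gauss)
  fix f :: "'a \<Rightarrow> complex" and k assume f: "f \<in> gauss_poly"
  obtain D where D: "(f has_derivative D x) (at x)" "(\<lambda>x. D x v) \<in> gauss_poly" for x v
    using gauss_poly_derivative[OF f] by blast
  show "f differentiable (at x)" for x using D(1) differentiable_def by blast
  show "dirderiv b f \<in> gauss_poly" for b using D(2)[of b]
    by (simp add: frechet_derivative_at[OF D(1), symmetric])
  show "\<exists>M. \<forall>x. (1 + norm x) ^ k * norm (f x) \<le> M"
    using f
  proof (induction arbitrary: k)
    case gauss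
    \<comment> \<open>With r = |x|, the power is at most k! exp (1 + r), and 1 + r - r^2 / 2 = 3 / 2
      - (r - 1)^2 / 2 is at most 3 / 2.\<close>
    have "(1 + norm x) ^ k * norm (gauss x) \<le> fact k * exp (3 / 2)" for x :: 'a
    proof -
      have "(1 + norm x) ^ k * norm (gauss x) \<le> fact k * exp (1 + norm x) * exp (- (norm x)\<^sup>2 / 2)"
        unfolding gauss_def norm_of_real
        by (auto intro!: mult_mono exp_ge_power_fact simp: dot_square_norm)
      also have "\<dots> = fact k * exp (1 + norm x + - (norm x)\<^sup>2 / 2)"
        by (simp only: exp_add mult.assoc)
      also have "\<dots> \<le> fact k * exp (3 / 2)"
        using zero_le_power2[of "norm x - 1"] by (simp add: power2_diff)
      finally show ?thesis .
    qed
    then show ?case by blast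
  next
    case (coord f e)
    obtain M where M: "\<And>x. (1 + norm x) ^ Suc k * norm (f x) \<le> M" using coord.IH by blast
    have "(1 + norm x) ^ k * norm (complex_of_real (x \<bullet> e) * f x) \<le> norm e * M" for x
    proof -
      have "\<bar>x \<bullet> e\<bar> \<le> norm e * (1 + norm x)"
        using Cauchy_Schwarz_ineq2[of x e] norm_ge_zero[of e] unfolding distrib_left
        by (simp add: mult.commute add_increasing)
      then have "(1 + norm x) ^ k * norm (complex_of_real (x \<bullet> e) * f x)
          \<le> (1 + norm x) ^ k * (norm e * (1 + norm x) * norm (f x))"
        by (auto simp: norm_mult intro!: mult_left_mono mult_right_mono)
      also have "\<dots> = norm e * ((1 + norm x) ^ Suc k * norm (f x))" by simp
      also have "\<dots> \<le> norm e * M" by (intro mult_left_mono M) auto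
      finally show ?thesis .
    qed
    then show ?case by blast
  next
    case (lin f g c)
    obtain M where M: "\<And>x. (1 + norm x) ^ k * norm (f x) \<le> M" using lin.IH by blast
    obtain N where N: "\<And>x. (1 + norm x) ^ k * norm (g x) \<le> N" using lin.IH by blast
    have "(1 + norm x) ^ k * norm (c * f x + g x) \<le> norm c * M + N" for x
    proof -
      have "(1 + norm x) ^ k * norm (c * f x + g x) \<le> (1 + norm x) ^ k * (norm c * norm (f x) + norm (g x))"
        by (intro mult_left_mono norm_triangle_mono) (auto simp: norm_mult)
      also have "\<dots> = norm c * ((1 + norm x) ^ k * norm (f x)) + (1 + norm x) ^ k * norm (g x)"
        by (simp add: algebra_simps)
      also have "\<dots> \<le> norm c * M + N" by (intro add_mono mult_left_mono M N) auto
      finally show ?thesis .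
    qed
    then show ?case by blast
  qed
qed

text \<open>The real supremum in \<open>schwartz_norm\<close> bounds its members only once the set
  is known to be bounded. This holds because there are finitely many lists of basis vectors of
  length at most \<open>N\<close>, and each of the corresponding partials is a Schwartz
  function.\<close>

lemma schwartz_norm_upper:
  fixes f :: "'a::euclidean_space \<Rightarrow> complex"
  assumes f: "f \<in> schwartz" and bs: "set bs \<subseteq> Basis" "length bs \<le> N"
  shows "(1 + norm x) ^ N * norm (partials bs f x) \<le> schwartz_norm N f"
proof -
  have "\<exists>M. \<forall>x. (1 + norm x) ^ N * norm (partials cs f x) \<le> M" if "set cs \<subseteq> Basis" for cs
  proof -
    have "partials cs f \<in> schwartz"
      by (rule partials_in_closed_class[OF _ f that]) (rule schwartz_dirderiv)
    then show ?thesis using schwartz_bound by metis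
  qed
  then obtain M where M: "(1 + norm x) ^ N * norm (partials cs f x) \<le> M cs"
    if "set cs \<subseteq> Basis" for cs x by metis
  let ?I = "{bs. set bs \<subseteq> (Basis :: 'a set) \<and> length bs \<le> N}"
  have fin: "finite ?I" by (rule finite_lists_length_le) simp
  have "bdd_above ((\<lambda>(bs, x). (1 + norm x) ^ N * norm (partials bs f x)) ` (?I \<times> UNIV))"
  proof (rule bdd_aboveI[of _ "Max (M ` ?I)"])
    fix y assume "y \<in> (\<lambda>(bs, x). (1 + norm x) ^ N * norm (partials bs f x)) ` (?I \<times> UNIV)"
    then obtain cs x where cs: "cs \<in> ?I" and y: "y = (1 + norm x) ^ N * norm (partials cs f x)" by auto
    have "y \<le> M cs" unfolding y using M cs by blast
    also have "\<dots> \<le> Max (M ` ?I)" using fin cs by (intro Max_ge) auto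
    finally show "y \<le> Max (M ` ?I)" .
  qed
  from cSUP_upper[OF _ this, of "(bs, x)"] show ?thesis
    unfolding schwartz_norm_def using bs by simp
qed

lemma schwartz_norm_nonneg: "f \<in> schwartz \<Longrightarrow> 0 \<le> schwartz_norm N f"
  using order_trans[OF norm_ge_zero[of "f 0"]] schwartz_norm_upper[of f "[]" N 0] by simp

lemma schwartz_norm_weighted: "f \<in> schwartz \<Longrightarrow> (1 + norm x) ^ N * norm (f x) \<le> schwartz_norm N f"
  using schwartz_norm_upper[of f "[]" N x] by simp

lemma schwartz_norm_dirderiv:
  fixes f :: "'a::euclidean_space \<Rightarrow> complex"
  assumes f: "f \<in> schwartz" and b: "b \<in> Basis"
  shows "schwartz_norm N (dirderiv b f) \<le> schwartz_norm (Suc N) f"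
  unfolding schwartz_norm_def[of N]
proof (rule cSUP_least)
  fix p assume "p \<in> {bs. set bs \<subseteq> (Basis :: 'a set) \<and> length bs \<le> N} \<times> (UNIV :: 'a set)"
  then obtain bs x where p: "p = (bs, x)" "set bs \<subseteq> Basis" "length bs \<le> N" by auto
  have "(1 + norm x) ^ N * norm (partials (bs @ [b]) f x) \<le> (1
    + norm x) ^ Suc N * norm (partials (bs @ [b]) f x)"
    by (intro mult_right_mono power_increasing) auto
  also have "\<dots> \<le> schwartz_norm (Suc N) f"
    using p b by (intro schwartz_norm_upper f) auto
  finally show "(case p of (bs, x) \<Rightarrow> (1 + norm x) ^ N * norm (partials bs (dirderiv b f) x))
    \<le> schwartz_norm (Suc N) f"
    using partials_append[of bs "[b]" f] p by simp
qed (auto intro: exI[of _ "[]"])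

lemma schwartz_norm_mono:
  assumes f: "f \<in> schwartz" and N: "N \<le> M"
  shows "schwartz_norm N f \<le> schwartz_norm M f"
  unfolding schwartz_norm_def[of N]
proof (rule cSUP_least)
  fix p assume "p \<in> {bs. set bs \<subseteq> (Basis :: 'a set) \<and> length bs \<le> N} \<times> (UNIV :: 'a set)"
  then obtain bs x where p: "p = (bs, x)" "set bs \<subseteq> Basis" "length bs \<le> N" by auto
  have "(1 + norm x) ^ N * norm (partials bs f x) \<le> (1 + norm x) ^ M * norm (partials bs f x)"
    using N by (intro mult_right_mono power_increasing) auto
  also have "\<dots> \<le> schwartz_norm M f"
    using p N by (intro schwartz_norm_upper f) auto
  finally show "(case p of (bs, x) \<Rightarrow> (1 + norm x) ^ N * norm (partials bs f x)) \<le> schwartz_norm M f"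
    using p by simp
qed (auto intro: exI[of _ "[]"])

section \<open>The Fourier transform on the Schwartz space\<close>

text \<open>The exponent provides a factor (1 + |x|)^2 >= 1 + (x \<bullet> b)^2 for every
  coordinate, so the weight is dominated by a product of one-dimensional functions 1 / (1 + t^2) and
  is integrable.\<close>

definition decay :: "'a::euclidean_space \<Rightarrow> real" where
  "decay x = 1 / (1 + norm x) ^ (2 * DIM('a))"

lemma nn_integral_inverse_one_plus_square:
  "(\<integral>\<^sup>+x. ennreal (1 / (1 + x\<^sup>2)) \<partial>lborel) < \<infinity>"
proof -
  let ?f = "\<lambda>x::real. 1 / (1 + x\<^sup>2)"
  have I: "(\<integral>\<^sup>+x. ennreal (?f x) * indicator {0..} x \<partial>lborel) = pi / 2 - arctan 0"
    by (rule nn_integral_FTC_atLeast)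
       (auto intro!: derivative_eq_intros tendsto_arctan_at_top simp: field_simps)
  have "(\<integral>\<^sup>+x. ennreal (?f x) * indicator {0..} (- x) \<partial>lborel)
    = (\<integral>\<^sup>+x. ennreal (?f x) * indicator {0..} x \<partial>lborel)"
    by (subst (2) lborel_distr_uminus[symmetric], subst nn_integral_distr) auto
  then have "(\<integral>\<^sup>+x. ennreal (?f x) * indicator {0..} x \<partial>lborel)
    + (\<integral>\<^sup>+x. ennreal (?f x) * indicator {0..} (- x) \<partial>lborel) < \<infinity>"
    unfolding I by simp
  moreover have "(\<integral>\<^sup>+x. ennreal (?f x) * indicator {0..} x \<partial>lborel)
    + (\<integral>\<^sup>+x. ennreal (?f x) * indicator {0..} (- x) \<partial>lborel)
    = (\<integral>\<^sup>+x. ennreal (?f x) * indicator {0..} x + ennreal (?f x) * indicator {0..} (- x) \<partial>lborel)"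
    by (subst nn_integral_add) auto
  ultimately have "(\<integral>\<^sup>+x. ennreal (?f x) * indicator {0..} x
    + ennreal (?f x) * indicator {0..} (- x) \<partial>lborel) < \<infinity>" by simp
  \<comment> \<open>Zero lies in both half lines, so the two restrictions together only dominate the
    integrand.\<close>
  moreover have "(\<integral>\<^sup>+x. ennreal (?f x) \<partial>lborel) \<le> (\<integral>\<^sup>+x. ennreal (?f x) * indicator {0..} x
    + ennreal (?f x) * indicator {0..} (- x) \<partial>lborel)"
    by (intro nn_integral_mono) (auto simp: indicator_def)
  ultimately show ?thesis by (rule le_less_trans[rotated])
qed

lemma decay_integrable: "integrable lborel (decay :: 'a::euclidean_space \<Rightarrow> real)"
proof (rule integrableI_bounded)
  have le: "decay x \<le> (\<Prod>b\<in>Basis. 1 / (1 + (x \<bullet> b)\<^sup>2))" for x :: 'a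
  proof -
    have "(\<Prod>b\<in>(Basis :: 'a set). 1 + (x \<bullet> b)\<^sup>2) \<le> (\<Prod>b\<in>(Basis :: 'a set). (1 + norm x)\<^sup>2)"
    proof (intro prod_mono conjI)
      fix b :: 'a assume "b \<in> Basis"
      then have "(x \<bullet> b)\<^sup>2 \<le> (norm x)\<^sup>2"
        using Basis_le_norm[of b x] by (simp add: abs_le_square_iff[symmetric])
      also have "\<dots> \<le> (norm x)\<^sup>2 + 2 * norm x" by simp
      finally show "1 + (x \<bullet> b)\<^sup>2 \<le> (1 + norm x)\<^sup>2" by (simp add: power2_sum)
    qed auto
    moreover have "0 < (\<Prod>b\<in>(Basis :: 'a set). 1 + (x \<bullet> b)\<^sup>2)"
      by (intro prod_pos) (auto intro: add_pos_nonneg)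
    ultimately show ?thesis
      unfolding decay_def by (simp add: prod_dividef power_mult frac_le)
  qed
  have "(\<integral>\<^sup>+x. ennreal (norm (decay x)) \<partial>(lborel :: 'a measure)) \<le> (\<integral>\<^sup>+x. (\<Prod>b\<in>Basis. ennreal (1 / (1
    + (x \<bullet> b)\<^sup>2))) \<partial>(lborel :: 'a measure))"
    using le by (intro nn_integral_mono) (subst prod_ennreal, auto simp: decay_def intro!: ennreal_leI)
  also have "\<dots> = (\<Prod>b\<in>(Basis :: 'a set). (\<integral>\<^sup>+x. ennreal (1 / (1 + x\<^sup>2)) \<partial>lborel))"
    by (intro nn_integral_lborel_prod) auto
  also have "\<dots> < \<infinity>"
    using nn_integral_inverse_one_plus_square by (simp add: power_less_top_ennreal)
  finally show "(\<integral>\<^sup>+x. ennreal (norm (decay x)) \<partial>(lborel :: 'a measure)) < \<infinity>" .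
  have "continuous_on UNIV (decay :: 'a \<Rightarrow> real)"
    unfolding decay_def
      by (intro continuous_intros) (metis add_nonneg_eq_0_iff norm_ge_zero power_eq_0_iff zero_le_one zero_neq_one)
  then show "(decay :: 'a \<Rightarrow> real) \<in> borel_measurable lborel"
    by (simp add: borel_measurable_continuous_onI)
qed

lemma decay_pos: "0 < decay x"
  by (simp add: decay_def add_pos_nonneg)

lemma decay_integral_nonneg: "0 \<le> (LINT x|lborel. decay x)"
  by (intro integral_nonneg_AE) (simp add: decay_pos less_imp_le)

lemma le_decayI: "(1 + norm x) ^ (2 * DIM('a)) * y \<le> M \<Longrightarrow> y \<le> M * decay (x :: 'a::euclidean_space)"
proof -
  assume "(1 + norm x) ^ (2 * DIM('a)) * y \<le> M"
  moreover have "0 < (1 + norm x) ^ (2 * DIM('a))" by (simp add: add_pos_nonneg)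
  ultimately show ?thesis unfolding decay_def by (simp add: field_simps)
qed

lemma
  fixes f :: "'a::euclidean_space \<Rightarrow> 'b::{banach, second_countable_topology}"
  assumes m: "f \<in> borel_measurable borel"
    and M: "\<And>x. (1 + norm x) ^ (2 * DIM('a)) * norm (f x) \<le> M"
  shows decay_bounded_integrable: "integrable lborel f"
    and decay_bounded_integral: "(LINT x|lborel. norm (f x)) \<le> M * (LINT x|lborel. decay (x :: 'a))"
proof -
  have le: "norm (f x) \<le> M * decay x" for x using le_decayI[OF M] .
  have i: "integrable lborel (\<lambda>x :: 'a. M * decay x)" by (intro integrable_mult_right decay_integrable)
  show *: "integrable lborel f"
    by (rule Bochner_Integration.integrable_bound[OF i])
      (use m le in \<open>auto intro!: order_trans[OF le abs_ge_self]\<close>)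
  have "(LINT x|lborel. norm (f x)) \<le> (LINT x|lborel. M * decay (x :: 'a))"
    using * i le by (intro integral_mono) auto
  then show "(LINT x|lborel. norm (f x)) \<le> M * (LINT x|lborel. decay (x :: 'a))" by simp
qed

lemma schwartz_integrable: "f \<in> schwartz \<Longrightarrow> integrable lborel f"
  using schwartz_bound[of f "2 * DIM('a)"
    for f :: "'a \<Rightarrow> complex"] decay_bounded_integrable schwartz_measurable by metis

lemma schwartz_weighted_integrable:
  fixes f :: "'a::euclidean_space \<Rightarrow> complex"
  assumes f: "f \<in> schwartz"
  shows "integrable lborel (\<lambda>x. (1 + norm x) ^ k * norm (f x))"
proof -
  obtain M where M: "\<And>x. (1 + norm x) ^ (2 * DIM('a) + k) * norm (f x) \<le> M"
    using schwartz_bound[OF f, of "2 * DIM('a) + k"] by blast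
  show ?thesis
  proof (rule decay_bounded_integrable)
    show "(\<lambda>x. (1 + norm x) ^ k * norm (f x)) \<in> borel_measurable borel"
      using schwartz_measurable[OF f] by measurable
    show "(1 + norm x) ^ (2 * DIM('a)) * norm ((1 + norm x) ^ k * norm (f x)) \<le> M" for x
      using M[of x] by (simp add: power_add abs_mult mult.assoc)
  qed
qed

section \<open>The Fourier transform and differentiation\<close>

lemma cis_approx: "norm (cis t - 1 - \<i> * of_real t) \<le> t\<^sup>2"
  using Taylor_exp[of "\<i> * of_real t" 1] by (simp add: cis_conv_exp norm_mult power2_eq_square algebra_simps)

lemma borel_measurable_cis [measurable]: "cis \<in> borel_measurable borel"
  by (intro borel_measurable_continuous_onI continuous_on_cis continuous_on_id)

lemma cis_integrable:
  fixes f :: "'a::euclidean_space \<Rightarrow> complex"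
  assumes "integrable lborel f"
  shows "integrable lborel (\<lambda>x. cis (- (x \<bullet> \<xi>)) * f x)"
  using assms by (rule Bochner_Integration.integrable_bound) (use assms in \<open>auto simp: norm_mult\<close>)

abbreviation fourier_const :: "'a::euclidean_space itself \<Rightarrow> real" where
  "fourier_const _ \<equiv> (2 * pi) powr (- real DIM('a) / 2)"

lemma fourier_norm_le:
  fixes f :: "'a::euclidean_space \<Rightarrow> complex"
  assumes "integrable lborel f"
  shows "norm (fourier f \<xi>) \<le> fourier_const TYPE('a) * (LINT x|lborel. norm (f x))"
  unfolding fourier_def norm_mult
  using integral_norm_bound[of lborel "\<lambda>x. cis (- (x \<bullet> \<xi>)) * f x"]
  by (auto intro!: mult_mono simp: norm_mult)

lemma fourier_lin:
  assumes "integrable lborel f" "integrable lborel g"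
  shows "fourier (\<lambda>x. c * f x + g x) \<xi> = c * fourier f \<xi> + fourier g \<xi>"
  using cis_integrable[OF assms(1), of \<xi>] cis_integrable[OF assms(2), of \<xi>]
  by (simp add: fourier_def distrib_left mult.left_commute[of _ c])

text \<open>Differentiation under the integral sign. By \<open>cis_approx\<close> the remainder is
  at most |h|^2 times a multiple of the second moment of \<open>f\<close>, so an explicit estimate
  replaces a convergence theorem.\<close>

lemma fourier_has_derivative:
  fixes f :: "'a::euclidean_space \<Rightarrow> complex"
  assumes f: "f \<in> schwartz"
  shows "(fourier f has_derivative (\<lambda>h. fourier (\<lambda>x. - \<i> * of_real (x \<bullet> h) * f x) \<xi>)) (at \<xi>)"
proof -
  let ?D = "\<lambda>h. fourier (\<lambda>x. - \<i> * of_real (x \<bullet> h) * f x) \<xi>"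
  let ?\<kappa> = "fourier_const TYPE('a)"
  note fi = schwartz_integrable[OF f]
  have xi: "integrable lborel (\<lambda>x. - \<i> * of_real (x \<bullet> h) * f x)" for h
    using schwartz_integrable[OF schwartz_mult[OF schwartz_mult_coord[OF f, of h], of "- \<i>"]]
      by (simp add: mult.assoc)
  have "linear ?D"
  proof (rule linearI)
    show "?D (x + y) = ?D x + ?D y" for x y
      using fourier_lin[OF xi[of x] xi[of y], of 1 \<xi>] by (simp add: inner_add_right algebra_simps)
    show "?D (c *\<^sub>R x) = c *\<^sub>R ?D x" for c x
      using fourier_lin[OF xi[of x] integrable_zero, of "of_real c" \<xi>]
      by (simp add: fourier_def scaleR_conv_of_real algebra_simps)
  qed
  define A where "A = ?\<kappa> * (LINT x|lborel. (norm x)\<^sup>2 * norm (f x))"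
  have x2: "integrable lborel (\<lambda>x. (norm x)\<^sup>2 * norm (f x))"
  proof (rule Bochner_Integration.integrable_bound[OF schwartz_weighted_integrable[OF f, of 2]])
    show "(\<lambda>x. (norm x)\<^sup>2 * norm (f x)) \<in> borel_measurable lborel"
      using schwartz_measurable[OF f] by simp
  qed (auto intro!: always_eventually mult_right_mono power_mono simp: abs_mult)
  have A: "A \<ge> 0" unfolding A_def by (intro mult_nonneg_nonneg integral_nonneg_AE) auto
  have est: "norm (fourier f (\<xi> + h) - fourier f \<xi> - ?D h) \<le> A * (norm h)\<^sup>2" for h
  proof -
    let ?g = "\<lambda>x. (cis (- (x \<bullet> h)) - 1 - \<i> * of_real (- (x \<bullet> h))) * f x"
    have le: "norm (?g x) \<le> (norm h)\<^sup>2 * ((norm x)\<^sup>2 * norm (f x))" for x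
    proof -
      have "norm (cis (- (x \<bullet> h)) - 1 - \<i> * of_real (- (x \<bullet> h))) \<le> (- (x \<bullet> h))\<^sup>2"
        by (rule cis_approx)
      also have "\<dots> \<le> (norm x * norm h)\<^sup>2"
        using Cauchy_Schwarz_ineq2[of x h] by (simp add: abs_le_square_iff[symmetric])
      finally have "norm (?g x) \<le> (norm x * norm h)\<^sup>2 * norm (f x)"
        unfolding norm_mult by (rule mult_right_mono) simp
      then show ?thesis by (simp add: power_mult_distrib mult_ac)
    qed
    have gi: "integrable lborel ?g"
      by (rule Bochner_Integration.integrable_bound[OF integrable_mult_right[OF x2, of "(norm h)\<^sup>2"]])
        (use schwartz_measurable[OF f] le in \<open>auto intro!: order_trans[OF le]\<close>)
    have "fourier f (\<xi> + h) - fourier f \<xi> - ?D h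
        = of_real ?\<kappa> * (LINT x|lborel. cis (- (x \<bullet> (\<xi> + h))) * f x - cis (- (x \<bullet> \<xi>)) * f x
            - cis (- (x \<bullet> \<xi>)) * (- \<i> * of_real (x \<bullet> h) * f x))"
      unfolding fourier_def
        by (subst Bochner_Integration.integral_diff, intro Bochner_Integration.integrable_diff cis_integrable fi xi, intro cis_integrable xi,
         subst Bochner_Integration.integral_diff, intro cis_integrable fi, intro cis_integrable fi, simp add: algebra_simps)
    also have "\<dots> = fourier ?g \<xi>"
      unfolding fourier_def by (intro arg_cong2[where f = "(*)"] refl Bochner_Integration.integral_cong)
        (auto simp: inner_add_right algebra_simps cis_mult)
    finally have "norm (fourier f (\<xi> + h) - fourier f \<xi> - ?D h) \<le> ?\<kappa> * (LINT x|lborel. norm (?g x))"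
      using fourier_norm_le[OF gi, of \<xi>] by simp
    also have "\<dots> \<le> ?\<kappa> * (LINT x|lborel. (norm h)\<^sup>2 * ((norm x)\<^sup>2 * norm (f x)))"
      by (intro mult_left_mono integral_mono integrable_norm gi integrable_mult_right x2 le) auto
    also have "\<dots> = A * (norm h)\<^sup>2" unfolding A_def integral_mult_right_zero by (simp only: mult_ac)
    finally show ?thesis .
  qed
  show ?thesis
    unfolding has_derivative_at_alt
  proof (intro conjI allI impI)
    show "bounded_linear ?D" using \<open>linear ?D\<close> by (simp add: linear_conv_bounded_linear)
    fix e :: real assume e: "e > 0"
    \<comment> \<open>The radius e / (A + 1) also covers the case A = 0.\<close>
    have "norm (fourier f y - fourier f \<xi> - ?D (y - \<xi>)) \<le> e * norm (y - \<xi>)"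
      if y: "norm (y - \<xi>) < e / (A + 1)" for y
    proof -
      have "norm (fourier f y - fourier f \<xi> - ?D (y - \<xi>)) \<le> (A * norm (y - \<xi>)) * norm (y - \<xi>)"
        using est[of "y - \<xi>"] by (simp add: power2_eq_square mult_ac)
      also have "\<dots> \<le> e * norm (y - \<xi>)"
      proof (intro mult_right_mono)
        have "A * norm (y - \<xi>) \<le> (A + 1) * norm (y - \<xi>)" by (intro mult_right_mono) auto
        also have "\<dots> \<le> e" using y A by (simp add: field_simps)
        finally show "A * norm (y - \<xi>) \<le> e" .
      qed simp
      finally show ?thesis .
    qed
    then show "\<exists>d>0. \<forall>y. norm (y - \<xi>) < d \<longrightarrow> norm (fourier f y - fourier f \<xi> - ?D (y - \<xi>)) \<le> e * norm (y - \<xi>)"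
      using e A by (intro exI[of _ "e / (A + 1)"]) auto
  qed
qed

lemma lborel_integral_translate:
  fixes f :: "'a::euclidean_space \<Rightarrow> 'b::{banach, second_countable_topology}"
  assumes "f \<in> borel_measurable borel"
  shows "(LINT x|lborel. f (a + x)) = (LINT x|lborel. f x)"
  by (subst (2) lborel_distr_plus[of a, symmetric], subst integral_distr) (use assms in auto)

text \<open>The mean value inequality on a segment in direction \<open>b\<close>. It provides the
  dominating function for the difference quotients in \<open>fourier_dirderiv\<close>.\<close>

lemma schwartz_line_increment:
  fixes f :: "'a::euclidean_space \<Rightarrow> complex"
  assumes f: "f \<in> schwartz" and b: "b \<in> Basis" and t: "0 < t"
    and B: "\<And>\<tau>. 0 \<le> \<tau> \<Longrightarrow> \<tau> \<le> t \<Longrightarrow> norm (dirderiv b f (x + \<tau> *\<^sub>R b)) \<le> B"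
  shows "norm (f (x + t *\<^sub>R b) - f x) \<le> B * t"
proof -
  have "norm ((\<lambda>\<tau>. f (x + \<tau> *\<^sub>R b)) t - (\<lambda>\<tau>. f (x + \<tau> *\<^sub>R b)) 0) \<le> B * norm (t - 0)"
  proof (rule differentiable_bound[where S = "{0..t}" and f' = "\<lambda>\<tau> s. s *\<^sub>R dirderiv b f (x + \<tau> *\<^sub>R b)"])
    fix \<tau> assume \<tau>: "\<tau> \<in> {0..t}"
    have d: "(f has_derivative frechet_derivative f (at (x + \<tau> *\<^sub>R b))) (at (x + \<tau> *\<^sub>R b))"
      using smooth_has_derivative[OF schwartz_smooth[OF f]] .
    have "((\<lambda>\<tau>. f (x + \<tau> *\<^sub>R b)) has_derivative (\<lambda>s. frechet_derivative f (at (x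
      + \<tau> *\<^sub>R b)) (s *\<^sub>R b))) (at \<tau> within {0..t})"
      by (rule has_derivative_compose[where g = f and f = "\<lambda>\<tau>. x
        + \<tau> *\<^sub>R b", OF _ d]) (auto intro!: derivative_eq_intros)
    then show "((\<lambda>\<tau>. f (x + \<tau> *\<^sub>R b)) has_derivative (\<lambda>s. s *\<^sub>R dirderiv b f (x
      + \<tau> *\<^sub>R b))) (at \<tau> within {0..t})"
      using has_derivative_linear[OF d] by (simp add: linear_cmul)
    show "onorm (\<lambda>s. s *\<^sub>R dirderiv b f (x + \<tau> *\<^sub>R b)) \<le> B"
    proof (rule onorm_le)
      show "norm (s *\<^sub>R dirderiv b f (x + \<tau> *\<^sub>R b)) \<le> B * norm s" for s
        using mult_left_mono[OF B[of \<tau>], of "\<bar>s\<bar>"] \<tau> by (simp add: mult.commute)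
    qed
  qed (use t in auto)
  then show ?thesis using t by simp
qed

text \<open>Translation by \<open>t *\<^sub>R b\<close> multiplies the Fourier transform by \<open>cis (t * (b \<bullet> \<xi>))\<close>. Passing to the
  limit in the difference quotients replaces an integration by parts.\<close>

lemma fourier_dirderiv:
  fixes f :: "'a::euclidean_space \<Rightarrow> complex"
  assumes f: "f \<in> schwartz" and b: "b \<in> Basis"
  shows "fourier (dirderiv b f) \<xi> = \<i> * of_real (\<xi> \<bullet> b) * fourier f \<xi>"
proof -
  define t where "t n = 1 / real (Suc n)" for n
  have t: "0 < t n" "t n \<le> 1" for n by (auto simp: t_def)
  have t0: "t \<longlonglongrightarrow> 0" unfolding t_def using LIMSEQ_inverse_real_of_nat by (simp add: inverse_eq_divide)
  note fi = schwartz_integrable[OF f]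
  let ?n = "2 * DIM('a)"
  obtain M where M: "\<And>x. (1 + norm x) ^ ?n * norm (dirderiv b f x) \<le> M"
    using schwartz_bound[OF schwartz_dirderiv[OF f b], of ?n] by blast
  let ?q = "\<lambda>n x. cis (- (x \<bullet> \<xi>)) * ((f (x + t n *\<^sub>R b) - f x) / of_real (t n))"
  have fm: "f \<in> borel_measurable borel" using schwartz_measurable[OF f] .
  have lim: "(\<lambda>n. LINT x|lborel. ?q n x) \<longlonglongrightarrow> (LINT x|lborel. cis (- (x \<bullet> \<xi>)) * dirderiv b f x)"
  proof (rule integral_dominated_convergence[where w = "\<lambda>x. (2 ^ ?n * M) * decay x"])
    show "(\<lambda>x. cis (- (x \<bullet> \<xi>)) * dirderiv b f x) \<in> borel_measurable lborel"
      using schwartz_measurable[OF schwartz_dirderiv[OF f b]] by simp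
    show "?q n \<in> borel_measurable lborel" for n
      using fm by (simp add: borel_measurable_divide)
    show "integrable lborel (\<lambda>x :: 'a. (2 ^ ?n * M) * decay x)"
      by (intro integrable_mult_right decay_integrable)
    show "AE x in lborel. (\<lambda>n. ?q n x) \<longlonglongrightarrow> cis (- (x \<bullet> \<xi>)) * dirderiv b f x"
    proof (intro AE_I2 tendsto_mult tendsto_const)
      fix x :: 'a
      have D: "(f has_derivative frechet_derivative f (at x)) (at x)"
        using smooth_has_derivative[OF schwartz_smooth[OF f]] .
      have "((\<lambda>h. norm (f (x + h) - f x - frechet_derivative f (at x) h) / norm h) \<longlongrightarrow> 0) (at 0)"
        using D unfolding has_derivative_at by blast
      moreover have "filterlim (\<lambda>n. t n *\<^sub>R b) (at 0) sequentially"
        unfolding filterlim_at using t0 t b less_imp_neq[OF t(1)]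
        by (auto intro!: always_eventually tendsto_eq_intros simp: nonzero_Basis)
      ultimately have "((\<lambda>n. norm (f (x
        + t n *\<^sub>R b) - f x - frechet_derivative f (at x) (t n *\<^sub>R b)) / norm (t n *\<^sub>R b)) \<longlongrightarrow> 0) sequentially"
        by (rule filterlim_compose)
      moreover have "norm (f (x
        + t n *\<^sub>R b) - f x - frechet_derivative f (at x) (t n *\<^sub>R b)) / norm (t n *\<^sub>R b)
          = norm ((f (x + t n *\<^sub>R b) - f x) / of_real (t n) - dirderiv b f x)" for n
      proof -
        have "(f (x + t n *\<^sub>R b) - f x) / of_real (t n) - dirderiv b f x = (f (x
          + t n *\<^sub>R b) - f x - frechet_derivative f (at x) (t n *\<^sub>R b)) / of_real (t n)"
          using t(1)[of n] has_derivative_linear[OF D]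
            by (simp add: linear_cmul scaleR_conv_of_real field_simps)
        then show ?thesis using t(1)[of n] b by (simp add: norm_divide)
      qed
      ultimately have "(\<lambda>n. norm ((f (x + t n *\<^sub>R b) - f x) / of_real (t n) - dirderiv b f x)) \<longlonglongrightarrow> 0" by simp
      then show "(\<lambda>n. (f (x + t n *\<^sub>R b) - f x) / of_real (t n)) \<longlonglongrightarrow> dirderiv b f x"
        by (rule LIM_zero_cancel[OF tendsto_norm_zero_cancel])
    qed
    show "AE x in lborel. norm (?q n x) \<le> (2 ^ ?n * M) * decay x" for n
    proof (intro AE_I2)
      fix x :: 'a
      \<comment> \<open>As \<tau> is at most 1, 1 + |x| <= 2 (1 + |x + \<tau> b|). Raised to the
        power \<open>?n\<close>, this costs the factor \<open>2 ^ ?n\<close>.\<close>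
      have "norm (dirderiv b f (x + \<tau> *\<^sub>R b)) \<le> (2 ^ ?n * M) * decay x" if "0 \<le> \<tau>" "\<tau> \<le> t n" for \<tau>
      proof (rule le_decayI)
        have "\<tau> \<le> 1" using that t(2)[of n] by linarith
        have aux: "1 + p \<le> 2 * (1 + q)" if "p \<le> q + r * 1" "0 \<le> q" "r \<le> 1" for p q r :: real
          using that by simp
        have "norm x \<le> norm (x + \<tau> *\<^sub>R b) + norm (\<tau> *\<^sub>R b)"
          using norm_triangle_ineq4[of "x + \<tau> *\<^sub>R b" "\<tau> *\<^sub>R b"] by simp
        then have "1 + norm x \<le> 2 * (1 + norm (x + \<tau> *\<^sub>R b))"
          using norm_ge_zero[of "x + \<tau> *\<^sub>R b"] \<open>\<tau> \<le> 1\<close>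
          unfolding norm_scaleR norm_Basis[OF b] abs_of_nonneg[OF that(1)]
          using aux by blast
        then have "(1 + norm x) ^ ?n * norm (dirderiv b f (x + \<tau> *\<^sub>R b)) \<le> (2 * (1 + norm (x
          + \<tau> *\<^sub>R b))) ^ ?n * norm (dirderiv b f (x + \<tau> *\<^sub>R b))"
          by (intro mult_right_mono power_mono) auto
        also have "\<dots> = 2 ^ ?n * ((1 + norm (x + \<tau> *\<^sub>R b)) ^ ?n * norm (dirderiv b f (x + \<tau> *\<^sub>R b)))"
          unfolding power_mult_distrib by simp
        also have "\<dots> \<le> 2 ^ ?n * M" by (intro mult_left_mono M) auto
        finally show "(1 + norm x) ^ ?n * norm (dirderiv b f (x + \<tau> *\<^sub>R b)) \<le> 2 ^ ?n * M" .
      qed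
      from schwartz_line_increment[OF f b t(1)[of n] this]
      show "norm (?q n x) \<le> (2 ^ ?n * M) * decay x"
        using t(1)[of n] by (simp add: norm_mult norm_divide pos_divide_le_eq)
    qed
  qed
  have eq: "(LINT x|lborel. ?q n x)
    = (cis (t n * (b \<bullet> \<xi>)) - 1) / of_real (t n) * (LINT x|lborel. cis (- (x \<bullet> \<xi>)) * f x)" for n
  proof -
    let ?h = "\<lambda>x. cis (- ((x - t n *\<^sub>R b) \<bullet> \<xi>)) * f x"
    have h: "?h = (\<lambda>x. cis (t n * (b \<bullet> \<xi>)) * (cis (- (x \<bullet> \<xi>)) * f x))"
      by (auto simp: fun_eq_iff inner_diff_left cis_mult mult.assoc[symmetric])
    have tr: "(LINT x|lborel. cis (- (x \<bullet> \<xi>)) * f (x + t n *\<^sub>R b)) = (LINT x|lborel. ?h x)"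
      using lborel_integral_translate[of ?h "t n *\<^sub>R b"] fm by (simp add: add.commute)
    have i: "integrable lborel (\<lambda>x. cis (- (x \<bullet> \<xi>)) * f (x + t n *\<^sub>R b))"
      using cis_integrable[OF schwartz_integrable[OF schwartz_affine[OF f, of 1 "t n *\<^sub>R b"]], of \<xi>]
        by (simp add: add.commute)
    have "(LINT x|lborel. ?q n x) = (LINT x|lborel. (cis (- (x \<bullet> \<xi>)) * f (x
      + t n *\<^sub>R b) - cis (- (x \<bullet> \<xi>)) * f x) / of_real (t n))"
      by (simp add: field_simps)
    also have "\<dots> = ((LINT x|lborel. ?h x) - (LINT x|lborel. cis (- (x \<bullet> \<xi>)) * f x)) / of_real (t n)"
      by (simp add: i cis_integrable[OF fi] tr)
    also have "(LINT x|lborel. ?h x) = cis (t n * (b \<bullet> \<xi>)) * (LINT x|lborel. cis (- (x \<bullet> \<xi>)) * f x)"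
      unfolding h by simp
    finally show ?thesis by (simp add: field_simps)
  qed
  have "(\<lambda>n. (cis (t n * (b \<bullet> \<xi>)) - 1) / of_real (t n)) \<longlonglongrightarrow> \<i> * of_real (b \<bullet> \<xi>)"
  proof (rule LIM_zero_cancel, rule Lim_null_comparison)
    show "\<forall>\<^sub>F n in sequentially. norm ((cis (t n * (b \<bullet> \<xi>)) - 1) / of_real (t n) - \<i> * of_real (b \<bullet> \<xi>))
      \<le> t n * (b \<bullet> \<xi>)\<^sup>2"
    proof (intro always_eventually allI)
      fix n
      have "(cis (t n * (b \<bullet> \<xi>)) - 1) / of_real (t n) - \<i> * of_real (b \<bullet> \<xi>)
          = (cis (t n * (b \<bullet> \<xi>)) - 1 - \<i> * of_real (t n * (b \<bullet> \<xi>))) / of_real (t n)"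
        using t(1)[of n] by (simp add: field_simps)
      then show "norm ((cis (t n * (b \<bullet> \<xi>)) - 1) / of_real (t n) - \<i> * of_real (b \<bullet> \<xi>)) \<le> t n * (b \<bullet> \<xi>)\<^sup>2"
        using divide_right_mono[OF cis_approx[of "t n * (b \<bullet> \<xi>)"], of "t n"] t(1)[of n]
        by (simp add: norm_divide power2_eq_square mult_ac)
    qed
    show "(\<lambda>n. t n * (b \<bullet> \<xi>)\<^sup>2) \<longlonglongrightarrow> 0" using t0 by (intro tendsto_mult_left_zero)
  qed
  from tendsto_mult[OF this tendsto_const]
  have "(\<lambda>n. (cis (t n * (b \<bullet> \<xi>)) - 1) / of_real (t n) * (LINT x|lborel. cis (- (x \<bullet> \<xi>)) * f x))
    \<longlonglongrightarrow> \<i> * of_real (b \<bullet> \<xi>) * (LINT x|lborel. cis (- (x \<bullet> \<xi>)) * f x)" .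
  then have "(LINT x|lborel. cis (- (x \<bullet> \<xi>)) * dirderiv b f x)
    = \<i> * of_real (b \<bullet> \<xi>) * (LINT x|lborel. cis (- (x \<bullet> \<xi>)) * f x)"
    by (rule LIMSEQ_unique[OF lim[unfolded eq]])
  then show ?thesis unfolding fourier_def by (simp add: inner_commute)
qed

text \<open>Powers of |\<xi>| are traded for derivatives: 1 + |\<xi>| is at most 1 plus the sum of
  the |\<xi> \<bullet> b|, and each of these factors is absorbed by \<open>fourier_dirderiv\<close>.
  In the order of the seminorm, \<open>2 * DIM('a)\<close> accounts for integrability and
  \<open>k\<close> for the derivatives. That \<open>C\<close> does not depend on \<open>f\<close> is
  what later makes functionals built from the transform continuous.\<close>

lemma fourier_decay:
  "\<exists>C\<ge>0. \<forall>f\<in>schwartz. \<forall>\<xi>::'a::euclidean_space.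
     (1 + norm \<xi>) ^ k * norm (fourier f \<xi>) \<le> C * schwartz_norm (2 * DIM('a) + k) f"
proof (induction k)
  case 0
  let ?C = "fourier_const TYPE('a) * (LINT x|lborel. decay (x :: 'a))"
  have "norm (fourier f \<xi>) \<le> ?C * schwartz_norm (2 * DIM('a)) f" if f: "f \<in> schwartz" for f and \<xi> :: 'a
  proof -
    have "norm (fourier f \<xi>) \<le> fourier_const TYPE('a) * (LINT x|lborel. norm (f x))"
      by (rule fourier_norm_le[OF schwartz_integrable[OF f]])
    also have "\<dots>
      \<le> fourier_const TYPE('a) * (schwartz_norm (2 * DIM('a)) f * (LINT x|lborel. decay (x :: 'a)))"
      by (intro mult_left_mono decay_bounded_integral schwartz_measurable schwartz_norm_weighted f) auto
    finally show ?thesis by (simp add: mult_ac)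
  qed
  then show ?case by (intro exI[of _ ?C]) (auto simp: decay_integral_nonneg)
next
  case (Suc k)
  then obtain C where C: "C \<ge> 0" "\<And>f \<xi>. f \<in> schwartz \<Longrightarrow>
     (1 + norm (\<xi>::'a)) ^ k * norm (fourier f \<xi>) \<le> C * schwartz_norm (2 * DIM('a) + k) f" by blast
  let ?N = "2 * DIM('a) + Suc k"
  have "(1 + norm \<xi>) ^ Suc k * norm (fourier f \<xi>) \<le> (C + real DIM('a) * C) * schwartz_norm ?N f"
    if f: "f \<in> schwartz" for f and \<xi> :: 'a
  proof -
    have "norm \<xi> \<le> (\<Sum>b\<in>Basis. \<bar>\<xi> \<bullet> b\<bar>)" by (rule norm_le_l1)
    then have "(1 + norm \<xi>) ^ Suc k * norm (fourier f \<xi>) \<le> (1 + (\<Sum>b\<in>Basis. \<bar>\<xi> \<bullet> b\<bar>)) * ((1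
      + norm \<xi>) ^ k * norm (fourier f \<xi>))"
      unfolding power_Suc mult.assoc by (intro mult_right_mono) auto
    also have "\<dots> = (1 + norm \<xi>) ^ k * norm (fourier f \<xi>) + (\<Sum>b\<in>Basis. (1
      + norm \<xi>) ^ k * norm (fourier (dirderiv b f) \<xi>))"
      by (simp add: fourier_dirderiv[OF f] norm_mult algebra_simps sum_distrib_left sum_distrib_right)
    also have "\<dots> \<le> C * schwartz_norm ?N f + (\<Sum>b\<in>(Basis::'a set). C * schwartz_norm ?N f)"
    proof (intro add_mono sum_mono)
      show "(1 + norm \<xi>) ^ k * norm (fourier f \<xi>) \<le> C * schwartz_norm ?N f"
        by (intro order_trans[OF C(2)[OF f]] mult_left_mono schwartz_norm_mono f C) auto
      show "(1 + norm \<xi>) ^ k * norm (fourier (dirderiv b f) \<xi>)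
        \<le> C * schwartz_norm ?N f" if b: "b \<in> Basis" for b
        using order_trans[OF C(2)[OF schwartz_dirderiv[OF f b]] mult_left_mono[OF schwartz_norm_dirderiv[OF f b] C(1)]]
        by simp
    qed
    finally show ?thesis by (simp add: algebra_simps)
  qed
  then show ?case using C(1) by (intro exI[of _ "C + real DIM('a) * C"]) auto
qed

lemma fourier_schwartz:
  fixes f :: "'a::euclidean_space \<Rightarrow> complex"
  assumes f: "f \<in> schwartz"
  shows "fourier f \<in> schwartz"
proof (rule schwartz_if_closed_class)
  \<comment> \<open>The range of the transform is its own closed class: a derivative of
    \<open>fourier f\<close> is the transform of \<open>f\<close> multiplied by a coordinate and -
    \<i>.\<close>
  let ?C = "fourier ` (schwartz :: ('a \<Rightarrow> complex) set)"
  show "fourier f \<in> ?C" using f by blast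
  fix k and g :: "'a \<Rightarrow> complex" assume "g \<in> ?C"
  then obtain f where g: "g = fourier f" and f: "f \<in> schwartz" by blast
  note D = fourier_has_derivative[OF f]
  show "g differentiable (at x)" for x using D g differentiable_def by blast
  show "dirderiv b g \<in> ?C" for b
  proof -
    have "(\<lambda>x. - \<i> * of_real (x \<bullet> b) * f x) \<in> schwartz"
      using schwartz_mult[OF schwartz_mult_coord[OF f, of b], of "- \<i>"] by (simp add: mult.assoc)
    then show ?thesis unfolding g frechet_derivative_at[OF D, symmetric] by (rule imageI)
  qed
  show "\<exists>M. \<forall>x. (1 + norm x) ^ k * norm (g x) \<le> M"
    using fourier_decay[where 'a = 'a, of k] f unfolding g by blast
qed

section \<open>Fourier inversion\<close>

text \<open>The transform of the Gaussian satisfies the same first order differential equation as the Gaussian.\<close>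

lemma fourier_gauss:
  fixes \<xi> :: "'a::euclidean_space"
  shows "fourier gauss \<xi> = fourier gauss (0 :: 'a) * gauss \<xi>"
proof -
  let ?D = "\<lambda>\<xi> h. fourier (\<lambda>x :: 'a. - \<i> * of_real (x \<bullet> h) * gauss x) \<xi>"
  have g: "(fourier gauss has_derivative ?D \<xi>) (at \<xi>)" for \<xi> :: 'a
    by (rule fourier_has_derivative[OF gauss_schwartz])
  have "?D \<xi> b = - complex_of_real (\<xi> \<bullet> b) * fourier gauss \<xi>" if b: "b \<in> Basis" for b \<xi> :: 'a
  proof -
    have "(\<lambda>x. - \<i> * of_real (x \<bullet> b) * gauss x) = (\<lambda>x. \<i> * dirderiv b gauss x + 0)"
      unfolding frechet_derivative_at[OF gauss_has_derivative, symmetric] by (simp add: mult.assoc)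
    then have "?D \<xi> b = \<i> * fourier (dirderiv b gauss) \<xi> + fourier (\<lambda>_. 0) \<xi>"
      using fourier_lin[OF schwartz_integrable[OF schwartz_dirderiv[OF gauss_schwartz b]] integrable_zero, of \<i> \<xi>]
      by simp
    also have "\<dots> = - complex_of_real (\<xi> \<bullet> b) * fourier gauss \<xi>"
      unfolding fourier_dirderiv[OF gauss_schwartz b] by (simp add: fourier_def mult.assoc[symmetric])
    finally show ?thesis .
  qed
  then have D: "?D \<xi> = (\<lambda>h. - complex_of_real (\<xi> \<bullet> h) * fourier gauss \<xi>)" for \<xi> :: 'a
    by (intro linear_eq_stdbasis has_derivative_linear[OF g] linearI)
      (auto simp: inner_add_right algebra_simps scaleR_conv_of_real)
  \<comment> \<open>The quotient of the transform by the Gaussian. The differential equation makes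
    its derivative vanish, so it is constant.\<close>
  let ?R = "\<lambda>\<xi> :: 'a. fourier gauss \<xi> * of_real (exp (\<xi> \<bullet> \<xi> / 2))"
  have "(?R has_derivative (\<lambda>h. 0)) (at \<xi> within UNIV)" for \<xi>
    using g[of \<xi>, unfolded D] by (auto intro!: derivative_eq_intros simp: inner_commute algebra_simps)
  then have "?R \<xi> = ?R 0"
    using has_derivative_zero_constant[OF convex_UNIV, of ?R] by (metis UNIV_I)
  then have "fourier gauss \<xi> = fourier gauss (0 :: 'a) / of_real (exp (\<xi> \<bullet> \<xi> / 2))" by (simp add: field_simps)
  moreover have "gauss \<xi> = inverse (of_real (exp (\<xi> \<bullet> \<xi> / 2)))"
    by (simp add: gauss_def exp_minus)
  ultimately show ?thesis by (metis divide_inverse)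
qed

definition gauss_integral :: "'a::euclidean_space itself \<Rightarrow> real" where
  "gauss_integral _ = (LINT x|lborel. exp (- ((x::'a) \<bullet> x) / 2))"


lemma gauss_real_integrable: "integrable lborel (\<lambda>x::'a::euclidean_space. exp (- (x \<bullet> x) / 2))"
  using integrable_Re[OF schwartz_integrable[OF gauss_schwartz]] by (simp add: gauss_def)

lemma integral_gauss: "(LINT x|lborel. gauss (x::'a::euclidean_space)) = of_real (gauss_integral TYPE('a))"
  unfolding gauss_def gauss_integral_def by (rule integral_complex_of_real)

lemma gauss_integral_pos: "0 < gauss_integral TYPE('a::euclidean_space)"
proof -
  have "gauss_integral TYPE('a) \<noteq> 0"
  proof
    assume "gauss_integral TYPE('a) = 0"
    then have "AE x in (lborel :: 'a measure). exp (- (x \<bullet> x) / 2) = 0"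
      unfolding gauss_integral_def
      by (subst (asm) integral_nonneg_eq_0_iff_AE[OF gauss_real_integrable]) auto
    then obtain N where "N \<in> null_sets (lborel :: 'a measure)" "UNIV \<subseteq> N"
      unfolding eventually_ae_filter by auto
    then have "emeasure (lborel :: 'a measure) UNIV = 0"
      by (metis null_setsD1 top.extremum_uniqueI)
    then show False by simp
  qed
  moreover have "0 \<le> gauss_integral TYPE('a)" unfolding gauss_integral_def by (intro integral_nonneg_AE) auto
  ultimately show ?thesis by simp
qed

text \<open>The constant is in fact \<open>1\<close>; only its positivity matters below, which saves the evaluation of the
  Gaussian integral.\<close>

definition inversion_const :: "'a::euclidean_space itself \<Rightarrow> real" where
  "inversion_const _ = (fourier_const TYPE('a) * gauss_integral TYPE('a))\<^sup>2"

lemma inversion_const_pos: "0 < inversion_const TYPE('a::euclidean_space)"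
  unfolding inversion_const_def using gauss_integral_pos[where 'a='a] by simp

text \<open>Fubini for a kernel that is symmetric in x and \<xi>. Stating it for integrable
  functions, beyond the Schwartz space, allows its use in
  \<open>AE_zero_if_schwartz_orthogonal\<close>.\<close>

lemma fourier_multiplication_formula:
  fixes f g :: "'a::euclidean_space \<Rightarrow> complex"
  assumes f: "integrable lborel f" and g: "integrable lborel g"
  shows "(LINT x|lborel. f x * fourier g x) = (LINT x|lborel. fourier f x * g x)"
proof -
  note [measurable] = borel_measurable_integrable[OF f] borel_measurable_integrable[OF g]
  let ?h = "\<lambda>x \<xi>. cis (- (x \<bullet> \<xi>)) * f x * g \<xi>"
  have "integrable (lborel \<Otimes>\<^sub>M lborel) (\<lambda>(x, \<xi>). ?h x \<xi>)"
  proof (rule lborel_pair.Fubini_integrable)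
    show "(\<lambda>(x, \<xi>). ?h x \<xi>) \<in> borel_measurable (lborel \<Otimes>\<^sub>M lborel)" by measurable
    show "integrable lborel (\<lambda>x. LINT y|lborel. norm (case (x, y) of (x, \<xi>) \<Rightarrow> ?h x \<xi>))"
      using integrable_norm[OF f] by (simp add: norm_mult)
    show "AE x in lborel. integrable lborel (\<lambda>y. case (x, y) of (x, \<xi>) \<Rightarrow> ?h x \<xi>)"
    proof (intro AE_I2)
      fix x
      have "integrable lborel (\<lambda>\<xi>. f x * (cis (- (\<xi> \<bullet> x)) * g \<xi>))"
        by (intro integrable_mult_right cis_integrable g)
      then show "integrable lborel (\<lambda>y. case (x, y) of (x, \<xi>) \<Rightarrow> ?h x \<xi>)"
        by (simp add: inner_commute mult_ac)
    qed
  qed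
  from lborel_pair.Fubini_integral[OF this]
  have "(LINT \<xi>|lborel. LINT x|lborel. ?h x \<xi>) = (LINT x|lborel. LINT \<xi>|lborel. ?h x \<xi>)" .
  moreover have "(LINT x|lborel. f x * fourier g x)
    = of_real (fourier_const TYPE('a)) * (LINT x|lborel. LINT \<xi>|lborel. ?h x \<xi>)"
  proof -
    have "?h x = (\<lambda>\<xi>. f x * (cis (- (\<xi> \<bullet> x)) * g \<xi>))" for x
      by (simp add: fun_eq_iff inner_commute mult_ac)
    then have "f x * fourier g x = of_real (fourier_const TYPE('a)) * (LINT \<xi>|lborel. ?h x \<xi>)" for x
      by (simp only: fourier_def integral_mult_right_zero mult.left_commute)
    then show ?thesis by simp
  qed
  moreover have "(LINT x|lborel. fourier f x * g x)
    = of_real (fourier_const TYPE('a)) * (LINT \<xi>|lborel. LINT x|lborel. ?h x \<xi>)"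
  proof -
    have "fourier f \<xi> * g \<xi> = of_real (fourier_const TYPE('a)) * (LINT x|lborel. ?h x \<xi>)" for \<xi>
      unfolding integral_mult_left_zero fourier_def by (rule mult.assoc)
    then show ?thesis by (simp only: integral_mult_right_zero)
  qed
  ultimately show ?thesis by simp
qed

lemma lborel_integral_scale:
  fixes f :: "'a::euclidean_space \<Rightarrow> 'b::{banach, second_countable_topology}"
  assumes c: "c \<noteq> 0" and f [measurable]: "f \<in> borel_measurable borel"
  shows "(LINT x|lborel. f x) = \<bar>c\<bar> ^ DIM('a) *\<^sub>R (LINT x|lborel. f (c *\<^sub>R x))"
  by (subst lborel_affine[OF c, of 0], subst integral_density, simp, simp, simp, subst integral_distr, simp, simp, simp)

lemma fourier_scale:
  fixes f :: "'a::euclidean_space \<Rightarrow> complex"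
  assumes c: "c \<noteq> 0" and f [measurable]: "f \<in> borel_measurable borel"
  shows "\<bar>c\<bar> ^ DIM('a) *\<^sub>R fourier (\<lambda>x. f (c *\<^sub>R x)) \<xi> = fourier f ((1 / c) *\<^sub>R \<xi>)"
  unfolding fourier_def
  using lborel_integral_scale[OF c, of "\<lambda>x. cis (- (x \<bullet> ((1 / c) *\<^sub>R \<xi>))) * f x"] c
  by (simp add: scaleR_conv_of_real mult_ac)

lemma fourier_translate:
  fixes f :: "'a::euclidean_space \<Rightarrow> complex"
  assumes f [measurable]: "f \<in> borel_measurable borel"
  shows "fourier (\<lambda>x. f (a + x)) \<xi> = cis (a \<bullet> \<xi>) * fourier f \<xi>"
proof -
  let ?F = "\<lambda>y. cis (- ((y - a) \<bullet> \<xi>)) * f y"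
  have "(LINT x|lborel. cis (- (x \<bullet> \<xi>)) * f (a + x)) = (LINT x|lborel. ?F x)"
    using lborel_integral_translate[of ?F a] by simp
  also have "?F = (\<lambda>y. cis (a \<bullet> \<xi>) * (cis (- (y \<bullet> \<xi>)) * f y))"
    by (auto simp: fun_eq_iff inner_diff_left cis_mult mult.assoc[symmetric])
  finally show ?thesis by (simp add: fourier_def)
qed

text \<open>The multiplication formula for \<open>f (t *\<^sub>R x)\<close> and the Gaussian, in the limit \<open>t \<rightarrow> 0\<close>.\<close>

lemma fourier_fourier_zero:
  fixes f :: "'a::euclidean_space \<Rightarrow> complex"
  assumes f: "f \<in> schwartz"
  shows "fourier (fourier f) 0 = of_real (inversion_const TYPE('a)) * f 0"
proof -
  define t where "t n = 1 / real (Suc n)" for n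
  have t: "t n \<noteq> 0" for n by (auto simp: t_def)
  have t0: "t \<longlonglongrightarrow> 0" unfolding t_def using LIMSEQ_inverse_real_of_nat by (simp add: inverse_eq_divide)
  note fs = fourier_schwartz[OF f]
  have [measurable]: "f \<in> borel_measurable borel" "fourier f \<in> borel_measurable borel"
    "gauss \<in> borel_measurable (borel :: 'a measure)" "fourier gauss \<in> borel_measurable (borel :: 'a measure)"
    using f fs gauss_schwartz schwartz_measurable fourier_schwartz by auto
  have fg: "fourier (gauss :: 'a \<Rightarrow> complex) = (\<lambda>\<xi>. fourier gauss (0 :: 'a) * gauss \<xi>)"
    using fourier_gauss by blast
  obtain M where M: "\<And>x. (1 + norm x) ^ 0 * norm (f x) \<le> M" using schwartz_bound[OF f, of 0] by blast
  have eq: "(LINT x|lborel. f (t n *\<^sub>R x) * fourier gauss x)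
    = (LINT \<xi>|lborel. fourier f \<xi> * gauss (t n *\<^sub>R \<xi>))" for n
  proof -
    have "integrable lborel (\<lambda>x. f (t n *\<^sub>R x))"
      using schwartz_integrable[OF schwartz_affine[OF f t[of n], of 0]] by simp
    then have "(LINT x|lborel. f (t n *\<^sub>R x) * fourier gauss x)
      = (LINT x|lborel. fourier (\<lambda>x. f (t n *\<^sub>R x)) x * gauss x)"
      by (intro fourier_multiplication_formula schwartz_integrable[OF gauss_schwartz])
    also have "\<dots>
      = \<bar>t n\<bar> ^ DIM('a) *\<^sub>R (LINT x|lborel. fourier (\<lambda>x. f (t n *\<^sub>R x)) (t n *\<^sub>R x) * gauss (t n *\<^sub>R x))"
    proof (rule lborel_integral_scale[OF t])
      show "(\<lambda>x. fourier (\<lambda>x. f (t n *\<^sub>R x)) x * gauss x) \<in> borel_measurable borel"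
        using schwartz_measurable[OF fourier_schwartz[OF schwartz_affine[OF f t[of n], of 0]]] by simp
    qed
    also have "\<dots> = (LINT \<xi>|lborel. fourier f \<xi> * gauss (t n *\<^sub>R \<xi>))"
    proof -
      have "\<bar>t n\<bar> ^ DIM('a) *\<^sub>R fourier (\<lambda>x. f (t n *\<^sub>R x)) (t n *\<^sub>R x) = fourier f x" for x
        using fourier_scale[OF t[of n], of f "t n *\<^sub>R x"] t[of n] by simp
      then have "\<bar>t n\<bar> ^ DIM('a) *\<^sub>R (fourier (\<lambda>x. f (t n *\<^sub>R x)) (t n *\<^sub>R x) * gauss (t n *\<^sub>R x))
        = fourier f x * gauss (t n *\<^sub>R x)" for x
        by (simp only: mult_scaleR_left[symmetric])
      then show ?thesis
        unfolding integral_scaleR_right[symmetric] by (simp only:)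
    qed
    finally show ?thesis .
  qed
  have "(\<lambda>n. LINT x|lborel. f (t n *\<^sub>R x) * fourier gauss x) \<longlonglongrightarrow> (LINT x|lborel. f 0 * fourier gauss (x :: 'a))"
  proof (rule integral_dominated_convergence[where w = "\<lambda>x. M * norm (fourier gauss x)"])
    show "integrable lborel (\<lambda>x :: 'a. M * norm (fourier gauss x))"
      by (intro integrable_mult_right integrable_norm schwartz_integrable fourier_schwartz gauss_schwartz)
    show "AE x in lborel. (\<lambda>n. f (t n *\<^sub>R x) * fourier gauss x) \<longlonglongrightarrow> f 0 * fourier gauss x"
    proof (intro AE_I2 tendsto_mult tendsto_const)
      show "(\<lambda>n. f (t n *\<^sub>R x)) \<longlonglongrightarrow> f 0" for x
        using schwartz_continuous[OF f] t0
        by (intro continuous_on_tendsto_compose[where f = f and s = UNIV]) (auto intro!: tendsto_eq_intros)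
    qed
    show "AE x in lborel. norm (f (t n *\<^sub>R x) * fourier gauss x) \<le> M * norm (fourier gauss x)" for n
      unfolding norm_mult using M by (intro AE_I2 mult_right_mono) auto
  qed measurable
  moreover have "(\<lambda>n. LINT \<xi>|lborel. fourier f \<xi> * gauss (t n *\<^sub>R \<xi>))
    \<longlonglongrightarrow> (LINT \<xi>|lborel. fourier f \<xi> * gauss (0 :: 'a))"
  proof (rule integral_dominated_convergence[where w = "\<lambda>\<xi>. norm (fourier f \<xi>)"])
    show "integrable lborel (\<lambda>\<xi>. norm (fourier f \<xi>))"
      by (intro integrable_norm schwartz_integrable fs)
    show "AE x in lborel. (\<lambda>n. fourier f x * gauss (t n *\<^sub>R x)) \<longlonglongrightarrow> fourier f x * gauss (0 :: 'a)"
    proof (intro AE_I2 tendsto_mult tendsto_const)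
      show "(\<lambda>n. gauss (t n *\<^sub>R x)) \<longlonglongrightarrow> gauss (0 :: 'a)" for x :: 'a
        using schwartz_continuous[OF gauss_schwartz] t0
        by (intro continuous_on_tendsto_compose[where f = gauss and s
          = UNIV]) (auto intro!: tendsto_eq_intros)
    qed
    show "AE x in lborel. norm (fourier f x * gauss (t n *\<^sub>R x)) \<le> norm (fourier f x)" for n
    proof -
      have "norm (gauss y) \<le> 1" for y :: 'a by (simp add: gauss_def)
      then show ?thesis unfolding norm_mult by (intro AE_I2 mult_left_le) auto
    qed
  qed measurable
  ultimately have "(LINT x|lborel. f 0 * fourier gauss (x :: 'a)) = (LINT \<xi>|lborel. fourier f \<xi>)"
    using LIMSEQ_unique unfolding eq by (fastforce simp: gauss_def)
  \<comment> \<open>By \<open>fourier_gauss\<close>, the integral of the transformed Gaussian is its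
    value at 0 times the Gaussian integral. This is the origin of the square in
    \<open>inversion_const\<close>: two Gaussian integrals appear here, and the two normalizing
    factors come from the inner and the outer transform.\<close>
  moreover have "(LINT x|lborel. f 0 * fourier gauss (x :: 'a))
    = f 0 * (fourier gauss (0 :: 'a) * of_real (gauss_integral TYPE('a)))"
    by (subst fg) (simp add: integral_gauss)
  moreover have "fourier gauss (0 :: 'a) = of_real (fourier_const TYPE('a) * gauss_integral TYPE('a))"
    unfolding fourier_def by (simp add: integral_gauss)
  ultimately show ?thesis
    unfolding fourier_def[of "fourier f"] inversion_const_def by (simp add: power2_eq_square mult_ac)
qed

text \<open>The value at an arbitrary point reduces to the value at 0 of a translate, because
  translation becomes modulation under the transform.\<close>

lemma fourier_fourier:
  fixes f :: "'a::euclidean_space \<Rightarrow> complex"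
  assumes f: "f \<in> schwartz"
  shows "fourier (fourier f) x = of_real (inversion_const TYPE('a)) * f (- x)"
proof -
  have "(\<lambda>y. f (- x + y)) \<in> schwartz" using schwartz_affine[OF f, of 1 "- x"] by simp
  from fourier_fourier_zero[OF this]
  have "of_real (inversion_const TYPE('a)) * f (- x) = fourier (fourier (\<lambda>y. f (- x + y))) 0" by simp
  also have "fourier (\<lambda>y. f (- x + y)) = (\<lambda>\<xi>. cis (- (x \<bullet> \<xi>)) * fourier f \<xi>)"
    using fourier_translate[OF schwartz_measurable[OF f], of "- x"] by (auto simp: fun_eq_iff)
  also have "fourier \<dots> 0 = fourier (fourier f) x"
    unfolding fourier_def[of _ 0] fourier_def[of _ x] by (simp add: inner_commute)
  finally show ?thesis by simp
qed

text \<open>The prefactor compensates for the unevaluated constant in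
  \<open>fourier_fourier\<close>, so that the two maps are exact inverses on the Schwartz
  space.\<close>

definition inverse_fourier :: "('a::euclidean_space \<Rightarrow> complex) \<Rightarrow> 'a \<Rightarrow> complex" where
  "inverse_fourier f x = of_real (1 / inversion_const TYPE('a)) * fourier f (- x)"

lemma inverse_fourier_fourier: "f \<in> schwartz \<Longrightarrow> inverse_fourier (fourier f) = f"
  for f :: "'a::euclidean_space \<Rightarrow> complex"
  using inversion_const_pos[where 'a='a] by (auto simp: inverse_fourier_def fourier_fourier fun_eq_iff)

lemma inverse_fourier_schwartz:
  fixes f :: "'a::euclidean_space \<Rightarrow> complex"
  assumes f: "f \<in> schwartz"
  shows "inverse_fourier f \<in> schwartz"
  using schwartz_mult[OF schwartz_affine[OF fourier_schwartz[OF f], of "-1" 0], of "of_real (1 / inversion_const TYPE('a))"]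
  by (simp add: inverse_fourier_def[abs_def])

lemma fourier_inverse_fourier:
  fixes f :: "'a::euclidean_space \<Rightarrow> complex"
  assumes f: "f \<in> schwartz"
  shows "fourier (inverse_fourier f) = f"
proof
  fix \<xi>
  have i: "integrable lborel (\<lambda>x. fourier f (- x))"
    using schwartz_integrable[OF schwartz_affine[OF fourier_schwartz[OF f], of "-1" 0]] by simp
  have "fourier (inverse_fourier f) \<xi>
    = of_real (1 / inversion_const TYPE('a)) * fourier (\<lambda>x. fourier f (- x)) \<xi>"
    using fourier_lin[OF i integrable_zero, of _ \<xi>] by (simp add: inverse_fourier_def[abs_def] fourier_def)
  also have "fourier (\<lambda>x. fourier f (- x)) \<xi> = fourier (fourier f) (- \<xi>)"
    using fourier_scale[of "-1" "fourier f" \<xi>] schwartz_measurable[OF fourier_schwartz[OF f]] by simp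
  finally show "fourier (inverse_fourier f) \<xi> = f \<xi>"
    using inversion_const_pos[where 'a='a] by (simp add: fourier_fourier[OF f])
qed

lemma inverse_fourier_decay:
  "\<exists>C\<ge>0. \<forall>f\<in>schwartz. \<forall>x::'a::euclidean_space.
     (1 + norm x) ^ k * norm (inverse_fourier f x) \<le> C * schwartz_norm (2 * DIM('a) + k) f"
proof -
  obtain C where C: "C \<ge> 0" "\<And>f \<xi>. f \<in> schwartz \<Longrightarrow>
     (1 + norm (\<xi>::'a)) ^ k * norm (fourier f \<xi>) \<le> C * schwartz_norm (2 * DIM('a) + k) f"
    using fourier_decay[where 'a='a, of k] by blast
  let ?c = "inversion_const TYPE('a)"
  have "(1 + norm x) ^ k * norm (inverse_fourier f x) \<le> (C / ?c) * schwartz_norm (2 * DIM('a) + k) f"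
    if f: "f \<in> schwartz" for f and x :: 'a
    using C(2)[OF f, of "- x"] inversion_const_pos[where 'a='a]
    by (simp add: inverse_fourier_def norm_mult norm_divide divide_right_mono)
  then show ?thesis using C(1) inversion_const_pos[where 'a='a] by (intro exI[of _ "C / ?c"]) auto
qed

section \<open>Functions orthogonal to the Schwartz space\<close>

lemma fourier_gauss_zero:
  "fourier gauss (0 :: 'a::euclidean_space) = of_real (fourier_const TYPE('a) * gauss_integral TYPE('a))"
  unfolding fourier_def by (simp add: integral_gauss)

text \<open>Up to a nonzero constant, the modulated Gaussian is the transform of a translated
  Gaussian. This gives membership without estimating derivatives of the product.\<close>

lemma gauss_modulated_schwartz:
  fixes a :: "'a::euclidean_space"
  shows "(\<lambda>\<xi>. cis (a \<bullet> \<xi>) * gauss \<xi>) \<in> schwartz"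
proof -
  define c where "c = fourier gauss (0 :: 'a)"
  have c: "c \<noteq> 0" unfolding c_def fourier_gauss_zero using gauss_integral_pos[where 'a='a] by simp
  have "(\<lambda>x. gauss (a + x)) \<in> schwartz" using schwartz_affine[OF gauss_schwartz, of 1 a] by simp
  from fourier_schwartz[OF this]
  have "(\<lambda>\<xi>. fourier (\<lambda>x. gauss (a + x)) \<xi>) \<in> schwartz" by simp
  then have "(\<lambda>\<xi>. cis (a \<bullet> \<xi>) * fourier gauss \<xi>) \<in> schwartz"
    by (simp only: fourier_translate[OF schwartz_measurable[OF gauss_schwartz], of a])
  moreover have "fourier gauss = (\<lambda>\<xi> :: 'a. c * gauss \<xi>)" unfolding c_def by (rule ext) (rule fourier_gauss)
  ultimately have "(\<lambda>\<xi>. cis (a \<bullet> \<xi>) * (c * gauss \<xi>)) \<in> schwartz" by simp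
  from schwartz_mult[OF this, of "1 / c"] show ?thesis using c by (simp add: mult_ac)
qed

lemma AE_lborel_not_frontier_box:
  fixes a b :: "'a::euclidean_space"
  shows "AE x in lborel. x \<notin> cbox a b - box a b"
proof (rule AE_not_in)
  have "cbox a b - box a b \<in> null_sets lebesgue"
    using negligible_frontier_interval[of a b] by (simp add: negligible_iff_null_sets)
  then show "cbox a b - box a b \<in> null_sets lborel"
    by (rule null_sets_completion_iff[THEN iffD1, rotated]) auto
qed

text \<open>The indicator function of the box is mollified with shrinking Gaussians.\<close>

lemma integral_box_zero_if_schwartz_orthogonal:
  fixes K :: "'a::euclidean_space \<Rightarrow> complex"
  assumes K: "integrable lborel K" and orth: "\<And>g. g \<in> schwartz \<Longrightarrow> (LINT x|lborel. K x * g x) = 0"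
  shows "(LINT x|lborel. K x * indicator (cbox a b) x) = 0"
proof -
  let ?A = "cbox a b"
  define t where "t n = 1 / real (Suc n)" for n
  have t: "0 < t n" for n by (auto simp: t_def)
  have t0: "t \<longlonglongrightarrow> 0" unfolding t_def using LIMSEQ_inverse_real_of_nat by (simp add: inverse_eq_divide)
  note [measurable] = borel_measurable_integrable[OF K] schwartz_measurable[OF gauss_schwartz]
  note gi = schwartz_integrable[OF gauss_schwartz]
  have gle: "norm (gauss y) \<le> 1" for y :: 'a by (simp add: gauss_def)
  have inA: "integrable lborel (\<lambda>x :: 'a. indicator ?A x :: complex)"
  proof -
    have "integrable lborel (\<lambda>x :: 'a. complex_of_real (indicator ?A x))"
      by (intro integrable_of_real integrable_real_indicator) (use emeasure_lborel_cbox_finite[of a b] in auto)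
    moreover have "complex_of_real (indicator ?A x) = indicator ?A x" for x by (simp add: indicator_def)
    ultimately show ?thesis by simp
  qed
  \<comment> \<open>The mollified indicator after the substitution y = x - t z. The Gaussian is left
    unnormalized, so the limit carries the factor \<open>gauss_integral\<close>.\<close>
  define \<phi> where "\<phi> n x = (LINT z|lborel. indicator ?A (x - t n *\<^sub>R z) * gauss z)" for n and x :: 'a
  have \<phi>0: "(LINT x|lborel. K x * \<phi> n x) = 0" for n
  proof -
    let ?k = "\<lambda>x y. K x * (indicator ?A y * gauss ((1 / t n) *\<^sub>R (x - y)))"
    have bd: "norm (indicator ?A y * gauss ((1 / t n) *\<^sub>R (x - y))) \<le> norm (indicator ?A y :: complex)"
      for x y
      unfolding norm_mult by (intro mult_left_le gle) auto
    have i2: "integrable lborel (\<lambda>y. indicator ?A y * gauss ((1 / t n) *\<^sub>R (x - y)))" for x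
      by (rule Bochner_Integration.integrable_bound[OF inA]) (use bd in auto)
    have i: "integrable (lborel \<Otimes>\<^sub>M lborel) (\<lambda>(x, y). ?k x y)"
    proof (rule lborel_pair.Fubini_integrable)
      show "(\<lambda>(x, y). ?k x y) \<in> borel_measurable (lborel \<Otimes>\<^sub>M lborel)" by measurable
      show "integrable lborel (\<lambda>x. LINT y|lborel. norm (case (x, y) of (x, y) \<Rightarrow> ?k x y))"
      proof (rule Bochner_Integration.integrable_bound)
        show "integrable lborel (\<lambda>x. norm (K x) * (LINT y|lborel. norm (indicator ?A y :: complex)))"
          using K by auto
        show "(\<lambda>x. LINT y|lborel. norm (case (x, y) of (x, y) \<Rightarrow> ?k x y)) \<in> borel_measurable lborel"
          by measurable
        have "(LINT y|lborel. norm (?k x y))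
          \<le> norm (K x) * (LINT y|lborel. norm (indicator ?A y :: complex))" for x
          unfolding norm_mult[of "K x"] integral_mult_right_zero
          using bd by (intro mult_left_mono integral_mono integrable_norm i2 inA) auto
        moreover have "0 \<le> (LINT y|lborel. norm (?k x y))" for x by (intro integral_nonneg_AE) auto
        ultimately show "AE x in lborel. norm (LINT y|lborel. norm (case (x, y) of (x, y) \<Rightarrow> ?k x y))
            \<le> norm (norm (K x) * (LINT y|lborel. norm (indicator ?A y :: complex)))"
          by (auto intro!: order_trans[OF _ abs_ge_self])
      qed
      show "AE x in lborel. integrable lborel (\<lambda>y. case (x, y) of (x, y) \<Rightarrow> ?k x y)"
        using i2 by (auto intro!: integrable_mult_right)
    qed
    \<comment> \<open>Fubini avoids proving that \<open>\<phi> n\<close> is a Schwartz function: for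
      fixed y, the integral over x pairs \<open>K\<close> with one rescaled and translated
      Gaussian.\<close>
    have "(LINT x|lborel. ?k x y) = 0" for y
    proof -
      have "(\<lambda>x. gauss (- ((1 / t n) *\<^sub>R y) + (1 / t n) *\<^sub>R x)) \<in> schwartz"
        using t[of n] by (intro schwartz_affine gauss_schwartz) simp
      from orth[OF this] have "(LINT x|lborel. K x * gauss ((1 / t n) *\<^sub>R (x - y))) = 0"
        by (simp add: scaleR_diff_right)
      then have "(LINT x|lborel. indicator ?A y * (K x * gauss ((1 / t n) *\<^sub>R (x - y)))) = 0"
        unfolding integral_mult_right_zero by simp
      then show ?thesis by (simp only: mult.left_commute)
    qed
    then have "0 = (LINT y|lborel. LINT x|lborel. ?k x y)" by simp
    also have "\<dots> = (LINT x|lborel. LINT y|lborel. ?k x y)"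
      by (rule lborel_pair.Fubini_integral[OF i])
    also have "\<dots> = (LINT x|lborel. K x * (\<bar>t n\<bar> ^ DIM('a) *\<^sub>R \<phi> n x))"
    proof (intro Bochner_Integration.integral_cong refl)
      fix x
      let ?F = "\<lambda>y. indicator ?A y * gauss ((1 / t n) *\<^sub>R (x - y)) :: complex"
      have "(LINT y|lborel. ?F y) = (LINT y|lborel. ?F (x + y))"
        by (rule lborel_integral_translate[symmetric]) measurable
      also have "\<dots> = \<bar>- t n\<bar> ^ DIM('a) *\<^sub>R (LINT z|lborel. ?F (x + (- t n) *\<^sub>R z))"
        using t[of n] by (intro lborel_integral_scale) auto
      also have "(LINT z|lborel. ?F (x + (- t n) *\<^sub>R z)) = \<phi> n x"
        unfolding \<phi>_def using t[of n] by simp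
      finally show "(LINT y|lborel. ?k x y) = K x * (\<bar>t n\<bar> ^ DIM('a) *\<^sub>R \<phi> n x)"
        unfolding integral_mult_right_zero by simp
    qed
    also have "\<dots> = \<bar>t n\<bar> ^ DIM('a) *\<^sub>R (LINT x|lborel. K x * \<phi> n x)" by simp
    finally show ?thesis using t[of n] by simp
  qed
  have \<phi>le: "norm (\<phi> n x) \<le> (LINT z|lborel. norm (gauss (z :: 'a)))" for n x
  proof -
    have i: "integrable lborel (\<lambda>z. indicator ?A (x - t n *\<^sub>R z) * gauss z)"
      by (rule Bochner_Integration.integrable_bound[OF gi]) (auto simp: norm_mult indicator_def)
    then have "norm (\<phi> n x) \<le> (LINT z|lborel. norm (indicator ?A (x - t n *\<^sub>R z) * gauss z))"
      unfolding \<phi>_def by simp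
    also have "\<dots> \<le> (LINT z|lborel. norm (gauss (z :: 'a)))"
      by (rule integral_mono[OF integrable_norm[OF i] integrable_norm[OF gi]])
        (auto simp: norm_mult indicator_def)
    finally show ?thesis .
  qed
  \<comment> \<open>Off the boundary of the box, the indicator is locally constant, so its values at
    \<open>x - t n *\<^sub>R z\<close> are eventually equal to its value at \<open>x\<close>. The
    boundary is a null set.\<close>
  have \<phi>lim: "(\<lambda>n. \<phi> n x)
    \<longlonglongrightarrow> indicator ?A x * of_real (gauss_integral TYPE('a))" if x: "x \<notin> cbox a b - box a b" for x
  proof -
    have lim: "(\<lambda>n. x - t n *\<^sub>R z) \<longlonglongrightarrow> x" for z
      using t0 by (auto intro!: tendsto_eq_intros)
    have "(\<lambda>n. \<phi> n x) \<longlonglongrightarrow> (LINT z|lborel. indicator ?A x * gauss (z :: 'a))"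
      unfolding \<phi>_def
    proof (rule integral_dominated_convergence[where w = "\<lambda>z. norm (gauss z)"])
      show "AE z in lborel. (\<lambda>n. indicator ?A (x - t n *\<^sub>R z) * gauss z :: complex)
        \<longlonglongrightarrow> indicator ?A x * gauss z"
      proof (intro AE_I2 tendsto_mult tendsto_const tendsto_eventually)
        fix z
        show "\<forall>\<^sub>F n in sequentially. indicator ?A (x - t n *\<^sub>R z) = (indicator ?A x :: complex)"
        proof (cases "x \<in> box a b")
          case True
          from topological_tendstoD[OF lim open_box this] have "\<forall>\<^sub>F n in sequentially. x - t n *\<^sub>R z \<in> box a b" .
          then show ?thesis using True box_subset_cbox[of a b]
            by (auto elim!: eventually_mono simp: indicator_def)
        next
          case False
          then have "x \<in> - cbox a b" using x by auto
          from topological_tendstoD[OF lim _ this] have "\<forall>\<^sub>F n in sequentially. x - t n *\<^sub>R z \<in> - cbox a b"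
            by (simp add: closed_cbox open_Compl)
          then show ?thesis using False x by (auto elim!: eventually_mono simp: indicator_def)
        qed
      qed
      show "AE z in lborel. norm (indicator ?A (x - t n *\<^sub>R z) * gauss z) \<le> norm (gauss z)" for n
        by (auto simp: norm_mult indicator_def)
    qed (use gi in \<open>auto intro: integrable_norm\<close>)
    then show ?thesis by (simp add: integral_gauss)
  qed
  have \<phi>m [measurable]: "\<phi> n \<in> borel_measurable borel" for n
    unfolding \<phi>_def by measurable
  have "(\<lambda>n. LINT x|lborel. K x * \<phi> n x)
    \<longlonglongrightarrow> (LINT x|lborel. K x * (indicator ?A x * of_real (gauss_integral TYPE('a))))"
  proof (rule integral_dominated_convergence[where w
    = "\<lambda>x. norm (K x) * (LINT z|lborel. norm (gauss (z :: 'a)))"])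
    show "AE x in lborel. (\<lambda>n. K x * \<phi> n x) \<longlonglongrightarrow> K x * (indicator ?A x * of_real (gauss_integral TYPE('a)))"
      using AE_lborel_not_frontier_box[of a b]
      by eventually_elim (intro tendsto_mult tendsto_const \<phi>lim)
    show "AE x in lborel. norm (K x * \<phi> n x) \<le> norm (K x) * (LINT z|lborel. norm (gauss (z :: 'a)))" for n
      unfolding norm_mult by (intro AE_I2 mult_left_mono \<phi>le) auto
    show "integrable lborel (\<lambda>x. norm (K x) * (LINT z|lborel. norm (gauss (z :: 'a))))" using K by auto
  qed measurable
  then have "(LINT x|lborel. K x * (indicator ?A x * of_real (gauss_integral TYPE('a)))) = 0"
    unfolding \<phi>0 by (simp add: LIMSEQ_const_iff)
  then show ?thesis
    using gauss_integral_pos[where 'a='a] unfolding mult.assoc[symmetric] integral_mult_left_zero by simp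
qed

text \<open>Lebesgue differentiation: outside a negligible set, \<open>K x\<close> is the limit of
  averages of \<open>K\<close> over cubes shrinking to \<open>x\<close>, and all these averages are
  zero.\<close>

lemma AE_zero_if_box_integrals_zero:
  fixes K :: "'a::euclidean_space \<Rightarrow> complex"
  assumes K: "integrable lborel K" and zero: "\<And>a b. (LINT x|lborel. K x * indicator (cbox a b) x) = 0"
  shows "AE x in lborel. K x = 0"
proof -
  have io: "K integrable_on cbox a b" for a b
    using integrable_on_subcbox[OF integrable_on_lborel[OF K]] by simp
  have i0: "integral (cbox a b) K = 0" for a b
  proof -
    have i: "integrable lborel (\<lambda>x. K x * indicator (cbox a b) x)"
      using borel_measurable_integrable[OF K]
      by (intro Bochner_Integration.integrable_bound[OF K]) (auto simp: norm_mult indicator_def)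
    have "integral (cbox a b) K = integral UNIV (\<lambda>x. if x \<in> cbox a b then K x else 0)"
      by (simp add: integral_restrict_UNIV)
    also have "(\<lambda>x. if x \<in> cbox a b then K x else 0) = (\<lambda>x. K x * indicator (cbox a b) x)"
      by (auto simp: indicator_def)
    also have "integral UNIV \<dots> = 0" using integral_lborel[OF i] zero by simp
    finally show ?thesis .
  qed
  obtain N where N: "negligible N" "\<And>x e. x \<notin> N \<Longrightarrow> 0 < e \<Longrightarrow>
      \<exists>d>0. \<forall>h. 0 < h \<and> h < d \<longrightarrow> norm (integral (cbox x (x + h *\<^sub>R One)) K /\<^sub>R h ^ DIM('a) - K x) < e"
    using integrable_ccontinuous_explicit[OF io] by blast
  have "K x = 0" if xN: "x \<notin> N" for x
  proof (rule ccontr)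
    assume "K x \<noteq> 0"
    then obtain d where d: "d > 0" "\<And>h. 0 < h \<Longrightarrow> h < d \<Longrightarrow> norm (integral (cbox x (x
      + h *\<^sub>R One)) K /\<^sub>R h ^ DIM('a) - K x) < norm (K x)"
      using N(2)[OF xN, of "norm (K x)"] by auto
    from d(2)[of "d / 2"] d(1) show False by (simp add: i0)
  qed
  then have "{x. K x \<noteq> 0} \<subseteq> N" by auto
  then have "{x. K x \<noteq> 0} \<in> null_sets lebesgue"
    using N(1) negligible_subset negligible_iff_null_sets by blast
  moreover have "{x. K x \<noteq> 0} \<in> sets lborel"
    using borel_measurable_integrable[OF K] by measurable
  ultimately have "{x. K x \<noteq> 0} \<in> null_sets lborel"
    by (metis null_sets_completion_iff)
  from AE_not_in[OF this] show ?thesis by simp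
qed

text \<open>Multiplying by the Gaussian makes \<open>H\<close> integrable. The product stays orthogonal to all modulations
  \<open>cis (a \<bullet> x)\<close>, so its Fourier transform vanishes and it is again orthogonal to the Schwartz space.\<close>

lemma AE_zero_if_schwartz_orthogonal:
  fixes H :: "'a::euclidean_space \<Rightarrow> complex"
  assumes i: "\<And>f. f \<in> schwartz \<Longrightarrow> integrable lborel (\<lambda>x. H x * f x)"
    and z: "\<And>f. f \<in> schwartz \<Longrightarrow> (LINT x|lborel. H x * f x) = 0"
  shows "AE x in lborel. H x = 0"
proof -
  let ?K = "\<lambda>x. H x * gauss x"
  have K: "integrable lborel ?K" by (rule i[OF gauss_schwartz])
  have "fourier ?K \<xi> = 0" for \<xi>
  proof -
    have "(\<lambda>x. cis (- (x \<bullet> \<xi>)) * ?K x) = (\<lambda>x. H x * (cis ((- \<xi>) \<bullet> x) * gauss x))"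
      by (simp add: fun_eq_iff inner_commute mult_ac)
    then show ?thesis unfolding fourier_def by (simp only: z[OF gauss_modulated_schwartz]) simp
  qed
  then have F: "fourier ?K = (\<lambda>_. 0)" by auto
  have "(LINT x|lborel. ?K x * g x) = 0" if g: "g \<in> schwartz" for g
    using fourier_multiplication_formula[OF K schwartz_integrable[OF inverse_fourier_schwartz[OF g]]]
    unfolding fourier_inverse_fourier[OF g] F by simp
  from AE_zero_if_box_integrals_zero[OF K integral_box_zero_if_schwartz_orthogonal[OF K this]]
  have "AE x in lborel. ?K x = 0" .
  then show ?thesis by eventually_elim (simp add: gauss_def)
qed

section \<open>Bessel potential spaces\<close>

text \<open>The Riesz-Fischer argument: a rapidly Cauchy subsequence converges almost everywhere,
  and Fatou's lemma identifies its pointwise limit as the limit in the weighted norm.\<close>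

lemma weighted_L2_complete:
  fixes F :: "nat \<Rightarrow> 'a \<Rightarrow> complex" and w :: "'a \<Rightarrow> real"
  assumes Fm [measurable]: "\<And>n. F n \<in> borel_measurable M" and wm [measurable]: "w \<in> borel_measurable M"
    and w: "\<And>x. 0 < w x"
    and int: "\<And>m n. integrable M (\<lambda>x. (w x * norm (F m x - F n x))\<^sup>2)"
    and Cauchy: "\<And>e. 0 < e \<Longrightarrow> \<exists>N. \<forall>m\<ge>N. \<forall>n\<ge>N. (LINT x|M. (w x * norm (F m x - F n x))\<^sup>2) \<le> e"
  shows "\<exists>G \<in> borel_measurable M. \<forall>e>0. \<exists>N. \<forall>n\<ge>N.
    integrable M (\<lambda>x. (w x * norm (G x - F n x))\<^sup>2) \<and> (LINT x|M. (w x * norm (G x - F n x))\<^sup>2) \<le> e"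
proof -
  \<comment> \<open>The rate 4^-j for squared norms leaves the summable 2^-j after the weight 2^j is
    applied.\<close>
  have "\<forall>j. \<exists>N. \<forall>m\<ge>N. \<forall>n\<ge>N. (LINT x|M. (w x * norm (F m x - F n x))\<^sup>2) \<le> (1/4) ^ j"
    using Cauchy by simp
  then obtain N where N: "\<And>j m n. N j \<le> m \<Longrightarrow> N j \<le> n \<Longrightarrow> (LINT x|M. (w x * norm (F m x - F n x))\<^sup>2) \<le> (1/4) ^ j"
    by metis
  \<comment> \<open>An explicit subsequence: \<open>r j\<close> exceeds every \<open>N i\<close>
    with i \<le> j and is at least \<open>j\<close>, which makes a recursive choice of indices
    unnecessary.\<close>
  define r where "r j = (\<Sum>i\<le>j. N i) + j" for j
  have rN: "N j \<le> r i" if "j \<le> i" for i j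
    unfolding r_def using member_le_sum[of j "{..i}" N] that by (simp add: trans_le_add1)
  have rj: "j \<le> r j" for j by (simp add: r_def)
  \<comment> \<open>The bound \<open>a \<le> 2\<^sup>-\<^sup>j + 2\<^sup>j * a\<^sup>2\<close> replaces Minkowski's inequality.\<close>
  define a where "a j x = w x * norm (F (r (Suc j)) x - F (r j) x)" for j x
  have [measurable]: "a j \<in> borel_measurable M" for j unfolding a_def by measurable
  have a0: "0 \<le> a j x" for j x using w[of x] by (simp add: a_def)
  have aint: "(\<integral>\<^sup>+x. ennreal (2 ^ j * (a j x)\<^sup>2) \<partial>M) \<le> ennreal ((1/2) ^ j)" for j
  proof -
    have "(\<integral>\<^sup>+x. ennreal (2 ^ j * (a j x)\<^sup>2) \<partial>M) = ennreal (LINT x|M. 2 ^ j * (a j x)\<^sup>2)"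
      using int by (intro nn_integral_eq_integral) (auto simp: a_def)
    also have "\<dots> \<le> ennreal ((1/2) ^ j)"
    proof (rule ennreal_leI)
      have "(LINT x|M. (a j x)\<^sup>2) \<le> (1/4) ^ j"
        unfolding a_def by (intro N rN) auto
      then have "(LINT x|M. 2 ^ j * (a j x)\<^sup>2) \<le> 2 ^ j * (1/4) ^ j" by simp
      also have "\<dots> = (1/2) ^ j" by (simp add: power_mult_distrib[symmetric])
      finally show "(LINT x|M. 2 ^ j * (a j x)\<^sup>2) \<le> (1/2) ^ j" .
    qed
    finally show ?thesis .
  qed
  have "(\<integral>\<^sup>+x. (\<Sum>j. ennreal (2 ^ j * (a j x)\<^sup>2)) \<partial>M) = (\<Sum>j. \<integral>\<^sup>+x. ennreal (2 ^ j * (a j x)\<^sup>2) \<partial>M)"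
    by (rule nn_integral_suminf) measurable
  also have "\<dots> \<le> (\<Sum>j. ennreal ((1/2) ^ j))"
    by (intro suminf_le aint) auto
  also have "\<dots> < top"
  proof (rule top.not_eq_extremum[THEN iffD1], rule ennreal_suminf_neq_top)
    show "summable (\<lambda>j. (1/2) ^ j :: real)" by (rule summable_geometric) simp
  qed simp
  finally have "AE x in M. (\<Sum>j. ennreal (2 ^ j * (a j x)\<^sup>2)) \<noteq> \<infinity>"
    by (intro nn_integral_PInf_AE) auto
  then have conv: "AE x in M. convergent (\<lambda>j. F (r j) x)"
  proof eventually_elim
    case (elim x)
    then have s: "summable (\<lambda>j. 2 ^ j * (a j x)\<^sup>2)" by (intro summable_suminf_not_top) auto
    have "summable (\<lambda>j. a j x)"
    proof (rule summable_comparison_test)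
      show "summable (\<lambda>j. (1/2) ^ j + 2 ^ j * (a j x)\<^sup>2)" by (intro summable_add s summable_geometric) auto
      have "a j x \<le> (1/2) ^ j + 2 ^ j * (a j x)\<^sup>2" for j
      proof (cases "a j x \<le> (1/2) ^ j")
        case False
        then have "1 \<le> 2 ^ j * a j x" by (simp add: field_simps)
        then have "a j x * 1 \<le> a j x * (2 ^ j * a j x)" using a0 by (intro mult_left_mono)
        then show ?thesis by (simp add: power2_eq_square mult_ac add_increasing)
      qed (simp add: add_increasing2)
      then show "\<exists>n0. \<forall>j\<ge>n0. norm (a j x) \<le> (1/2) ^ j + 2 ^ j * (a j x)\<^sup>2" using a0 by auto
    qed
    then have "summable (\<lambda>j. (1 / w x) * a j x)" by (rule summable_mult)
    then have "summable (\<lambda>j. norm (F (r (Suc j)) x - F (r j) x))"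
      using w[of x] by (simp add: a_def)
    then have "summable (\<lambda>j. F (r (Suc j)) x - F (r j) x)" by (rule summable_norm_cancel)
    from summable_LIMSEQ[OF this]
    have "(\<lambda>n. F (r n) x - F (r 0) x) \<longlonglongrightarrow> (\<Sum>j. F (r (Suc j)) x - F (r j) x)"
      using sum_lessThan_telescope[of "\<lambda>j. F (r j) x"] by simp
    from tendsto_add[OF this tendsto_const[of "F (r 0) x"]] show ?case
      by (auto intro: convergentI)
  qed
  \<comment> \<open>Where the subsequence diverges, the value of \<open>lim\<close> is arbitrary; by
    \<open>conv\<close> this affects a null set only.\<close>
  define G where "G x = lim (\<lambda>j. F (r j) x)" for x
  have Gm [measurable]: "G \<in> borel_measurable M" unfolding G_def by measurable
  have "integrable M (\<lambda>x. (w x * norm (G x - F n x))\<^sup>2) \<and> (LINT x|M. (w x * norm (G x - F n x))\<^sup>2) \<le> e"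
    if e: "0 < e" and K: "\<And>m n. K \<le> m \<Longrightarrow> K \<le> n \<Longrightarrow> (LINT x|M. (w x * norm (F m x - F n x))\<^sup>2) \<le> e" and n: "K \<le> n"
    for e K n
  proof -
    \<comment> \<open>Writing the integrand as a lower limit prepares Fatou's lemma. Working with
      nonnegative integrals yields integrability together with the bound.\<close>
    have "(\<integral>\<^sup>+x. ennreal ((w x * norm (G x - F n x))\<^sup>2) \<partial>M)
      = (\<integral>\<^sup>+x. liminf (\<lambda>j. ennreal ((w x * norm (F (r j) x - F n x))\<^sup>2)) \<partial>M)"
    proof (rule nn_integral_cong_AE, use conv in eventually_elim)
      case (elim x)
      then have "(\<lambda>j. F (r j) x) \<longlonglongrightarrow> G x" unfolding G_def by (simp add: convergent_LIMSEQ_iff)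
      then have "(\<lambda>j. ennreal ((w x * norm (F (r j) x - F n x))\<^sup>2)) \<longlonglongrightarrow> ennreal ((w x * norm (G x - F n x))\<^sup>2)"
        by (intro tendsto_ennrealI tendsto_intros)
      from lim_imp_Liminf[OF _ this] show ?case by simp
    qed
    also have "\<dots> \<le> liminf (\<lambda>j. \<integral>\<^sup>+x. ennreal ((w x * norm (F (r j) x - F n x))\<^sup>2) \<partial>M)"
      by (rule nn_integral_liminf) measurable
    also have "\<dots> \<le> liminf (\<lambda>j :: nat. ennreal e)"
    proof (rule Liminf_mono)
      show "\<forall>\<^sub>F j in sequentially. (\<integral>\<^sup>+x. ennreal ((w x * norm (F (r j) x - F n x))\<^sup>2) \<partial>M) \<le> ennreal e"
        using eventually_ge_at_top[of K]
      proof eventually_elim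
        case (elim j)
        then have "K \<le> r j" using rj[of j] by linarith
        have "(\<integral>\<^sup>+x. ennreal ((w x * norm (F (r j) x - F n x))\<^sup>2) \<partial>M)
          = ennreal (LINT x|M. (w x * norm (F (r j) x - F n x))\<^sup>2)"
          by (intro nn_integral_eq_integral int) auto
        also have "\<dots> \<le> ennreal e" by (intro ennreal_leI K \<open>K \<le> r j\<close> n)
        finally show ?case .
      qed
    qed
    also have "\<dots> = ennreal e" by (simp add: Liminf_const)
    finally have *: "(\<integral>\<^sup>+x. ennreal ((w x * norm (G x - F n x))\<^sup>2) \<partial>M) \<le> ennreal e" .
    have i: "integrable M (\<lambda>x. (w x * norm (G x - F n x))\<^sup>2)"
      using * by (intro integrableI_bounded) (auto simp: le_less_trans)
    moreover have "(LINT x|M. (w x * norm (G x - F n x))\<^sup>2) \<le> e"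
      using * e by (subst (asm) nn_integral_eq_integral[OF i]) auto
    ultimately show ?thesis by blast
  qed
  note close = this
  show ?thesis
  proof (rule bexI[OF _ Gm], intro allI impI)
    fix e :: real assume e: "0 < e"
    from Cauchy[OF this] obtain K where "\<forall>m\<ge>K. \<forall>n\<ge>K. (LINT x|M. (w x * norm (F m x - F n x))\<^sup>2) \<le> e" by blast
    then show "\<exists>N. \<forall>n\<ge>N. integrable M (\<lambda>x. (w x * norm (G x - F n x))\<^sup>2)
      \<and> (LINT x|M. (w x * norm (G x - F n x))\<^sup>2) \<le> e"
      by (intro exI[of _ K] allI impI close[OF e, of K]) auto
  qed
qed

section \<open>Functions representing Fourier transforms\<close>

lemma has_fourier_fun_measurable: "has_fourier_fun u F \<Longrightarrow> F \<in> borel_measurable borel"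
  by (simp add: has_fourier_fun_def)

lemma has_fourier_fun_unique:
  assumes F: "has_fourier_fun u F" and G: "has_fourier_fun u G"
  shows "AE \<xi> in lborel. F \<xi> = G \<xi>"
proof -
  have "AE \<xi> in lborel. F \<xi> - G \<xi> = 0"
  proof (rule AE_zero_if_schwartz_orthogonal)
    fix f :: "'a \<Rightarrow> complex" assume f: "f \<in> schwartz"
    show "integrable lborel (\<lambda>x. (F x - G x) * f x)"
      using F G f by (simp add: has_fourier_fun_def left_diff_distrib)
    show "(LINT x|lborel. (F x - G x) * f x) = 0"
      using F G f unfolding left_diff_distrib
      by (subst Bochner_Integration.integral_diff) (auto simp: has_fourier_fun_def)
  qed
  then show ?thesis by eventually_elim simp
qed

lemma has_fourier_fun_fourier_fun: "has_fourier_fun u F \<Longrightarrow> has_fourier_fun u (fourier_fun u)"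
  unfolding fourier_fun_def by (rule someI[where P = "has_fourier_fun u"])

lemma has_fourier_fun_lin:
  assumes F: "has_fourier_fun u F" and G: "has_fourier_fun v G"
  shows "has_fourier_fun (c *\<^sub>R u + v) (\<lambda>\<xi>. of_real c * F \<xi> + G \<xi>)"
  unfolding has_fourier_fun_def
proof (intro conjI ballI)
  show "(\<lambda>\<xi>. of_real c * F \<xi> + G \<xi>) \<in> borel_measurable borel"
    using F G by (auto simp: has_fourier_fun_def)
  fix f :: "'a \<Rightarrow> complex" assume f: "f \<in> schwartz"
  have i: "integrable lborel (\<lambda>\<xi>. F \<xi> * f \<xi>)" "integrable lborel (\<lambda>\<xi>. G \<xi> * f \<xi>)"
    using F G f by (auto simp: has_fourier_fun_def)
  then show "integrable lborel (\<lambda>\<xi>. (of_real c * F \<xi> + G \<xi>) * f \<xi>)"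
    by (simp add: distrib_right mult.assoc)
  show "pairing (c *\<^sub>R u + v) (fourier f) = (LINT \<xi>|lborel. (of_real c * F \<xi> + G \<xi>) * f \<xi>)"
    using F G f i
    by (simp add: distrib_right mult.assoc has_fourier_fun_def plus_tempered_dist.rep_eq scaleR_tempered_dist.rep_eq)
qed

lemma has_fourier_fun_diff:
  "has_fourier_fun u F \<Longrightarrow> has_fourier_fun v G \<Longrightarrow> has_fourier_fun (u - v) (\<lambda>\<xi>. F \<xi> - G \<xi>)"
  using has_fourier_fun_lin[of v G u F "-1"] by simp

abbreviation Hs_integrable :: "real \<Rightarrow> ('a::euclidean_space \<Rightarrow> complex) \<Rightarrow> bool" where
  "Hs_integrable s F \<equiv> integrable lborel (\<lambda>\<xi>. (bracket \<xi> powr s * norm (F \<xi>))\<^sup>2)"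

section \<open>The Sobolev weight and the pairing estimate\<close>

lemma bracket_ge_one: "1 \<le> bracket \<xi>"
  by (simp add: bracket_def)

lemma bracket_pos [simp]: "0 < bracket \<xi>"
  using bracket_ge_one[of \<xi>] by linarith

lemma bracket_nonzero [simp]: "bracket \<xi> \<noteq> 0"
  using bracket_pos[of \<xi>] by linarith

lemma bracket_le: "bracket \<xi> \<le> 1 + norm \<xi>"
  unfolding bracket_def by (rule real_le_lsqrt) (auto simp: power2_sum)

lemma bracket_measurable [measurable]: "bracket \<in> borel_measurable borel"
  unfolding bracket_def by measurable

lemma bracket_powr_le: "bracket \<xi> powr s \<le> (1 + norm \<xi>) ^ nat \<lceil>\<bar>s\<bar>\<rceil>"
proof -
  have "bracket \<xi> powr s \<le> bracket \<xi> powr (real (nat \<lceil>\<bar>s\<bar>\<rceil>))"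
    by (intro powr_mono bracket_ge_one) linarith
  also have "\<dots> = bracket \<xi> ^ nat \<lceil>\<bar>s\<bar>\<rceil>" by (rule powr_realpow) simp
  also have "\<dots> \<le> (1 + norm \<xi>) ^ nat \<lceil>\<bar>s\<bar>\<rceil>" by (intro power_mono bracket_le) (simp add: less_imp_le)
  finally show ?thesis .
qed

text \<open>The first summand controls the growth of \<open>bracket \<xi> powr s\<close> as well as
  of \<open>bracket \<xi> powr (- s)\<close>. The second makes the remaining factor square
  integrable, its square being \<open>decay\<close>.\<close>

definition weight_order :: "real \<Rightarrow> 'a::euclidean_space itself \<Rightarrow> nat" where
  "weight_order s _ = nat \<lceil>\<bar>s\<bar>\<rceil> + DIM('a)"

lemma weight_sq_le:
  fixes \<xi> :: "'a::euclidean_space"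
  shows "(bracket \<xi> powr s / (1 + norm \<xi>) ^ weight_order s TYPE('a))\<^sup>2 \<le> decay \<xi>"
proof -
  have "bracket \<xi> powr s / (1 + norm \<xi>) ^ weight_order s TYPE('a) \<le> (1 + norm \<xi>) ^ nat \<lceil>\<bar>s\<bar>\<rceil> / (1
    + norm \<xi>) ^ weight_order s TYPE('a)"
    by (intro divide_right_mono bracket_powr_le) (auto simp: add_nonneg_nonneg)
  also have "\<dots> = 1 / (1 + norm \<xi>) ^ DIM('a)"
    using norm_ge_zero[of \<xi>] by (simp add: weight_order_def power_add)
  finally have "(bracket \<xi> powr s / (1 + norm \<xi>) ^ weight_order s TYPE('a))\<^sup>2 \<le> (1 / (1
    + norm \<xi>) ^ DIM('a))\<^sup>2"
    by (intro power_mono) auto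
  also have "\<dots> = decay \<xi>" by (simp add: decay_def power_divide power_mult[symmetric] mult.commute)
  finally show ?thesis .
qed

text \<open>The duality between orders s and -s in pointwise form. Writing F = (bracket^s F)
  bracket^-s and using p q <= p^2 + q^2 gives an integrable majorant, at the price of a bound that
  is not homogeneous in \<open>F\<close>.\<close>

lemma weighted_product_le:
  fixes \<xi> :: "'a::euclidean_space" and F \<phi> :: "'a \<Rightarrow> complex"
  assumes M: "(1 + norm \<xi>) ^ weight_order s TYPE('a) * norm (\<phi> \<xi>) \<le> M"
  shows "norm (F \<xi> * \<phi> \<xi>) \<le> M * ((bracket \<xi> powr s * norm (F \<xi>))\<^sup>2 + decay \<xi>)"
proof -
  let ?m = "weight_order s TYPE('a)" and ?p = "bracket \<xi> powr s * norm (F \<xi>)"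
  let ?q = "bracket \<xi> powr (- s) / (1 + norm \<xi>) ^ ?m"
  have pos: "0 < (1 + norm \<xi>) ^ ?m" by (simp add: add_pos_nonneg)
  have M0: "0 \<le> M" using order_trans[OF _ M] by simp
  \<comment> \<open>The order depends on |s| only, so \<open>weight_sq_le\<close> may be applied to
    -s.\<close>
  have "weight_order (- s) TYPE('a) = ?m" by (simp add: weight_order_def)
  then have q: "?q\<^sup>2 \<le> decay \<xi>" using weight_sq_le[of \<xi> "- s"] by simp
  have "norm (F \<xi>) / (1 + norm \<xi>) ^ ?m = ?p * ?q"
    using pos by (simp add: powr_minus field_simps)
  also have "\<dots> \<le> ?p\<^sup>2 + ?q\<^sup>2"
    using sum_squares_bound[of ?p ?q] sum_power2_ge_zero[of ?p ?q] by linarith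
  also have "\<dots> \<le> ?p\<^sup>2 + decay \<xi>" using q by simp
  finally have le: "norm (F \<xi>) / (1 + norm \<xi>) ^ ?m \<le> ?p\<^sup>2 + decay \<xi>" .
  have "norm (F \<xi> * \<phi> \<xi>) = ((1 + norm \<xi>) ^ ?m * norm (\<phi> \<xi>)) * (norm (F \<xi>) / (1 + norm \<xi>) ^ ?m)"
  proof -
    have "1 + norm \<xi> \<noteq> 0" using norm_ge_zero[of \<xi>] by linarith
    then show ?thesis by (simp add: norm_mult)
  qed
  also have "\<dots> \<le> M * (?p\<^sup>2 + decay \<xi>)"
    using M0 by (intro mult_mono M le) auto
  finally show ?thesis .
qed

lemma
  fixes F \<phi> :: "'a::euclidean_space \<Rightarrow> complex"
  assumes F: "F \<in> borel_measurable borel" "Hs_integrable s F" and \<phi>: "\<phi> \<in> borel_measurable borel"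
    and M: "\<And>\<xi>. (1 + norm \<xi>) ^ weight_order s TYPE('a) * norm (\<phi> \<xi>) \<le> M"
  shows weighted_product_integrable: "integrable lborel (\<lambda>\<xi>. F \<xi> * \<phi> \<xi>)"
    and weighted_product_integral: "norm (LINT \<xi>|lborel. F \<xi> * \<phi> \<xi>) \<le>
      M * ((LINT \<xi>|lborel. (bracket \<xi> powr s * norm (F \<xi>))\<^sup>2) + (LINT x|lborel. decay (x :: 'a)))"
proof -
  have i: "integrable lborel (\<lambda>\<xi>. M * ((bracket \<xi> powr s * norm (F \<xi>))\<^sup>2 + decay \<xi>))"
    by (intro integrable_mult_right Bochner_Integration.integrable_add F decay_integrable)
  have le: "norm (F \<xi> * \<phi> \<xi>) \<le> M * ((bracket \<xi> powr s * norm (F \<xi>))\<^sup>2 + decay \<xi>)" for \<xi>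
    by (rule weighted_product_le[OF M])
  show *: "integrable lborel (\<lambda>\<xi>. F \<xi> * \<phi> \<xi>)"
    by (rule Bochner_Integration.integrable_bound[OF i])
      (use F \<phi> in \<open>auto intro!: AE_I2 order_trans[OF le abs_ge_self]\<close>)
  have "norm (LINT \<xi>|lborel. F \<xi> * \<phi> \<xi>) \<le> (LINT \<xi>|lborel. norm (F \<xi> * \<phi> \<xi>))"
    by (rule integral_norm_bound)
  also have "\<dots> \<le> (LINT \<xi>|lborel. M * ((bracket \<xi> powr s * norm (F \<xi>))\<^sup>2 + decay \<xi>))"
    by (intro integral_mono integrable_norm * i le)
  also have "\<dots> = M * ((LINT \<xi>|lborel. (bracket \<xi> powr s * norm (F \<xi>))\<^sup>2) + (LINT x|lborel. decay (x :: 'a)))"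
    by (simp add: F decay_integrable)
  finally show "norm (LINT \<xi>|lborel. F \<xi> * \<phi> \<xi>) \<le>
      M * ((LINT \<xi>|lborel. (bracket \<xi> powr s * norm (F \<xi>))\<^sup>2) + (LINT x|lborel. decay (x :: 'a)))" .
qed

lemma inverse_fourier_lin:
  assumes "f \<in> schwartz" "g \<in> schwartz"
  shows "inverse_fourier (\<lambda>x. c * f x + g x) = (\<lambda>x. c * inverse_fourier f x + inverse_fourier g x)"
  unfolding inverse_fourier_def[abs_def] fourier_lin[OF assms[THEN schwartz_integrable]]
  by (simp add: algebra_simps)

text \<open>The distribution is defined by transposition, sending g to the integral of
  \<open>F\<close> against \<open>inverse_fourier g\<close>. The uniform estimate
  \<open>inverse_fourier_decay\<close> makes it sequentially continuous, and the value 0 off the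
  Schwartz space is the convention built into \<open>tempered\<close>.\<close>

lemma ex_dist_with_fourier_fun:
  fixes F :: "'a::euclidean_space \<Rightarrow> complex"
  assumes F: "F \<in> borel_measurable borel" "Hs_integrable s F"
  shows "\<exists>u. has_fourier_fun u F"
proof -
  let ?m = "weight_order s TYPE('a)"
  define T where "T g = (if g \<in> schwartz then LINT \<xi>|lborel. F \<xi> * inverse_fourier g \<xi> else 0)" for g
  obtain C where C: "C \<ge> 0" "\<And>f x. f \<in> schwartz \<Longrightarrow>
     (1 + norm (x::'a)) ^ ?m * norm (inverse_fourier f x) \<le> C * schwartz_norm (2 * DIM('a) + ?m) f"
    using inverse_fourier_decay[where 'a='a, of ?m] by blast
  note wi = weighted_product_integrable[OF F schwartz_measurable]
  have iS: "integrable lborel (\<lambda>\<xi>. F \<xi> * f \<xi>)" if f: "f \<in> schwartz" for f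
    using schwartz_bound[OF f, of ?m] wi[OF f] by metis
  have lin: "T (\<lambda>x. c * f x + g x) = c * T f + T g" if f: "f \<in> schwartz" and g: "g \<in> schwartz" for f g c
  proof -
    have "(LINT \<xi>|lborel. F \<xi> * (c * inverse_fourier f \<xi> + inverse_fourier g \<xi>)) =
        (LINT \<xi>|lborel. c * (F \<xi> * inverse_fourier f \<xi>) + F \<xi> * inverse_fourier g \<xi>)"
      by (simp add: algebra_simps)
    also have "\<dots> = c * T f + T g"
      using f g by (simp add: T_def iS inverse_fourier_schwartz)
    finally show ?thesis
      using f g by (simp add: T_def schwartz_lin inverse_fourier_lin)
  qed
  have "tempered T"
    unfolding tempered_def
  proof (intro conjI ballI allI impI)
    show "T (\<lambda>x. f x + g x) = T f + T g" if "f \<in> schwartz" "g \<in> schwartz" for f g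
      using lin[OF that, of 1] by simp
    have "T (\<lambda>_. 0) = 0" using lin[OF zero_schwartz zero_schwartz, of 1] by simp
    then show "T (\<lambda>x. c * f x) = c * T f" if "f \<in> schwartz" for f c
      using lin[OF that zero_schwartz, of c] by simp
    show "T f = 0" if "f \<notin> schwartz" for f using that by (simp add: T_def)
    fix f :: "nat \<Rightarrow> 'a \<Rightarrow> complex" assume f: "schwartz_null_seq f"
    then have fs: "f k \<in> schwartz" for k by (auto simp: schwartz_null_seq_def)
    let ?S = "(LINT \<xi>|lborel. (bracket \<xi> powr s * norm (F \<xi>))\<^sup>2) + (LINT x|lborel. decay (x :: 'a))"
    have Tk: "norm (T (f k)) \<le> C * schwartz_norm (2 * DIM('a) + ?m) (f k) * ?S" for k
      using weighted_product_integral[OF F schwartz_measurable[OF inverse_fourier_schwartz[OF fs[of k]]] C(2)[OF fs[of k]]] fs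
      by (simp add: T_def)
    have lim: "(\<lambda>k. C * schwartz_norm (2 * DIM('a) + ?m) (f k) * ?S) \<longlonglongrightarrow> 0"
      using f by (intro tendsto_mult_left_zero tendsto_mult_right_zero) (auto simp: schwartz_null_seq_def)
    show "(\<lambda>k. T (f k)) \<longlonglongrightarrow> 0"
      by (rule Lim_null_comparison[OF always_eventually lim]) (use Tk in blast)
  qed
  then have "pairing (Abs_tempered_dist T) = T" by (simp add: Abs_tempered_dist_inverse)
  then have "has_fourier_fun (Abs_tempered_dist T) F"
    unfolding has_fourier_fun_def using F iS
    by (auto simp: T_def fourier_schwartz inverse_fourier_fourier)
  then show ?thesis by blast
qed

text \<open>This removes the choice hidden in \<open>fourier_fun\<close>: two representing functions
  agree almost everywhere, so any of them computes the norm.\<close>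

lemma Hs_norm_square:
  assumes F: "has_fourier_fun u F"
  shows "(Hs_norm s u)\<^sup>2 = (LINT \<xi>|lborel. (bracket \<xi> powr s * norm (F \<xi>))\<^sup>2)"
proof -
  have "(LINT \<xi>|lborel. (bracket \<xi> powr s * norm (fourier_fun u \<xi>))\<^sup>2)
    = (LINT \<xi>|lborel. (bracket \<xi> powr s * norm (F \<xi>))\<^sup>2)"
  proof (rule integral_cong_AE)
    show "AE \<xi> in lborel. (bracket \<xi> powr s * norm (fourier_fun u \<xi>))\<^sup>2 = (bracket \<xi> powr s * norm (F \<xi>))\<^sup>2"
      using has_fourier_fun_unique[OF has_fourier_fun_fourier_fun[OF F] F] by eventually_elim simp
  qed (use has_fourier_fun_measurable[OF F] has_fourier_fun_measurable[OF has_fourier_fun_fourier_fun[OF F]] in measurable)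
  moreover have "0 \<le> (LINT \<xi>|lborel. (bracket \<xi> powr s * norm (F \<xi>))\<^sup>2)" by (intro integral_nonneg_AE) auto
  ultimately show ?thesis unfolding Hs_norm_def by simp
qed

lemma Hs_norm_nonneg: "0 \<le> Hs_norm s u"
  unfolding Hs_norm_def by (intro real_sqrt_ge_zero integral_nonneg_AE) auto

lemma HsE:
  assumes "u \<in> Hs s"
  obtains F where "has_fourier_fun u F" "Hs_integrable s F" "real_dist u"
  using assms by (auto simp: Hs_def)

lemma HsI: "has_fourier_fun u F \<Longrightarrow> Hs_integrable s F \<Longrightarrow> real_dist u \<Longrightarrow> u \<in> Hs s"
  by (auto simp: Hs_def)

text \<open>A triangle inequality for squares with a factor 2. It survives integration directly and
  suffices for every approximation argument below.\<close>

lemma norm_square_lin_le: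
  fixes x y c :: complex
  shows "(w * norm (c * x + y))\<^sup>2 \<le> 2 * ((norm c)\<^sup>2 * (w * norm x)\<^sup>2 + (w * norm y)\<^sup>2)"
proof -
  have "(norm (c * x + y))\<^sup>2 \<le> (norm c * norm x + norm y)\<^sup>2"
    by (intro power_mono norm_triangle_mono) (auto simp: norm_mult)
  also have "\<dots> \<le> 2 * ((norm c * norm x)\<^sup>2 + (norm y)\<^sup>2)"
    using sum_squares_bound[of "norm c * norm x" "norm y"] by (simp add: power2_sum)
  finally have "w\<^sup>2 * (norm (c * x + y))\<^sup>2 \<le> w\<^sup>2 * (2 * ((norm c * norm x)\<^sup>2 + (norm y)\<^sup>2))"
    by (intro mult_left_mono) auto
  then show ?thesis by (simp add: power_mult_distrib algebra_simps)
qed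

lemma Hs_integrable_lin:
  assumes F: "F \<in> borel_measurable borel" "Hs_integrable s F" and G: "G \<in> borel_measurable borel"
    "Hs_integrable s G"
  shows "Hs_integrable s (\<lambda>\<xi>. c * F \<xi> + G \<xi>)"
proof (rule Bochner_Integration.integrable_bound)
  show "integrable lborel (\<lambda>\<xi>. 2 * ((norm c)\<^sup>2 * (bracket \<xi> powr s * norm (F \<xi>))\<^sup>2
    + (bracket \<xi> powr s * norm (G \<xi>))\<^sup>2))"
    by (intro integrable_mult_right Bochner_Integration.integrable_add F G)
  show "(\<lambda>\<xi>. (bracket \<xi> powr s * norm (c * F \<xi> + G \<xi>))\<^sup>2) \<in> borel_measurable lborel"
    using F G by measurable
  have "norm ((bracket \<xi> powr s * norm (c * F \<xi> + G \<xi>))\<^sup>2)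
    \<le> norm (2 * ((norm c)\<^sup>2 * (bracket \<xi> powr s * norm (F \<xi>))\<^sup>2 + (bracket \<xi> powr s * norm (G \<xi>))\<^sup>2))" for \<xi>
    unfolding real_norm_def abs_of_nonneg[OF zero_le_power2]
    by (rule order_trans[OF norm_square_lin_le abs_ge_self])
  then show "AE \<xi> in lborel. norm ((bracket \<xi> powr s * norm (c * F \<xi> + G \<xi>))\<^sup>2)
    \<le> norm (2 * ((norm c)\<^sup>2 * (bracket \<xi> powr s * norm (F \<xi>))\<^sup>2 + (bracket \<xi> powr s * norm (G \<xi>))\<^sup>2))"
    by (rule AE_I2)
qed

lemma real_dist_lin: "real_dist u \<Longrightarrow> real_dist v \<Longrightarrow> real_dist (c *\<^sub>R u + v)"
  by (simp add: real_dist_def plus_tempered_dist.rep_eq scaleR_tempered_dist.rep_eq)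

lemma Hs_lin:
  assumes "u \<in> Hs s" "v \<in> Hs s"
  shows "c *\<^sub>R u + v \<in> Hs s"
proof -
  from assms(1) obtain F where F: "has_fourier_fun u F" "Hs_integrable s F" "real_dist u" by (rule HsE)
  from assms(2) obtain G where G: "has_fourier_fun v G" "Hs_integrable s G" "real_dist v" by (rule HsE)
  show ?thesis
    by (rule HsI[OF has_fourier_fun_lin[OF F(1) G(1)] Hs_integrable_lin real_dist_lin])
      (use F G has_fourier_fun_measurable in auto)
qed

lemma has_fourier_fun_zero: "has_fourier_fun 0 (\<lambda>_. 0)"
  by (simp add: has_fourier_fun_def zero_tempered_dist.rep_eq)

lemma Hs_zero: "0 \<in> Hs s"
  by (rule HsI[OF has_fourier_fun_zero]) (auto simp: real_dist_def zero_tempered_dist.rep_eq)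

lemma Hs_add: "u \<in> Hs s \<Longrightarrow> v \<in> Hs s \<Longrightarrow> u + v \<in> Hs s"
  using Hs_lin[of u s v 1] by simp

lemma Hs_scale: "u \<in> Hs s \<Longrightarrow> c *\<^sub>R u \<in> Hs s"
  using Hs_lin[OF _ Hs_zero, of u s c] by simp

lemma Hs_diff: "u \<in> Hs s \<Longrightarrow> v \<in> Hs s \<Longrightarrow> u - v \<in> Hs s"
  using Hs_lin[of v s u "-1"] by simp

lemma Hs_norm_lin_square_le:
  assumes "u \<in> Hs s" "v \<in> Hs s"
  shows "(Hs_norm s (c *\<^sub>R u + v))\<^sup>2 \<le> 2 * (c\<^sup>2 * (Hs_norm s u)\<^sup>2 + (Hs_norm s v)\<^sup>2)"
proof -
  from assms(1) obtain F where F: "has_fourier_fun u F" "Hs_integrable s F" by (rule HsE)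
  from assms(2) obtain G where G: "has_fourier_fun v G" "Hs_integrable s G" by (rule HsE)
  have "(LINT \<xi>|lborel. (bracket \<xi> powr s * norm (of_real c * F \<xi> + G \<xi>))\<^sup>2)
     \<le> (LINT \<xi>|lborel. 2 * ((norm (of_real c :: complex))\<^sup>2 * (bracket \<xi> powr s * norm (F \<xi>))\<^sup>2
       + (bracket \<xi> powr s * norm (G \<xi>))\<^sup>2))"
    using F G has_fourier_fun_measurable
    by (intro integral_mono Hs_integrable_lin norm_square_lin_le integrable_mult_right Bochner_Integration.integrable_add) auto
  also have "\<dots> = 2 * (c\<^sup>2 * (LINT \<xi>|lborel. (bracket \<xi> powr s * norm (F \<xi>))\<^sup>2)
    + (LINT \<xi>|lborel. (bracket \<xi> powr s * norm (G \<xi>))\<^sup>2))"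
    using F G by simp
  finally show ?thesis
    unfolding Hs_norm_square[OF has_fourier_fun_lin[OF F(1) G(1)]] Hs_norm_square[OF F(1)] Hs_norm_square[OF G(1)] .
qed

lemma Hs_norm_scale:
  assumes F: "has_fourier_fun u F"
  shows "Hs_norm s (c *\<^sub>R u) = \<bar>c\<bar> * Hs_norm s u"
proof -
  have "has_fourier_fun (c *\<^sub>R u) (\<lambda>\<xi>. of_real c * F \<xi>)"
    using has_fourier_fun_lin[OF F has_fourier_fun_zero, of c] by simp
  from Hs_norm_square[OF this, of s] have "(Hs_norm s (c *\<^sub>R u))\<^sup>2 = (\<bar>c\<bar> * Hs_norm s u)\<^sup>2"
    by (simp add: norm_mult power_mult_distrib Hs_norm_square[OF F] mult.left_commute[of _ "c\<^sup>2"])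
  then show ?thesis using Hs_norm_nonneg by (metis abs_ge_zero mult_nonneg_nonneg power2_eq_iff_nonneg)
qed

lemma Hs_norm_diff_commute: "u \<in> Hs s \<Longrightarrow> v \<in> Hs s \<Longrightarrow> Hs_norm s (u - v) = Hs_norm s (v - u)"
  using Hs_norm_scale[of "v - u" _ s "-1"]
    by (metis (no_types) Hs_diff HsE abs_minus_cancel abs_one minus_diff_eq mult_1 scaleR_minus1_left)

text \<open>\<open>weighted_product_integral\<close> is not homogeneous in \<open>u\<close>; applying it to \<open>t *\<^sub>R u\<close> and choosing \<open>t\<close> gives
  the linear bound.\<close>

lemma pairing_Hs_bound:
  fixes \<phi> :: "'a::euclidean_space \<Rightarrow> complex"
  assumes \<phi>: "\<phi> \<in> schwartz"
  shows "\<exists>C\<ge>0. \<forall>u F. has_fourier_fun u F \<longrightarrow> Hs_integrable s F \<longrightarrow> norm (pairing u \<phi>) \<le> C * Hs_norm s u"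
proof -
  let ?D = "LINT x|lborel. decay (x :: 'a)"
  obtain M where M: "\<And>x. (1 + norm x) ^ weight_order s TYPE('a) * norm (inverse_fourier \<phi> x) \<le> M"
    using schwartz_bound[OF inverse_fourier_schwartz[OF \<phi>]] by blast
  have "0 \<le> M" using order_trans[OF _ M[of 0]] by simp
  have key: "norm (pairing u \<phi>) \<le> M * ((Hs_norm s u)\<^sup>2 + ?D)" if F: "has_fourier_fun u F"
    "Hs_integrable s F" for u F
  proof -
    have "pairing u \<phi> = (LINT \<xi>|lborel. F \<xi> * inverse_fourier \<phi> \<xi>)"
      using F(1) inverse_fourier_schwartz[OF \<phi>] fourier_inverse_fourier[OF \<phi>] unfolding has_fourier_fun_def by metis
    then show ?thesis
      using weighted_product_integral[OF has_fourier_fun_measurable[OF F(1)] F(2) schwartz_measurable[OF inverse_fourier_schwartz[OF \<phi>]] M]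
      by (simp add: Hs_norm_square[OF F(1)])
  qed
  have "norm (pairing u \<phi>) \<le> (M * (1 + ?D)) * Hs_norm s u" if F: "has_fourier_fun u F"
    "Hs_integrable s F" for u F
  proof -
    let ?n = "Hs_norm s u"
    have t: "t * norm (pairing u \<phi>) \<le> M * (t\<^sup>2 * ?n\<^sup>2 + ?D)" if "t > 0" for t :: real
    proof -
      have "has_fourier_fun (t *\<^sub>R u) (\<lambda>\<xi>. of_real t * F \<xi> + 0)" "Hs_integrable s (\<lambda>\<xi>. of_real t * F \<xi> + 0)"
        using has_fourier_fun_lin[OF F(1) has_fourier_fun_zero, of t]
          Hs_integrable_lin[OF has_fourier_fun_measurable[OF F(1)] F(2), of "\<lambda>_. 0" "of_real t"] by auto
      from key[OF this] show ?thesis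
        using that
          by (simp add: Hs_norm_scale[OF F(1)] power_mult_distrib scaleR_tempered_dist.rep_eq norm_mult)
    qed
    show ?thesis
    proof (cases "?n = 0")
      case True
      have "norm (pairing u \<phi>) = 0"
      proof (rule ccontr)
        assume "norm (pairing u \<phi>) \<noteq> 0"
        then have p: "norm (pairing u \<phi>) > 0" by simp
        \<comment> \<open>For norm 0 the bound reads
          \<open>t * norm (pairing u \<phi>) \<le> M * ?D\<close> for all t > 0. This choice makes
          the left side equal to \<open>M * ?D + 1\<close>.\<close>
        define T where "T = (M * ?D + 1) / norm (pairing u \<phi>)"
        have "0 \<le> M * ?D" using \<open>0 \<le> M\<close> decay_integral_nonneg[where 'a='a] by simp
        then have "T > 0" unfolding T_def using p by (intro divide_pos_pos) auto
        from t[OF this] show False using p True by (simp add: T_def)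
      qed
      then show ?thesis using True by simp
    next
      case False
      then have n: "?n > 0" using Hs_norm_nonneg[of s u] by simp
      then have "(1 / ?n) * norm (pairing u \<phi>) \<le> M * (1 + ?D)"
        using t[of "1 / ?n"] by (simp add: power_divide)
      then show ?thesis using n by (simp add: field_simps)
    qed
  qed
  then show ?thesis using \<open>0 \<le> M\<close> decay_integral_nonneg[where 'a='a]
    by (intro exI[of _ "M * (1 + ?D)"]) auto
qed

lemma pairing_Hs_bound_in:
  assumes "\<phi> \<in> schwartz"
  obtains C where "C \<ge> 0" "\<And>u. u \<in> Hs s \<Longrightarrow> norm (pairing u \<phi>) \<le> C * Hs_norm s u"
  using pairing_Hs_bound[OF assms, of s] by (metis HsE)

lemma Hs_norm_eq_zeroD:
  assumes u: "u \<in> Hs s" and z: "Hs_norm s u = 0"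
  shows "u = 0"
proof -
  have "pairing u \<phi> = 0" for \<phi>
  proof (cases "\<phi> \<in> schwartz")
    case True
    then obtain C where "\<And>u. u \<in> Hs s \<Longrightarrow> norm (pairing u \<phi>) \<le> C * Hs_norm s u"
      using pairing_Hs_bound_in[of \<phi> s] by blast
    from this[OF u] z show ?thesis by simp
  next
    case False
    then show ?thesis using pairing[of u] by (simp add: tempered_def)
  qed
  then have "pairing u = pairing 0" by (auto simp: zero_tempered_dist.rep_eq)
  then show ?thesis by (simp add: pairing_inject)
qed

text \<open>The limit is found among the representing functions and turned back into a distribution
  by \<open>ex_dist_with_fourier_fun\<close>. Reality is not visible on that side; it passes to the
  limit because norm convergence implies convergence of all pairings.\<close>

lemma Hs_complete:
  fixes u :: "nat \<Rightarrow> 'a::euclidean_space tempered_dist"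
  assumes u: "\<And>n. u n \<in> Hs s"
    and Cauchy: "\<And>e. 0 < e \<Longrightarrow> \<exists>N. \<forall>m\<ge>N. \<forall>n\<ge>N. Hs_norm s (u m - u n) < e"
  shows "\<exists>v\<in>Hs s. (\<lambda>n. Hs_norm s (u n - v)) \<longlonglongrightarrow> 0"
proof -
  have "\<exists>F. has_fourier_fun (u n) F \<and> Hs_integrable s F" for n using u[of n] by (auto simp: Hs_def)
  then have "\<exists>F. \<forall>n. has_fourier_fun (u n) (F n) \<and> Hs_integrable s (F n)" by (intro choice allI)
  then obtain F where F: "\<And>n. has_fourier_fun (u n) (F n)" "\<And>n. Hs_integrable s (F n)" by blast
  note Fm [measurable] = has_fourier_fun_measurable[OF F(1)]
  have "\<exists>G \<in> borel_measurable lborel. \<forall>e>0. \<exists>N. \<forall>n\<ge>N.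
    integrable lborel (\<lambda>x. (bracket x powr s * norm (G x - F n x))\<^sup>2)
      \<and> (LINT x|lborel. (bracket x powr s * norm (G x - F n x))\<^sup>2) \<le> e"
  proof (rule weighted_L2_complete)
    show "integrable lborel (\<lambda>x. (bracket x powr s * norm (F m x - F n x))\<^sup>2)" for m n
      using Hs_integrable_lin[OF Fm F(2) Fm F(2), of "-1" n m] by simp
    fix e :: real assume "0 < e"
    then obtain N where N: "\<And>m n. N \<le> m \<Longrightarrow> N \<le> n \<Longrightarrow> Hs_norm s (u m - u n) < sqrt e"
      using Cauchy[of "sqrt e"] by auto
    have "(LINT x|lborel. (bracket x powr s * norm (F m x - F n x))\<^sup>2) \<le> e" if "N \<le> m" "N \<le> n" for m n
    proof -
      have "(Hs_norm s (u m - u n))\<^sup>2 \<le> (sqrt e)\<^sup>2"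
        by (intro power_mono Hs_norm_nonneg less_imp_le N that)
      then show ?thesis using \<open>0 < e\<close> by (simp add: Hs_norm_square[OF has_fourier_fun_diff[OF F(1) F(1)]])
    qed
    then show "\<exists>N. \<forall>m\<ge>N. \<forall>n\<ge>N. (LINT x|lborel. (bracket x powr s * norm (F m x - F n x))\<^sup>2) \<le> e" by blast
  qed (use Fm in auto)
  then obtain G where Gm [measurable]: "G \<in> borel_measurable borel" and G: "\<And>e. e > 0 \<Longrightarrow> \<exists>N. \<forall>n\<ge>N.
    Hs_integrable s (\<lambda>x. G x - F n x) \<and> (LINT x|lborel. (bracket x powr s * norm (G x - F n x))\<^sup>2) \<le> e"
    by auto
  obtain N where N: "\<And>n. n \<ge> N \<Longrightarrow> Hs_integrable s (\<lambda>x. G x - F n x)" using G[of 1] by auto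
  \<comment> \<open>\<open>G\<close> is the sum of \<open>F N\<close> and \<open>G - F N\<close>,
    both of finite weighted norm.\<close>
  have Gi: "Hs_integrable s G"
    using Hs_integrable_lin[OF Fm F(2) _ N[of N], of 1 N] by simp
  obtain v where v: "has_fourier_fun v G" using ex_dist_with_fourier_fun[OF Gm Gi] by blast
  have d: "has_fourier_fun (u n - v) (\<lambda>\<xi>. F n \<xi> - G \<xi>)" "Hs_integrable s (\<lambda>\<xi>. F n \<xi> - G \<xi>)" for n
    using has_fourier_fun_diff[OF F(1) v, of n] Hs_integrable_lin[OF Gm Gi Fm F(2), of "-1" n] by auto
  have lim: "(\<lambda>n. Hs_norm s (u n - v)) \<longlonglongrightarrow> 0"
  proof (rule LIMSEQ_I)
    fix e :: real assume e: "0 < e"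
    then have "(e / 2)\<^sup>2 > 0" by simp
    from G[OF this] obtain N where N: "\<And>n. n \<ge> N
      \<Longrightarrow> (LINT x|lborel. (bracket x powr s * norm (G x - F n x))\<^sup>2) \<le> (e / 2)\<^sup>2"
      by blast
    have "norm (Hs_norm s (u n - v) - 0) < e" if n: "n \<ge> N" for n
    proof -
      have "(Hs_norm s (u n - v))\<^sup>2 \<le> (e / 2)\<^sup>2"
        using N[OF n] unfolding Hs_norm_square[OF d(1)] norm_minus_commute[of "F n x" "G x" for x] .
      then have "Hs_norm s (u n - v) \<le> e / 2" by (rule power2_le_imp_le) (use e in simp)
      then show ?thesis using e Hs_norm_nonneg[of s "u n - v"] by simp
    qed
    then show "\<exists>no. \<forall>n\<ge>no. norm (Hs_norm s (u n - v) - 0) < e" by blast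
  qed
  have plim: "(\<lambda>n. pairing (u n) \<phi>) \<longlonglongrightarrow> pairing v \<phi>" if \<phi>: "\<phi> \<in> schwartz" for \<phi>
  proof -
    obtain C where C: "\<And>u F. has_fourier_fun u F \<Longrightarrow> Hs_integrable s F \<Longrightarrow> norm (pairing u \<phi>) \<le> C * Hs_norm s u"
      using pairing_Hs_bound[OF \<phi>, of s] by blast
    have "(\<lambda>n. pairing (u n - v) \<phi>) \<longlonglongrightarrow> 0"
    proof (rule Lim_null_comparison)
      show "\<forall>\<^sub>F n in sequentially. norm (pairing (u n - v) \<phi>) \<le> C * Hs_norm s (u n - v)"
        by (intro always_eventually allI C[OF d(1) d(2)])
      show "(\<lambda>n. C * Hs_norm s (u n - v)) \<longlonglongrightarrow> 0" using lim by (intro tendsto_mult_right_zero)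
    qed
    then show ?thesis by (simp add: minus_tempered_dist.rep_eq LIM_zero_iff)
  qed
  have "real_dist v"
    unfolding real_dist_def
  proof
    fix f :: "'a \<Rightarrow> complex" assume f: "f \<in> schwartz"
    have "pairing (u n) (\<lambda>x. cnj (f x)) = cnj (pairing (u n) f)" for n
      using u[of n] f by (auto simp: Hs_def real_dist_def)
    then have "(\<lambda>n. cnj (pairing (u n) f)) \<longlonglongrightarrow> pairing v (\<lambda>x. cnj (f x))"
      using plim[OF schwartz_cnj[OF f]] by simp
    moreover have "(\<lambda>n. cnj (pairing (u n) f)) \<longlonglongrightarrow> cnj (pairing v f)"
      by (intro tendsto_cnj plim f)
    ultimately show "pairing v (\<lambda>x. cnj (f x)) = cnj (pairing v f)" by (rule LIMSEQ_unique)
  qed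
  then have "v \<in> Hs s" using HsI[OF v Gi] by blast
  then show ?thesis using lim by blast
qed

section \<open>Test functions and their closure\<close>

lemma smooth_lin:
  fixes f g :: "'a::euclidean_space \<Rightarrow> real"
  assumes "smooth f" "smooth g"
  shows "smooth (\<lambda>x. c * f x + g x)"
proof (rule smooth_if_closed_class)
  let ?C = "{\<lambda>x. c * f x + g x | f g :: 'a \<Rightarrow> real. smooth f \<and> smooth g}"
  have inC: "(\<lambda>x. c * f x + g x) \<in> ?C" if "smooth f" "smooth g" for f g :: "'a \<Rightarrow> real"
    using that by blast
  show "(\<lambda>x. c * f x + g x) \<in> ?C" by (rule inC[OF assms])
  have der: "((\<lambda>x. c * f x + g x) has_derivative
      (\<lambda>v. c * frechet_derivative f (at x) v + frechet_derivative g (at x) v)) (at x)"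
    if "smooth f" "smooth g" for f g :: "'a \<Rightarrow> real" and x
    by (intro has_derivative_add has_derivative_mult_right smooth_has_derivative that)
  fix h assume "h \<in> ?C"
  then obtain f g where h: "h = (\<lambda>x. c * f x + g x)" and fg: "smooth f" "smooth g" by blast
  show "h differentiable (at x)" for x unfolding h differentiable_def using der[OF fg] by blast
  show "dirderiv b h \<in> ?C" if b: "b \<in> Basis" for b
    unfolding h frechet_derivative_at[OF der[OF fg], symmetric]
    by (rule inC[OF smooth_dirderiv[OF fg(1) b] smooth_dirderiv[OF fg(2) b]])
qed

lemma smooth_complex_of_real:
  fixes f :: "'a::euclidean_space \<Rightarrow> real"
  assumes f: "smooth f"
  shows "smooth (\<lambda>x. complex_of_real (f x))"
proof (rule smooth_if_closed_class)
  let ?C = "{\<lambda>x. complex_of_real (g x) | g :: 'a \<Rightarrow> real. smooth g}"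
  have inC: "(\<lambda>x. complex_of_real (g x)) \<in> ?C" if "smooth g" for g :: "'a \<Rightarrow> real"
    using that by blast
  show "(\<lambda>x. complex_of_real (f x)) \<in> ?C" by (rule inC[OF f])
  have der: "((\<lambda>x. complex_of_real (g x)) has_derivative
      (\<lambda>v. complex_of_real (frechet_derivative g (at x) v))) (at x)" if "smooth g" for g :: "'a \<Rightarrow> real" and x
    by (intro has_derivative_of_real smooth_has_derivative that)
  fix h assume "h \<in> ?C"
  then obtain g where h: "h = (\<lambda>x. complex_of_real (g x))" and g: "smooth g" by blast
  show "h differentiable (at x)" for x unfolding h differentiable_def using der[OF g] by blast
  show "dirderiv b h \<in> ?C" if b: "b \<in> Basis" for b
    unfolding h frechet_derivative_at[OF der[OF g], symmetric]
    by (rule inC[OF smooth_dirderiv[OF g b]])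
qed

text \<open>Derivatives still vanish off the fixed set \<open>K\<close>, because its complement is
  open. On \<open>K\<close> itself, continuity bounds every weighted value.\<close>

lemma schwartz_if_compact_support:
  fixes f :: "'a::euclidean_space \<Rightarrow> complex"
  assumes f: "smooth f" and K: "compact K" and 0: "\<And>x. x \<notin> K \<Longrightarrow> f x = 0"
  shows "f \<in> schwartz"
proof (rule schwartz_if_closed_class)
  let ?C = "{g :: 'a \<Rightarrow> complex. smooth g \<and> (\<forall>x. x \<notin> K \<longrightarrow> g x = 0)}"
  show "f \<in> ?C" using f 0 by blast
  fix k and g :: "'a \<Rightarrow> complex" assume "g \<in> ?C"
  then have g: "smooth g" and g0: "\<And>x. x \<notin> K \<Longrightarrow> g x = 0" by auto
  show "g differentiable (at x)" for x using smooth_has_derivative[OF g] differentiable_def by blast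
  show "dirderiv b g \<in> ?C" if b: "b \<in> Basis" for b
  proof (intro CollectI conjI allI impI smooth_dirderiv[OF g b])
    fix x assume x: "x \<notin> K"
    have "frechet_derivative (\<lambda>_. 0) (at x) = frechet_derivative g (at x)"
      by (rule frechet_derivative_transform_within_open[of _ _ "- K"])
        (use x g0 K in \<open>auto simp: compact_imp_closed open_Compl\<close>)
    then show "dirderiv b g x = 0" by (metis frechet_derivative_const)
  qed
  have "continuous_on K (\<lambda>x. (1 + norm x) ^ k * norm (g x))"
    using smooth_continuous[OF g] by (intro continuous_intros) (auto intro: continuous_on_subset)
  from compact_imp_bounded[OF compact_continuous_image[OF this K]]
  obtain M where M: "\<And>x. x \<in> K \<Longrightarrow> norm ((1 + norm x) ^ k * norm (g x)) \<le> M"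
    by (auto simp: bounded_iff)
  have "(1 + norm x) ^ k * norm (g x) \<le> max M 0" for x
    using M[of x] g0[of x] by (cases "x \<in> K") auto
  then show "\<exists>M. \<forall>x. (1 + norm x) ^ k * norm (g x) \<le> M" by blast
qed

section \<open>Test functions as distributions\<close>

lemma zero_outside_fun_support: "x \<notin> fun_support f \<Longrightarrow> f x = 0"
  using closure_subset[of "{x. f x \<noteq> 0}"] by (auto simp: fun_support_def)

lemma test_function_schwartz: "f \<in> test_functions U \<Longrightarrow> f \<in> schwartz"
  unfolding test_functions_def using schwartz_if_compact_support zero_outside_fun_support by blast

lemma real_test_function_schwartz:
  assumes "f \<in> test_functions U"
  shows "(\<lambda>x. complex_of_real (f x)) \<in> schwartz"
proof (rule schwartz_if_compact_support)
  show "smooth (\<lambda>x. complex_of_real (f x))" "compact (fun_support f)"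
    using assms smooth_complex_of_real by (auto simp: test_functions_def)
qed (simp add: zero_outside_fun_support)

lemma test_functions_lin:
  fixes f g :: "'a::euclidean_space \<Rightarrow> real"
  assumes f: "f \<in> test_functions U" and g: "g \<in> test_functions U"
  shows "(\<lambda>x. c * f x + g x) \<in> test_functions U"
proof -
  have "fun_support (\<lambda>x. c * f x + g x) \<subseteq> closure ({x. f x \<noteq> 0} \<union> {x. g x \<noteq> 0})"
    unfolding fun_support_def by (intro closure_mono) auto
  also have "\<dots> = fun_support f \<union> fun_support g" by (simp add: fun_support_def closure_Un)
  finally have sub: "fun_support (\<lambda>x. c * f x + g x) \<subseteq> fun_support f \<union> fun_support g" .
  have "compact (fun_support f \<union> fun_support g)" using f g by (auto simp: test_functions_def)
  then have "compact (fun_support (\<lambda>x. c * f x + g x))"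
    using sub by (metis closed_closure closed_Int_compact fun_support_def inf.absorb1)
  then show ?thesis using sub f g by (auto simp: test_functions_def smooth_lin)
qed

lemma zero_test_function: "(\<lambda>_::'a::euclidean_space. 0 :: real) \<in> test_functions U"
proof -
  have "partials bs (\<lambda>_. 0) = (\<lambda>_. 0 :: real)" for bs :: "'a list"
    by (induction bs) auto
  then show ?thesis by (simp add: test_functions_def smooth_def fun_support_def)
qed

lemma schwartz_product_integrable:
  assumes f: "f \<in> schwartz" and g: "g \<in> schwartz"
  shows "integrable lborel (\<lambda>x. f x * g x)"
proof (rule Bochner_Integration.integrable_bound)
  show "integrable lborel (\<lambda>x. complex_of_real (schwartz_norm 0 f) * g x)"
    using schwartz_integrable[OF g] by simp
  show "(\<lambda>x. f x * g x) \<in> borel_measurable lborel"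
    using schwartz_measurable[OF f] schwartz_measurable[OF g] by simp
  show "AE x in lborel. norm (f x * g x) \<le> norm (complex_of_real (schwartz_norm 0 f) * g x)"
    using schwartz_norm_bound[OF f] schwartz_norm_nonneg[OF f, of 0]
    by (intro AE_I2) (auto simp: norm_mult intro!: mult_right_mono)
qed

lemma dist_of_lin:
  assumes f: "f \<in> test_functions U" and g: "g \<in> test_functions U"
  shows "dist_of (\<lambda>x. c * f x + g x) = c *\<^sub>R dist_of f + dist_of g"
proof (rule pairing_inject[THEN iffD1], rule ext)
  fix \<phi> :: "'a \<Rightarrow> complex"
  show "pairing (dist_of (\<lambda>x. c * f x + g x)) \<phi> = pairing (c *\<^sub>R dist_of f + dist_of g) \<phi>"
  proof (cases "\<phi> \<in> schwartz")
    case True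
    note i = schwartz_product_integrable[OF real_test_function_schwartz[OF f] True]
      schwartz_product_integrable[OF real_test_function_schwartz[OF g] True]
    show ?thesis
      using True i
      by (simp add: pairing_dist_of[OF test_functions_lin[OF f g]] pairing_dist_of[OF f] pairing_dist_of[OF g]
          plus_tempered_dist.rep_eq scaleR_tempered_dist.rep_eq distrib_right mult.assoc)
  qed (simp add: pairing_dist_of[OF test_functions_lin[OF f g]] pairing_dist_of[OF f] pairing_dist_of[OF g]
          plus_tempered_dist.rep_eq scaleR_tempered_dist.rep_eq)
qed

lemma dist_of_zero: "dist_of (\<lambda>_. 0) = 0"
  by (rule pairing_inject[THEN iffD1])
    (simp add: pairing_dist_of[OF zero_test_function] zero_tempered_dist.rep_eq fun_eq_iff)

text \<open>The multiplication formula identifies \<open>fourier f\<close> as a representing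
  function; its rapid decay then beats the weight for every real \<open>s\<close>.\<close>

lemma dist_of_in_Hs:
  fixes f :: "'a::euclidean_space \<Rightarrow> real"
  assumes f: "f \<in> test_functions U"
  shows "dist_of f \<in> Hs s"
proof -
  let ?f = "\<lambda>x. complex_of_real (f x)" and ?m = "weight_order s TYPE('a)"
  note fS = real_test_function_schwartz[OF f]
  note FS = fourier_schwartz[OF fS]
  have hf: "has_fourier_fun (dist_of f) (fourier ?f)"
    unfolding has_fourier_fun_def
    using fourier_multiplication_formula[OF schwartz_integrable[OF fS] schwartz_integrable]
    by (auto simp: pairing_dist_of[OF f] fourier_schwartz schwartz_measurable[OF FS] schwartz_product_integrable[OF FS])
  obtain M where M: "\<And>x. (1 + norm x) ^ ?m * norm (fourier ?f x) \<le> M"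
    using schwartz_bound[OF FS] by blast
  have "Hs_integrable s (fourier ?f)"
  proof (rule Bochner_Integration.integrable_bound)
    show "integrable lborel (\<lambda>\<xi> :: 'a. M\<^sup>2 * decay \<xi>)" by (intro integrable_mult_right decay_integrable)
    show "(\<lambda>\<xi>. (bracket \<xi> powr s * norm (fourier ?f \<xi>))\<^sup>2) \<in> borel_measurable lborel"
      using schwartz_measurable[OF FS] by measurable
    have "(bracket \<xi> powr s * norm (fourier ?f \<xi>))\<^sup>2 \<le> M\<^sup>2 * decay \<xi>" for \<xi>
    proof -
      have "1 + norm \<xi> \<noteq> 0" using norm_ge_zero[of \<xi>] by linarith
      then have "(bracket \<xi> powr s * norm (fourier ?f \<xi>))\<^sup>2
          = ((1 + norm \<xi>) ^ ?m * norm (fourier ?f \<xi>))\<^sup>2 * (bracket \<xi> powr s / (1 + norm \<xi>) ^ ?m)\<^sup>2"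
        by (simp add: power_mult_distrib[symmetric])
      also have "\<dots> \<le> M\<^sup>2 * decay \<xi>"
        by (intro mult_mono power_mono M weight_sq_le) auto
      finally show ?thesis .
    qed
    then show "AE \<xi> in lborel. norm ((bracket \<xi> powr s * norm (fourier ?f \<xi>))\<^sup>2) \<le> norm (M\<^sup>2 * decay \<xi>)"
      unfolding real_norm_def abs_of_nonneg[OF zero_le_power2] by (intro AE_I2 order_trans[OF _ abs_ge_self])
  qed
  moreover have "real_dist (dist_of f)"
    unfolding real_dist_def pairing_dist_of[OF f]
  proof
    fix \<phi> :: "'a \<Rightarrow> complex" assume \<phi>: "\<phi> \<in> schwartz"
    have "(LINT x|lborel. ?f x * cnj (\<phi> x)) = (LINT x|lborel. cnj (?f x * \<phi> x))" by simp
    also have "\<dots> = cnj (LINT x|lborel. ?f x * \<phi> x)"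
      by (rule integral_bounded_linear'[OF bounded_linear_cnj bounded_linear_cnj]) simp
    finally show "(if (\<lambda>x. cnj (\<phi> x)) \<in> schwartz then LINT x|lborel. ?f x * cnj (\<phi> x) else 0) =
        cnj (if \<phi> \<in> schwartz then LINT x|lborel. ?f x * \<phi> x else 0)"
      using \<phi> schwartz_cnj[OF \<phi>] by simp
  qed
  ultimately show ?thesis by (rule HsI[OF hf])
qed

lemma dist_of_vanishes_on:
  assumes f: "f \<in> test_functions U" and V: "V \<inter> fun_support f = {}"
  shows "vanishes_on (dist_of f) V"
  unfolding vanishes_on_def
proof
  fix \<phi> :: "'a \<Rightarrow> complex" assume \<phi>: "\<phi> \<in> test_functions V"
  have zero: "complex_of_real (f x) * \<phi> x = 0" for x
  proof (cases "x \<in> fun_support f")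
    case True
    then have "x \<notin> fun_support \<phi>" using V \<phi> by (auto simp: test_functions_def)
    then show ?thesis by (simp add: zero_outside_fun_support)
  qed (simp add: zero_outside_fun_support)
  show "pairing (dist_of f) \<phi> = 0" unfolding pairing_dist_of[OF f] zero by simp
qed

lemma dist_support_subset: "open V \<Longrightarrow> vanishes_on u V \<Longrightarrow> dist_support u \<subseteq> - V"
  unfolding dist_support_def by blast

lemma dist_support_dist_of:
  assumes f: "f \<in> test_functions U"
  shows "dist_support (dist_of f) \<subseteq> U"
proof -
  have "dist_support (dist_of f) \<subseteq> - (- fun_support f)"
    by (intro dist_support_subset dist_of_vanishes_on[OF f]) (auto simp: fun_support_def)
  then show ?thesis using f by (auto simp: test_functions_def)
qed

lemma vanishes_on_subset: "vanishes_on u V \<Longrightarrow> U \<subseteq> V \<Longrightarrow> vanishes_on u U"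
  unfolding vanishes_on_def test_functions_def by blast

lemma Hs_norm_triangle_square:
  assumes "u \<in> Hs s" "v \<in> Hs s" "w \<in> Hs s"
  shows "(Hs_norm s (u - w))\<^sup>2 \<le> 2 * ((Hs_norm s (u - v))\<^sup>2 + (Hs_norm s (v - w))\<^sup>2)"
  using Hs_norm_lin_square_le[OF Hs_diff[OF assms(1,2)] Hs_diff[OF assms(2,3)], of 1] by simp

section \<open>The closure of the test functions\<close>

lemma HtildeD:
  assumes "u \<in> Htilde s \<Omega>" "0 < e"
  obtains f where "f \<in> test_functions \<Omega>" "Hs_norm s (u - dist_of f) < e"
  using assms by (auto simp: Htilde_def)

lemma Htilde_Hs: "u \<in> Htilde s \<Omega> \<Longrightarrow> u \<in> Hs s"
  by (simp add: Htilde_def)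

lemma Hs_norm_zero: "Hs_norm s 0 = 0"
  using Hs_norm_scale[OF has_fourier_fun_zero, of s 0] by simp

lemma Htilde_zero: "0 \<in> Htilde s \<Omega>"
  unfolding Htilde_def using Hs_zero zero_test_function[of \<Omega>]
  by (auto intro!: bexI[of _ "\<lambda>_. 0"] simp: dist_of_zero Hs_norm_zero)

lemma Htilde_lin:
  assumes u: "u \<in> Htilde s \<Omega>" and v: "v \<in> Htilde s \<Omega>"
  shows "c *\<^sub>R u + v \<in> Htilde s \<Omega>"
  unfolding Htilde_def
proof (intro CollectI conjI allI impI)
  show "c *\<^sub>R u + v \<in> Hs s" using u v by (intro Hs_lin Htilde_Hs)
  fix e :: real assume e: "0 < e"
  \<comment> \<open>Chosen so that 2 (c^2 + 1) d^2 <= 2 (|c| + 1)^2 d^2 = e^2 / 2.\<close>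
  define d where "d = e / (2 * (\<bar>c\<bar> + 1))"
  have d: "0 < d" unfolding d_def using e by (intro divide_pos_pos) auto
  obtain f where f: "f \<in> test_functions \<Omega>" "Hs_norm s (u - dist_of f) < d" using HtildeD[OF u d] .
  obtain g where g: "g \<in> test_functions \<Omega>" "Hs_norm s (v - dist_of g) < d" using HtildeD[OF v d] .
  have eq: "c *\<^sub>R u + v - dist_of (\<lambda>x. c * f x + g x) = c *\<^sub>R (u - dist_of f) + (v - dist_of g)"
    unfolding dist_of_lin[OF f(1) g(1)] by (simp add: algebra_simps)
  have "(Hs_norm s (c *\<^sub>R u + v - dist_of (\<lambda>x. c * f x + g x)))\<^sup>2
      \<le> 2 * (c\<^sup>2 * (Hs_norm s (u - dist_of f))\<^sup>2 + (Hs_norm s (v - dist_of g))\<^sup>2)"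
    unfolding eq using u v f g by (intro Hs_norm_lin_square_le Hs_diff Htilde_Hs dist_of_in_Hs)
  also have "\<dots> \<le> 2 * (c\<^sup>2 * d\<^sup>2 + d\<^sup>2)"
    using f(2) g(2) by (intro mult_left_mono add_mono power_mono Hs_norm_nonneg) auto
  also have "\<dots> = 2 * (c\<^sup>2 + 1) * d\<^sup>2" by (simp add: algebra_simps)
  also have "\<dots> \<le> 2 * (\<bar>c\<bar> + 1)\<^sup>2 * d\<^sup>2"
    by (intro mult_right_mono mult_left_mono) (auto simp: power2_sum)
  also have "\<dots> = e\<^sup>2 / 2"
  proof -
    have "(\<bar>c\<bar> + 1) * d = e / 2" unfolding d_def by (simp add: add_pos_nonneg field_simps)
    then have "2 * (\<bar>c\<bar> + 1)\<^sup>2 * d\<^sup>2 = 2 * (e / 2)\<^sup>2" by (metis mult.assoc power_mult_distrib)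
    then show ?thesis by (simp add: power_divide)
  qed
  also have "\<dots> < e\<^sup>2" using e by simp
  finally have "Hs_norm s (c *\<^sub>R u + v - dist_of (\<lambda>x. c * f x + g x)) < e"
    using e by (meson less_imp_le power2_less_imp_less)
  then show "\<exists>f\<in>test_functions \<Omega>. Hs_norm s (c *\<^sub>R u + v - dist_of f) < e"
    using test_functions_lin[OF f(1) g(1)] by blast
qed

lemma Htilde_add: "u \<in> Htilde s \<Omega> \<Longrightarrow> v \<in> Htilde s \<Omega> \<Longrightarrow> u + v \<in> Htilde s \<Omega>"
  using Htilde_lin[of u s \<Omega> v 1] by simp

lemma Htilde_diff: "u \<in> Htilde s \<Omega> \<Longrightarrow> v \<in> Htilde s \<Omega> \<Longrightarrow> u - v \<in> Htilde s \<Omega>"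
  using Htilde_lin[of v s \<Omega> u "-1"] by simp

lemma Htilde_closed:
  assumes u: "u \<in> Hs s" and approx: "\<And>e. 0 < e \<Longrightarrow> \<exists>w\<in>Htilde s \<Omega>. Hs_norm s (u - w) < e"
  shows "u \<in> Htilde s \<Omega>"
  unfolding Htilde_def
proof (intro CollectI conjI allI impI u)
  fix e :: real assume e: "0 < e"
  \<comment> \<open>Half of \<open>e\<close> suffices despite the factor 2 in
    \<open>Hs_norm_triangle_square\<close>: 2 ((e/2)^2 + (e/2)^2) = e^2, and both approximations are
    strict.\<close>
  then have e2: "0 < e / 2" by simp
  obtain w where w: "w \<in> Htilde s \<Omega>" "Hs_norm s (u - w) < e / 2" using approx[OF e2] by blast
  obtain f where f: "f \<in> test_functions \<Omega>" "Hs_norm s (w - dist_of f) < e / 2" using HtildeD[OF w(1) e2] .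
  have "(Hs_norm s (u - dist_of f))\<^sup>2 \<le> 2 * ((Hs_norm s (u - w))\<^sup>2 + (Hs_norm s (w - dist_of f))\<^sup>2)"
    by (intro Hs_norm_triangle_square u Htilde_Hs[OF w(1)] dist_of_in_Hs[OF f(1)])
  also have "\<dots> < 2 * ((e / 2)\<^sup>2 + (e / 2)\<^sup>2)"
    using w(2) f(2) by (intro mult_strict_left_mono add_strict_mono power_strict_mono Hs_norm_nonneg) auto
  also have "\<dots> = e\<^sup>2" by (simp add: power_divide)
  finally have "Hs_norm s (u - dist_of f) < e" using e by (meson less_imp_le power2_less_imp_less)
  then show "\<exists>f\<in>test_functions \<Omega>. Hs_norm s (u - dist_of f) < e" using f(1) by blast
qed

text \<open>The pairing with a fixed test function is continuous for the norm, so vanishing outside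
  the closure of \<Omega> passes from test functions to their limits.\<close>

lemma Htilde_vanishes_on:
  assumes u: "u \<in> Htilde s \<Omega>"
  shows "vanishes_on u (- closure \<Omega>)"
  unfolding vanishes_on_def
proof
  fix \<phi> :: "'a \<Rightarrow> complex" assume \<phi>: "\<phi> \<in> test_functions (- closure \<Omega>)"
  obtain C where C: "C \<ge> 0" "\<And>u. u \<in> Hs s \<Longrightarrow> norm (pairing u \<phi>) \<le> C * Hs_norm s u"
    using pairing_Hs_bound_in[OF test_function_schwartz[OF \<phi>], of s] by blast
  have "norm (pairing u \<phi>) \<le> e" if e: "0 < e" for e
  proof -
    have "0 < e / (C + 1)" using e C by simp
    from HtildeD[OF u this] obtain f where f: "f \<in> test_functions \<Omega>"
      "Hs_norm s (u - dist_of f) < e / (C + 1)" .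
    have "- closure \<Omega> \<inter> fun_support f = {}"
      using f(1) closure_subset[of \<Omega>] by (auto simp: test_functions_def)
    then have "pairing (dist_of f) \<phi> = 0"
      using dist_of_vanishes_on[OF f(1)] \<phi> by (auto simp: vanishes_on_def)
    then have "norm (pairing u \<phi>) = norm (pairing (u - dist_of f) \<phi>)"
      by (simp add: minus_tempered_dist.rep_eq)
    also have "\<dots> \<le> C * Hs_norm s (u - dist_of f)"
      using u f by (intro C Hs_diff Htilde_Hs dist_of_in_Hs)
    also have "\<dots> \<le> C * (e / (C + 1))" using f(2) C by (intro mult_left_mono) auto
    also have "\<dots> \<le> e" using C e by (simp add: field_simps)
    finally show ?thesis .
  qed
  then have "norm (pairing u \<phi>) \<le> 0" by (rule field_le_epsilon[of _ 0, simplified])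
  then show "pairing u \<phi> = 0" by simp
qed

lemma dist_support_Htilde: "u \<in> Htilde s \<Omega> \<Longrightarrow> dist_support u \<subseteq> closure \<Omega>"
  using dist_support_subset[OF _ Htilde_vanishes_on, of "\<Omega>" u] by auto

lemma Htilde_complete:
  assumes u: "\<And>n. u n \<in> Htilde s \<Omega>"
    and Cauchy: "\<And>e. 0 < e \<Longrightarrow> \<exists>N. \<forall>m\<ge>N. \<forall>n\<ge>N. Hs_norm s (u m - u n) < e"
  shows "\<exists>v\<in>Htilde s \<Omega>. (\<lambda>n. Hs_norm s (u n - v)) \<longlonglongrightarrow> 0"
proof -
  have uH: "u n \<in> Hs s" for n using u by (rule Htilde_Hs)
  obtain v where v: "v \<in> Hs s" and lim: "(\<lambda>n. Hs_norm s (u n - v)) \<longlonglongrightarrow> 0"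
    using Hs_complete[OF uH Cauchy] by blast
  have "v \<in> Htilde s \<Omega>"
  proof (rule Htilde_closed[OF v])
    fix e :: real assume "0 < e"
    from order_tendstoD(2)[OF lim this] obtain n where "Hs_norm s (u n - v) < e"
      by (auto simp: eventually_sequentially)
    then have "Hs_norm s (v - u n) < e" using Hs_norm_diff_commute[OF v uH[of n]] by simp
    then show "\<exists>w\<in>Htilde s \<Omega>. Hs_norm s (v - w) < e" using u by blast
  qed
  then show ?thesis using lim by blast
qed

section \<open>The Lax--Milgram theorem\<close>

text \<open>A set and a function replace a Hilbert space type, since
  \<open>Htilde s \<Omega>\<close> carries no norm class. Only nonnegativity and completeness are
  asked of \<open>N\<close>; everything else about the geometry enters through the bounds and the
  coercivity of the forms.\<close>

locale complete_subspace =
  fixes V :: "'v::real_vector set" and N :: "'v \<Rightarrow> real"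
  assumes zero_in: "0 \<in> V"
    and lin_in: "u \<in> V \<Longrightarrow> v \<in> V \<Longrightarrow> c *\<^sub>R u + v \<in> V"
    and N_nonneg: "0 \<le> N u"
    and complete: "(\<And>n. w n \<in> V) \<Longrightarrow> (\<And>e. 0 < e \<Longrightarrow> \<exists>K. \<forall>m\<ge>K. \<forall>n\<ge>K. N (w m - w n) < e) \<Longrightarrow>
      \<exists>v\<in>V. (\<lambda>n::nat. N (w n - v)) \<longlonglongrightarrow> 0"
begin

definition bounded_functional :: "('v \<Rightarrow> real) \<Rightarrow> bool" where
  "bounded_functional \<psi> \<longleftrightarrow> (\<forall>u\<in>V. \<forall>v\<in>V. \<forall>c. \<psi> (c *\<^sub>R u + v) = c * \<psi> u + \<psi> v) \<and>
     (\<exists>D\<ge>0. \<forall>u\<in>V. \<bar>\<psi> u\<bar> \<le> D * N u)"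

definition bounded_form :: "('v \<Rightarrow> 'v \<Rightarrow> real) \<Rightarrow> bool" where
  "bounded_form a \<longleftrightarrow>
     (\<forall>u\<in>V. \<forall>v\<in>V. \<forall>w\<in>V. \<forall>c. a (c *\<^sub>R u + v) w = c * a u w + a v w \<and> a w (c *\<^sub>R u + v) = c * a w u + a w v) \<and>
     (\<exists>C\<ge>0. \<forall>u\<in>V. \<forall>v\<in>V. \<bar>a u v\<bar> \<le> C * N u * N v)"

definition coercive :: "('v \<Rightarrow> 'v \<Rightarrow> real) \<Rightarrow> bool" where
  "coercive a \<longleftrightarrow> (\<exists>k>0. \<forall>u\<in>V. k * (N u)\<^sup>2 \<le> a u u)"

lemma scale_in: "u \<in> V \<Longrightarrow> c *\<^sub>R u \<in> V"
  using lin_in[OF _ zero_in, of u c] by simp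

lemma add_in: "u \<in> V \<Longrightarrow> v \<in> V \<Longrightarrow> u + v \<in> V"
  using lin_in[of u v 1] by simp

lemma diff_in: "u \<in> V \<Longrightarrow> v \<in> V \<Longrightarrow> u - v \<in> V"
  using lin_in[of v u "-1"] by simp

lemma form_simps:
  assumes "bounded_form a" "u \<in> V" "v \<in> V" "w \<in> V"
  shows "a (u + v) w = a u w + a v w" "a w (u + v) = a w u + a w v"
    "a (u - v) w = a u w - a v w" "a w (u - v) = a w u - a w v"
    "a (c *\<^sub>R u) w = c * a u w" "a w (c *\<^sub>R u) = c * a w u"
proof -
  have l: "a (c *\<^sub>R u + v) w = c * a u w + a v w" "a w (c *\<^sub>R u + v) = c * a w u + a w v"
    if "u \<in> V" "v \<in> V" for u v c
    using assms(1,4) that unfolding bounded_form_def by blast+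
  show "a (u + v) w = a u w + a v w" "a w (u + v) = a w u + a w v"
    using l[OF assms(2,3), of 1] by auto
  show "a (u - v) w = a u w - a v w" "a w (u - v) = a w u - a w v"
    using l[OF assms(3,2), of "-1"] by auto
  have "a 0 w = 0" "a w 0 = 0" using l[OF zero_in zero_in, of 1] by auto
  then show "a (c *\<^sub>R u) w = c * a u w" "a w (c *\<^sub>R u) = c * a w u"
    using l[OF assms(2) zero_in, of c] by auto
qed

lemma functional_simps:
  assumes "bounded_functional \<psi>" "u \<in> V" "v \<in> V"
  shows "\<psi> (u + v) = \<psi> u + \<psi> v" "\<psi> (c *\<^sub>R u) = c * \<psi> u"
proof -
  have l: "\<psi> (c *\<^sub>R u + v) = c * \<psi> u + \<psi> v" if "u \<in> V" "v \<in> V" for u v c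
    using assms(1) that unfolding bounded_functional_def by blast
  show "\<psi> (u + v) = \<psi> u + \<psi> v" using l[OF assms(2,3), of 1] by simp
  have "\<psi> 0 = 0" using l[OF zero_in zero_in, of 1] by simp
  then show "\<psi> (c *\<^sub>R u) = c * \<psi> u" using l[OF assms(2) zero_in, of c] by simp
qed

text \<open>\<open>w\<close> minimizes the energy \<open>a w w - 2 * \<psi> w\<close>; minimizing sequences are Cauchy by the parallelogram law.\<close>

lemma riesz_symmetric:
  assumes a: "bounded_form a" and sym: "\<And>u v. u \<in> V \<Longrightarrow> v \<in> V \<Longrightarrow> a u v = a v u"
    and co: "coercive a" and l: "bounded_functional \<psi>"
  shows "\<exists>w\<in>V. \<forall>v\<in>V. a v w = \<psi> v"
proof -
  obtain C where C: "C \<ge> 0" "\<And>u v. u \<in> V \<Longrightarrow> v \<in> V \<Longrightarrow> \<bar>a u v\<bar> \<le> C * N u * N v"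
    using a unfolding bounded_form_def by blast
  obtain D where D: "D \<ge> 0" "\<And>u. u \<in> V \<Longrightarrow> \<bar>\<psi> u\<bar> \<le> D * N u"
    using l unfolding bounded_functional_def by blast
  obtain k where k: "k > 0" "\<And>u. u \<in> V \<Longrightarrow> k * (N u)\<^sup>2 \<le> a u u"
    using co unfolding coercive_def by blast
  define J where "J w = a w w - 2 * \<psi> w" for w
  \<comment> \<open>Completing the square: k n^2 - 2 D n = ((k n - D)^2 - D^2) / k with n =
    \<open>N w\<close>.\<close>
  have Jlow: "- D\<^sup>2 / k \<le> J w" if "w \<in> V" for w
  proof -
    have "0 \<le> (k * N w - D)\<^sup>2" by simp
    then have "- D\<^sup>2 \<le> k * (k * (N w)\<^sup>2 - 2 * D * N w)" by (simp add: power2_eq_square algebra_simps)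
    then have "- D\<^sup>2 / k \<le> k * (N w)\<^sup>2 - 2 * D * N w" using k by (simp add: field_simps)
    also have "\<dots> \<le> J w" unfolding J_def using k(2)[OF that] D(2)[OF that] by simp
    finally show ?thesis .
  qed
  have J_add: "J (u + v) = J u + a v v + 2 * a v u - 2 * \<psi> v" if "u \<in> V" "v \<in> V" for u v
    using that by (simp add: J_def form_simps[OF a] functional_simps[OF l] add_in sym[of u v])
  define m where "m = Inf (J ` V)"
  have bdd: "bdd_below (J ` V)" using Jlow by (intro bdd_belowI) auto
  have m_le: "m \<le> J w" if "w \<in> V" for w unfolding m_def using that bdd by (intro cInf_lower) auto
  have "\<exists>w\<in>V. J w < m + 1 / real (Suc n)" for n
  proof (rule ccontr)
    assume "\<not> ?thesis"
    then have "m + 1 / real (Suc n) \<le> m"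
      unfolding m_def using zero_in by (intro cInf_greatest) (auto simp: not_less)
    then show False by simp
  qed
  then obtain w where w: "\<And>n. w n \<in> V" "\<And>n. J (w n) < m + 1 / real (Suc n)" by metis
  have near: "k * (N (u - v))\<^sup>2 \<le> 4 * e" if "u \<in> V" "v \<in> V" "J u < m + e" "J v < m + e" for u v e
  proof -
    let ?h = "(1/2) *\<^sub>R (u + v)"
    have "k * (N (u - v))\<^sup>2 \<le> a (u - v) (u - v)" using that by (intro k diff_in)
    \<comment> \<open>The linear terms cancel in this combination, and the midpoint
      \<open>?h\<close> lies in \<open>V\<close>, so its energy is at least
      \<open>m\<close>.\<close>
    also have "\<dots> = 2 * J u + 2 * J v - 4 * J ?h"
    proof -
      have uv: "u + v \<in> V" using that by (intro add_in)
      have "J ?h = a (u + v) (u + v) / 4 - \<psi> (u + v)"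
        using uv form_simps(5,6)[OF a uv uv] form_simps(5)[OF a uv uv scale_in[OF uv]] functional_simps(2)[OF l uv uv]
        by (simp add: J_def)
      then show ?thesis
        using that uv
          by (simp add: J_def form_simps[OF a] functional_simps[OF l] diff_in sym[of u v] field_simps)
    qed
    also have "\<dots> \<le> 4 * e" using that m_le[of ?h] by (simp add: scale_in add_in)
    finally show ?thesis .
  qed
  have "\<exists>v\<in>V. (\<lambda>n. N (w n - v)) \<longlonglongrightarrow> 0"
  proof (rule complete[OF w(1)])
    fix e :: real assume e: "0 < e"
    then have "0 < k * e\<^sup>2 / 4" using k by simp
    then obtain K where K: "1 / real (Suc K) < k * e\<^sup>2 / 4"
      using nat_approx_posE by blast
    have "N (w p - w q) < e" if "K \<le> p" "K \<le> q" for p q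
    proof -
      have "J (w r) < m + 1 / real (Suc K)" if "K \<le> r" for r
        using w(2)[of r] that
          by (smt (verit) Suc_le_mono frac_le of_nat_0_less_iff of_nat_le_iff zero_less_Suc)
      then have "k * (N (w p - w q))\<^sup>2 \<le> 4 * (1 / real (Suc K))" using that by (intro near w) auto
      also have "\<dots> < k * e\<^sup>2" using K by simp
      finally have "(N (w p - w q))\<^sup>2 < e\<^sup>2" using k by simp
      then show ?thesis using e by (meson less_imp_le power2_less_imp_less)
    qed
    then show "\<exists>K. \<forall>m\<ge>K. \<forall>n\<ge>K. N (w m - w n) < e" by blast
  qed
  then obtain v where v: "v \<in> V" and lim: "(\<lambda>n. N (w n - v)) \<longlonglongrightarrow> 0" by blast
  have "(\<lambda>n. J (w n) - J v) \<longlonglongrightarrow> 0"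
  proof (rule Lim_null_comparison)
    have "norm (J (w n) - J v) \<le> C * N (w n - v) * N (w n - v) + 2 * (C * N (w n - v) * N v)
      + 2 * (D * N (w n - v))" for n
    proof -
      have d: "w n - v \<in> V" using v w by (intro diff_in)
      have "J (w n) - J v = a (w n - v) (w n - v) + 2 * a (w n - v) v - 2 * \<psi> (w n - v)"
        using J_add[OF v d] by simp
      then show ?thesis using C(2)[OF d d] C(2)[OF d v] D(2)[OF d] unfolding real_norm_def by linarith
    qed
    then show "\<forall>\<^sub>F n in sequentially. norm (J (w n) - J v) \<le> C * N (w n - v) * N (w n - v)
      + 2 * (C * N (w n - v) * N v) + 2 * (D * N (w n - v))"
      by (intro always_eventually allI)
    show "(\<lambda>n. C * N (w n - v) * N (w n - v) + 2 * (C * N (w n - v) * N v) + 2 * (D * N (w n - v))) \<longlonglongrightarrow> 0"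
      using lim by (auto intro!: tendsto_eq_intros)
  qed
  then have "(\<lambda>n. J (w n)) \<longlonglongrightarrow> J v" by (rule LIM_zero_cancel)
  moreover have "(\<lambda>n. m + 1 / real (Suc n)) \<longlonglongrightarrow> m + 0"
    using LIMSEQ_inverse_real_of_nat by (intro tendsto_add tendsto_const) (simp add: inverse_eq_divide)
  ultimately have Jv: "J v \<le> m"
    using w(2) by (intro LIMSEQ_le[of "\<lambda>n. J (w n)" _ "\<lambda>n. m + 1 / real (Suc n)" m]) (auto intro: less_imp_le)
  have "a u v = \<psi> u" if u: "u \<in> V" for u
  proof -
    define p where "p = a u u"
    define q where "q = a u v - \<psi> u"
    have p: "p \<ge> 0" using k(2)[OF u] k(1) unfolding p_def by (smt (verit) mult_nonneg_nonneg zero_le_power2)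
    have ineq: "0 \<le> t\<^sup>2 * p + 2 * t * q" for t
    proof -
      have "J v \<le> J (v + t *\<^sub>R u)" using Jv m_le[OF add_in[OF v scale_in[OF u]]] by (rule order_trans)
      then show ?thesis
        using u v J_add[OF v scale_in[OF u], of t]
        by (simp add: p_def q_def form_simps[OF a u u] form_simps[OF a u u v] form_simps[OF a u u scale_in[OF u]]
            functional_simps[OF l u u] power2_eq_square algebra_simps)
    qed
    \<comment> \<open>The quadratic in t would be minimal at - q / p; the added 1 covers p = 0 and
      still makes the value negative unless q = 0.\<close>
    define t where "t = - q / (p + 1)"
    have rt: "(p + 1) * t = - q" using p by (simp add: t_def)
    have "0 \<le> (p + 1)\<^sup>2 * (t\<^sup>2 * p + 2 * t * q)" using ineq[of t] by simp
    also have "\<dots> = ((p + 1) * t)\<^sup>2 * p + 2 * (p + 1) * ((p + 1) * t) * q"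
      by (simp add: power2_eq_square algebra_simps)
    also have "\<dots> = - (q\<^sup>2 * (p + 2))"
      unfolding rt by (simp add: power2_eq_square algebra_simps)
    finally have "q\<^sup>2 * (p + 2) \<le> 0" by simp
    then have "q\<^sup>2 \<le> 0" using p by (simp add: mult_le_0_iff)
    then show ?thesis by (simp add: q_def)
  qed
  then show ?thesis using v by blast
qed

text \<open>With the symmetric part \<open>a\<close> of \<open>B\<close> as inner product, Riesz gives an operator \<open>S\<close> with
  \<open>B v w = a w (S v)\<close>. The form \<open>a (S v) (S z)\<close> is symmetric and coercive, and \<open>w = S z\<close> solves the
  problem if \<open>z\<close> represents \<open>\<psi>\<close> for it.\<close>

theorem lax_milgram:
  assumes B: "bounded_form B" and co: "coercive B" and l: "bounded_functional \<psi>"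
  shows "\<exists>w\<in>V. \<forall>v\<in>V. B v w = \<psi> v"
proof -
  obtain C0 where C0: "\<And>u v. u \<in> V \<Longrightarrow> v \<in> V \<Longrightarrow> \<bar>B u v\<bar> \<le> C0 * N u * N v"
    using B unfolding bounded_form_def by blast
  \<comment> \<open>The maximum with 1 makes \<open>C\<close> positive, so that it can serve as a
    denominator.\<close>
  define C where "C = max C0 1"
  have C: "C > 0" by (simp add: C_def)
  have BC: "\<bar>B u v\<bar> \<le> C * N u * N v" if "u \<in> V" "v \<in> V" for u v
    by (rule order_trans[OF C0[OF that]]) (auto simp: C_def N_nonneg intro!: mult_right_mono)
  obtain k where k: "k > 0" "\<And>u. u \<in> V \<Longrightarrow> k * (N u)\<^sup>2 \<le> B u u"
    using co unfolding coercive_def by blast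
  define a where "a u v = (B u v + B v u) / 2" for u v
  have sym: "a u v = a v u" for u v by (simp add: a_def)
  have a: "bounded_form a"
    unfolding bounded_form_def
  proof (intro conjI ballI allI)
    fix u v w c assume "u \<in> V" "v \<in> V" "w \<in> V"
    then show "a (c *\<^sub>R u + v) w = c * a u w + a v w" "a w (c *\<^sub>R u + v) = c * a w u + a w v"
      by (simp_all add: a_def form_simps[OF B] scale_in add_divide_distrib distrib_left)
  next
    have "\<bar>a u v\<bar> \<le> C * N u * N v" if "u \<in> V" "v \<in> V" for u v
      using BC[OF that] BC[OF that(2,1)] unfolding a_def by (simp add: mult.assoc mult.commute[of "N v"])
    then show "\<exists>C\<ge>0. \<forall>u\<in>V. \<forall>v\<in>V. \<bar>a u v\<bar> \<le> C * N u * N v" using C by (intro exI[of _ C]) auto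
  qed
  have aco: "coercive a" unfolding coercive_def using k by (auto simp: a_def)
  have "\<exists>z\<in>V. \<forall>w\<in>V. a w z = B v w" if v: "v \<in> V" for v
  proof (rule riesz_symmetric[OF a sym aco])
    show "bounded_functional (B v)"
      unfolding bounded_functional_def
    proof (intro conjI ballI allI exI[of _ "C * N v"])
      show "B v (c *\<^sub>R u + w) = c * B v u + B v w" if "u \<in> V" "w \<in> V" for u w c
        using that v by (simp add: form_simps[OF B] scale_in)
    qed (use C v BC N_nonneg in auto)
  qed
  then obtain S where S: "\<And>v. v \<in> V \<Longrightarrow> S v \<in> V" "\<And>v w. v \<in> V \<Longrightarrow> w \<in> V \<Longrightarrow> a w (S v) = B v w" by metis
  have aS: "a (S u) (S v) = B u (S v)" if "u \<in> V" "v \<in> V" for u v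
    using S(2)[OF that(1) S(1)[OF that(2)]] sym by metis
  \<comment> \<open>Testing the defining equation of \<open>S v\<close> with \<open>S v\<close>
    itself bounds \<open>S\<close> from above.\<close>
  have NS: "N (S v) \<le> C / k * N v" if v: "v \<in> V" for v
  proof (cases "N (S v) = 0")
    case False
    then have pos: "N (S v) > 0" using N_nonneg[of "S v"] by linarith
    have "k * (N (S v))\<^sup>2 \<le> B (S v) (S v)" by (intro k S v)
    also have "\<dots> = a (S v) (S v)" by (simp add: a_def)
    also have "\<dots> = B v (S v)" by (rule aS[OF v v])
    also have "\<dots> \<le> C * N v * N (S v)" using BC[OF v S(1)[OF v]] by simp
    finally have "(k * N (S v)) * N (S v) \<le> (C * N v) * N (S v)" by (simp add: power2_eq_square mult.assoc)
    then have "k * N (S v) \<le> C * N v" using pos by (rule mult_right_le_imp_le)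
    then show ?thesis using k by (simp add: field_simps)
  qed (use C k N_nonneg in auto)
  let ?b = "\<lambda>u v. a (S u) (S v)"
  have "\<exists>z\<in>V. \<forall>v\<in>V. ?b v z = \<psi> v"
  proof (rule riesz_symmetric[OF _ sym _ l])
    show "bounded_form ?b"
      unfolding bounded_form_def
    proof (intro conjI ballI allI)
      fix u v w c assume uvw: "u \<in> V" "v \<in> V" "w \<in> V"
      then have cuv: "c *\<^sub>R u + v \<in> V" by (intro lin_in)
      \<comment> \<open>By \<open>aS\<close> the form equals \<open>B u (S w)\<close>, so it is
        linear in its first argument without appeal to linearity of \<open>S\<close>; symmetry gives
        the second argument.\<close>
      show 1: "?b (c *\<^sub>R u + v) w = c * ?b u w + ?b v w"
        using uvw cuv by (simp add: aS S(1) form_simps[OF B] scale_in)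
      then show "?b w (c *\<^sub>R u + v) = c * ?b w u + ?b w v" using sym by metis
    next
      have "\<bar>?b u v\<bar> \<le> (C * (C / k)) * N u * N v" if "u \<in> V" "v \<in> V" for u v
      proof -
        have "\<bar>?b u v\<bar> \<le> C * N u * N (S v)" unfolding aS[OF that] by (intro BC S that)
        also have "\<dots> \<le> C * N u * (C / k * N v)" using C
          by (intro mult_left_mono NS that) (auto simp: N_nonneg)
        finally show ?thesis by (simp add: mult_ac)
      qed
      then show "\<exists>C\<ge>0. \<forall>u\<in>V. \<forall>v\<in>V. \<bar>?b u v\<bar> \<le> C * N u * N v"
        using C k by (intro exI[of _ "C * (C / k)"]) auto
    qed
    show "coercive ?b"
      unfolding coercive_def
    \<comment> \<open>One factor \<open>k\<close> is the coercivity of \<open>a\<close>. The factor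
      \<open>k / C\<close> is a lower bound for \<open>S\<close>, obtained by testing the defining
      equation of \<open>S v\<close> with \<open>v\<close>.\<close>
    proof (intro exI[of _ "k * (k / C)\<^sup>2"] conjI ballI)
      show "0 < k * (k / C)\<^sup>2" using k C by simp
      fix v assume v: "v \<in> V"
      have "k / C * N v \<le> N (S v)"
      proof (cases "N v = 0")
        case False
        then have pos: "N v > 0" using N_nonneg[of v] by linarith
        have "k * (N v)\<^sup>2 \<le> B v v" by (rule k(2)[OF v])
        also have "\<dots> = a v (S v)" using S(2)[OF v v] by simp
        also have "\<dots> \<le> C * N v * N (S v)"
          using BC[OF v S(1)[OF v]] BC[OF S(1)[OF v] v]
            by (simp add: a_def mult.assoc mult.commute[of "N (S v)"])
        finally have "(k * N v) * N v \<le> (C * N (S v)) * N v" by (simp add: power2_eq_square mult_ac)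
        then have "k * N v \<le> C * N (S v)" using pos by (rule mult_right_le_imp_le)
        then show ?thesis using C by (simp add: field_simps)
      qed (simp add: N_nonneg)
      then have "(k / C * N v)\<^sup>2 \<le> (N (S v))\<^sup>2" using k C N_nonneg by (intro power_mono) auto
      then have "k * (k / C * N v)\<^sup>2 \<le> k * (N (S v))\<^sup>2" using k by simp
      also have "\<dots> \<le> ?b v v" using k(2)[OF S(1)[OF v]] by (simp add: a_def)
      finally show "k * (k / C)\<^sup>2 * (N v)\<^sup>2 \<le> ?b v v" unfolding power_mult_distrib mult.assoc .
    qed
  qed
  then obtain z where z: "z \<in> V" "\<And>v. v \<in> V \<Longrightarrow> ?b v z = \<psi> v" by blast
  have "B v (S z) = \<psi> v" if "v \<in> V" for v using z(2)[OF that] aS[OF that z(1)] by simp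
  then show ?thesis using S(1)[OF z(1)] by blast
qed

end

section \<open>Exterior solutions and the DN map\<close>

lemma Htilde_complete_subspace: "complete_subspace (Htilde s \<Omega>) (Hs_norm s)"
  by unfold_locales (auto intro: Htilde_zero Htilde_lin Hs_norm_nonneg Htilde_complete)

lemma form_lin:
  assumes "bounded_bilinear_form s B" "u \<in> Hs s" "v \<in> Hs s" "w \<in> Hs s"
  shows "B (c *\<^sub>R u + v) w = c * B u w + B v w" "B w (c *\<^sub>R u + v) = c * B w u + B w v"
  using assms by (auto simp: bounded_bilinear_form_def Hs_scale)

lemma form_add_diff:
  assumes "bounded_bilinear_form s B" "u \<in> Hs s" "v \<in> Hs s" "w \<in> Hs s"
  shows "B (u + v) w = B u w + B v w" "B w (u + v) = B w u + B w v"
    "B (u - v) w = B u w - B v w" "B w (u - v) = B w u - B w v"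
  using form_lin(1)[OF assms, of 1] form_lin(2)[OF assms, of 1]
    form_lin(1)[OF assms(1,3,2,4), of "-1"] form_lin(2)[OF assms(1,3,2,4), of "-1"] by simp_all

lemma form_bound:
  assumes "bounded_bilinear_form s B"
  shows "\<exists>C\<ge>0. \<forall>u\<in>Hs s. \<forall>v\<in>Hs s. \<bar>B u v\<bar> \<le> C * Hs_norm s u * Hs_norm s v"
proof -
  obtain C where C: "\<And>u v. u \<in> Hs s \<Longrightarrow> v \<in> Hs s \<Longrightarrow> \<bar>B u v\<bar> \<le> C * Hs_norm s u * Hs_norm s v"
    using assms unfolding bounded_bilinear_form_def by blast
  have "\<bar>B u v\<bar> \<le> \<bar>C\<bar> * Hs_norm s u * Hs_norm s v" if "u \<in> Hs s" "v \<in> Hs s" for u v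
    by (rule order_trans[OF C[OF that]]) (intro mult_right_mono Hs_norm_nonneg abs_ge_self)
  then show ?thesis by (intro exI[of _ "\<bar>C\<bar>"]) auto
qed

lemma bounded_bilinear_form_add:
  assumes L: "bounded_bilinear_form s L" and q: "bounded_bilinear_form s q"
  shows "bounded_bilinear_form s (add_form L q)"
  unfolding bounded_bilinear_form_def
proof (intro conjI ballI allI)
  obtain C where "0 \<le> C" and C: "\<And>u v. u \<in> Hs s \<Longrightarrow> v \<in> Hs s \<Longrightarrow> \<bar>L u v\<bar> \<le> C * Hs_norm s u * Hs_norm s v"
    using form_bound[OF L] by blast
  obtain D where "0 \<le> D" and D: "\<And>u v. u \<in> Hs s \<Longrightarrow> v \<in> Hs s \<Longrightarrow> \<bar>q u v\<bar> \<le> D * Hs_norm s u * Hs_norm s v"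
    using form_bound[OF q] by blast
  have "\<bar>add_form L q u v\<bar> \<le> (C + D) * Hs_norm s u * Hs_norm s v" if "u \<in> Hs s" "v \<in> Hs s" for u v
    using C[OF that] D[OF that] by (simp add: add_form_def distrib_right)
  then show "\<exists>C. \<forall>u\<in>Hs s. \<forall>v\<in>Hs s. \<bar>add_form L q u v\<bar> \<le> C * Hs_norm s u * Hs_norm s v" by blast
next
  fix u v w :: "'a tempered_dist" and c assume h: "u \<in> Hs s" "v \<in> Hs s"
  show "add_form L q (c *\<^sub>R u) v = c * add_form L q u v" "add_form L q u (c *\<^sub>R v) = c * add_form L q u v"
    using L q h by (simp_all add: add_form_def bounded_bilinear_form_def distrib_left)
  assume "w \<in> Hs s"
  then show "add_form L q (u + v) w = add_form L q u w + add_form L q v w"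
    "add_form L q w (u + v) = add_form L q w u + add_form L q w v"
    using h by (simp_all add: add_form_def form_add_diff[OF L] form_add_diff[OF q])
qed

text \<open>The second conclusion is the first one for the transposed form, which has the same bound
  and the same coercivity. The first serves the adjoint problem of the Runge argument, the second
  the construction of exterior solutions.\<close>

lemma lax_milgram_Htilde:
  assumes B: "bounded_bilinear_form s B" and co: "coercive_form s \<Omega> B"
    and lin: "\<And>u v c. u \<in> Htilde s \<Omega> \<Longrightarrow> v \<in> Htilde s \<Omega> \<Longrightarrow> \<psi> (c *\<^sub>R u + v) = c * \<psi> u + \<psi> v"
    and bound: "\<And>u. u \<in> Htilde s \<Omega> \<Longrightarrow> \<bar>\<psi> u\<bar> \<le> D * Hs_norm s u"
  shows "\<exists>w\<in>Htilde s \<Omega>. \<forall>v\<in>Htilde s \<Omega>. B v w = \<psi> v" "\<exists>w\<in>Htilde s \<Omega>. \<forall>v\<in>Htilde s \<Omega>. B w v = \<psi> v"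
proof -
  interpret complete_subspace "Htilde s \<Omega>" "Hs_norm s" by (rule Htilde_complete_subspace)
  obtain C where C: "0 \<le> C" "\<And>u v. u \<in> Hs s \<Longrightarrow> v \<in> Hs s \<Longrightarrow> \<bar>B u v\<bar> \<le> C * Hs_norm s u * Hs_norm s v"
    using form_bound[OF B] by blast
  have l: "bounded_functional \<psi>"
    unfolding bounded_functional_def
  proof (intro conjI ballI allI exI[of _ "\<bar>D\<bar>"] lin)
    show "\<bar>\<psi> u\<bar> \<le> \<bar>D\<bar> * Hs_norm s u" if "u \<in> Htilde s \<Omega>" for u
      by (rule order_trans[OF bound[OF that]]) (intro mult_right_mono Hs_norm_nonneg abs_ge_self)
  qed auto
  have C': "\<bar>B u v\<bar> \<le> C * Hs_norm s u * Hs_norm s v" "\<bar>B u v\<bar> \<le> C * Hs_norm s v * Hs_norm s u"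
    if "u \<in> Htilde s \<Omega>" "v \<in> Htilde s \<Omega>" for u v
    using C(2)[OF that[THEN Htilde_Hs]] by (simp_all only: mult.assoc mult.commute[of "Hs_norm s v"])
  have "bounded_form B"
    unfolding bounded_form_def
  proof (intro conjI ballI allI exI[of _ C] form_lin[OF B] Htilde_Hs[where \<Omega> = \<Omega>])
    show "\<bar>B u v\<bar> \<le> C * Hs_norm s u * Hs_norm s v" if "u \<in> Htilde s \<Omega>" "v \<in> Htilde s \<Omega>" for u v
      by (rule C'(1)[OF that])
  qed (use C(1) in auto)
  moreover have "bounded_form (\<lambda>u v. B v u)"
    unfolding bounded_form_def
  proof (intro conjI ballI allI exI[of _ C] form_lin[OF B] Htilde_Hs[where \<Omega> = \<Omega>])
    show "\<bar>B v u\<bar> \<le> C * Hs_norm s u * Hs_norm s v" if "u \<in> Htilde s \<Omega>" "v \<in> Htilde s \<Omega>" for u v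
      by (rule C'(2)[OF that(2,1)])
  qed (use C(1) in auto)
  moreover have "coercive B" "coercive (\<lambda>u v. B v u)"
    using co unfolding coercive_def coercive_form_def by auto
  ultimately show "\<exists>w\<in>Htilde s \<Omega>. \<forall>v\<in>Htilde s \<Omega>. B v w = \<psi> v" "\<exists>w\<in>Htilde s \<Omega>. \<forall>v\<in>Htilde s \<Omega>. B w v = \<psi> v"
    using lax_milgram[of B \<psi>] lax_milgram[of "\<lambda>u v. B v u" \<psi>] l by blast+
qed

text \<open>Writing u = w + f moves the datum to the right-hand side, where w is found by
  Lax--Milgram. Two solutions differ by an element of \<open>Htilde s \<Omega>\<close>, on which
  coercivity forces norm 0.\<close>

lemma exterior_solution_unique:
  assumes B: "bounded_bilinear_form s B" and co: "coercive_form s \<Omega> B" and f: "f \<in> Hs s"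
  shows "\<exists>!u. u \<in> Hs s \<and> u - f \<in> Htilde s \<Omega> \<and> (\<forall>v\<in>Htilde s \<Omega>. B u v = 0)"
proof (rule ex_ex1I)
  obtain C where C: "0 \<le> C" "\<And>u v. u \<in> Hs s \<Longrightarrow> v \<in> Hs s \<Longrightarrow> \<bar>B u v\<bar> \<le> C * Hs_norm s u * Hs_norm s v"
    using form_bound[OF B] by blast
  have "\<exists>w\<in>Htilde s \<Omega>. \<forall>v\<in>Htilde s \<Omega>. B w v = - B f v"
  proof (rule lax_milgram_Htilde(2)[OF B co])
    show "- B f (c *\<^sub>R u + v) = c * - B f u + - B f v" if "u \<in> Htilde s \<Omega>" "v \<in> Htilde s \<Omega>" for u v c
      using that f by (simp add: form_lin[OF B] Htilde_Hs[where \<Omega> = \<Omega>])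
    show "\<bar>- B f u\<bar> \<le> C * Hs_norm s f * Hs_norm s u" if "u \<in> Htilde s \<Omega>" for u
      using C(2)[OF f Htilde_Hs[OF that]] by simp
  qed
  then obtain w where w: "w \<in> Htilde s \<Omega>" "\<And>v. v \<in> Htilde s \<Omega> \<Longrightarrow> B w v = - B f v" by blast
  then have "w + f \<in> Hs s \<and> w + f - f \<in> Htilde s \<Omega> \<and> (\<forall>v\<in>Htilde s \<Omega>. B (w + f) v = 0)"
    using f by (simp add: Hs_add Htilde_Hs form_add_diff[OF B])
  then show "\<exists>u. u \<in> Hs s \<and> u - f \<in> Htilde s \<Omega> \<and> (\<forall>v\<in>Htilde s \<Omega>. B u v = 0)" by blast
next
  fix u v assume u: "u \<in> Hs s \<and> u - f \<in> Htilde s \<Omega> \<and> (\<forall>v\<in>Htilde s \<Omega>. B u v = 0)"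
    and v: "v \<in> Hs s \<and> v - f \<in> Htilde s \<Omega> \<and> (\<forall>w\<in>Htilde s \<Omega>. B v w = 0)"
  obtain k where k: "k > 0" "\<And>u. u \<in> Htilde s \<Omega> \<Longrightarrow> k * (Hs_norm s u)\<^sup>2 \<le> B u u"
    using co unfolding coercive_form_def by blast
  have d: "u - v \<in> Htilde s \<Omega>" using Htilde_diff[of "u - f" s \<Omega> "v - f"] u v by simp
  have "B (u - v) (u - v) = B u (u - v) - B v (u - v)"
    using u v Htilde_Hs[OF d] by (intro form_add_diff[OF B]) auto
  then have "B (u - v) (u - v) = 0" using u v d by simp
  then have "Hs_norm s (u - v) = 0" using k(2)[OF d] k(1) by (simp add: mult_le_0_iff)
  then show "u = v" using Hs_norm_eq_zeroD[OF Htilde_Hs[OF d]] by simp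
qed

lemma exterior_solution:
  assumes "bounded_bilinear_form s B" "coercive_form s \<Omega> B" "f \<in> Hs s"
  shows "exterior_solution s \<Omega> B f \<in> Hs s" "exterior_solution s \<Omega> B f - f \<in> Htilde s \<Omega>"
    "v \<in> Htilde s \<Omega> \<Longrightarrow> B (exterior_solution s \<Omega> B f) v = 0"
  using theI'[OF exterior_solution_unique[OF assms]] unfolding exterior_solution_def by blast+

section \<open>The DN map on the quotient\<close>

lemma exterior_solution_cong:
  assumes "f - g \<in> Htilde s \<Omega>"
  shows "exterior_solution s \<Omega> B f = exterior_solution s \<Omega> B g"
proof -
  have "u - f \<in> Htilde s \<Omega> \<longleftrightarrow> u - g \<in> Htilde s \<Omega>" for u
    using Htilde_add[OF _ assms, of "u - f"] Htilde_diff[OF _ assms, of "u - g"] by auto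
  then show ?thesis unfolding exterior_solution_def by simp
qed

text \<open>Well-definedness on classes: changing \<open>f\<close> leaves the solution unchanged,
  and changing \<open>g\<close> alters the value by \<open>B\<close> of the solution against an
  element of \<open>Htilde s \<Omega>\<close>, which is 0. The classes are nonempty, so the common
  value is unique.\<close>

lemma DN_map_trace_class:
  assumes B: "bounded_bilinear_form s B" and co: "coercive_form s \<Omega> B" and f: "f \<in> Hs s" and g: "g \<in> Hs s"
  shows "DN_map s \<Omega> B (trace_class s \<Omega> f) (trace_class s \<Omega> g) = B (exterior_solution s \<Omega> B f) g"
  unfolding DN_map_def
proof (rule the_equality)
  note sol = exterior_solution[OF B co f]
  show "\<forall>f'\<in>trace_class s \<Omega> f. \<forall>g'\<in>trace_class s \<Omega> g. B (exterior_solution s \<Omega> B f') g'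
    = B (exterior_solution s \<Omega> B f) g"
  proof (intro ballI)
    fix f' g' assume "f' \<in> trace_class s \<Omega> f" "g' \<in> trace_class s \<Omega> g"
    then have d: "f - f' \<in> Htilde s \<Omega>" "g - g' \<in> Htilde s \<Omega>" "g' \<in> Hs s" by (auto simp: exterior_rel_def)
    have "B (exterior_solution s \<Omega> B f) (g - g') = 0" by (rule sol(3)[OF d(2)])
    then show "B (exterior_solution s \<Omega> B f') g' = B (exterior_solution s \<Omega> B f) g"
      unfolding exterior_solution_cong[OF d(1), symmetric] using d g sol(1) by (simp add: form_add_diff[OF B])
  qed
  fix r assume r: "\<forall>f\<in>trace_class s \<Omega> f. \<forall>g\<in>trace_class s \<Omega> g. B (exterior_solution s \<Omega> B f) g = r"
  have "f \<in> trace_class s \<Omega> f" "g \<in> trace_class s \<Omega> g"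
    using f g Htilde_zero[of s \<Omega>] by (auto simp: exterior_rel_def)
  from bspec[OF bspec[OF r this(1)] this(2)] show "r = B (exterior_solution s \<Omega> B f) g" by simp
qed

lemma local_form_exterior:
  assumes "local_form s q" "W \<subseteq> - closure \<Omega>" "f \<in> test_functions W" "v \<in> Htilde s \<Omega>"
  shows "q (dist_of f) v = 0" "q v (dist_of f) = 0"
proof -
  have "dist_support (dist_of f) \<inter> dist_support v = {}"
    using dist_support_dist_of[OF assms(3)] dist_support_Htilde[OF assms(4)] assms(2) by blast
  then show "q (dist_of f) v = 0" "q v (dist_of f) = 0"
    using assms(1) dist_of_in_Hs[OF assms(3)] Htilde_Hs[OF assms(4)]
    unfolding local_form_def by (auto simp: Int_commute)
qed

theorem theorem2p6:
  fixes s :: real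
    and \<Omega> W\<^sub>1 W\<^sub>2 :: "(real ^ 'n) set"
    and L q\<^sub>1 q\<^sub>2 :: "(real ^ 'n) form"
  assumes "open \<Omega>"
    and "- closure \<Omega> \<noteq> {}"
    and "bounded_bilinear_form s L"
    and "open W\<^sub>1" and "W\<^sub>1 \<noteq> {}" and "W\<^sub>1 \<subseteq> - closure \<Omega>" and "right_UCP s L W\<^sub>1"
    and "open W\<^sub>2" and "W\<^sub>2 \<noteq> {}" and "W\<^sub>2 \<subseteq> - closure \<Omega>" and "left_UCP s L W\<^sub>2"
    and "W\<^sub>1 \<inter> W\<^sub>2 = {}"
    and "bounded_bilinear_form s q\<^sub>1" and "local_form s q\<^sub>1"
    and "bounded_bilinear_form s q\<^sub>2" and "local_form s q\<^sub>2"
    and "coercive_form s \<Omega> (add_form L q\<^sub>1)"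
    and "coercive_form s \<Omega> (add_form L q\<^sub>2)"
    and "\<And>f g. f \<in> test_functions W\<^sub>1 \<Longrightarrow> g \<in> test_functions W\<^sub>2 \<Longrightarrow>
      DN_map s \<Omega> (add_form L q\<^sub>1) (trace_class s \<Omega> (dist_of f)) (trace_class s \<Omega> (dist_of g)) =
      DN_map s \<Omega> (add_form L q\<^sub>2) (trace_class s \<Omega> (dist_of f)) (trace_class s \<Omega> (dist_of g))"
  shows "\<forall>u\<in>Htilde s \<Omega>. \<forall>v\<in>Htilde s \<Omega>. q\<^sub>1 u v = q\<^sub>2 u v"
proof -
  let ?V = "Htilde s \<Omega>" and ?B1 = "add_form L q\<^sub>1" and ?B2 = "add_form L q\<^sub>2"
  note L = assms(3) and W1 = assms(6) and W2 = assms(10) and q1 = assms(13) and l1 = assms(14)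
    and q2 = assms(15) and l2 = assms(16) and c1 = assms(17) and c2 = assms(18)
  note B1 = bounded_bilinear_form_add[OF L q1] and B2 = bounded_bilinear_form_add[OF L q2]
  define sol where "sol f = exterior_solution s \<Omega> ?B1 (dist_of f)" for f
  have sol1: "sol f \<in> Hs s" "sol f - dist_of f \<in> ?V" "\<And>v. v \<in> ?V \<Longrightarrow> ?B1 (sol f) v = 0"
    if "f \<in> test_functions W\<^sub>1" for f
    using exterior_solution[OF B1 c1 dist_of_in_Hs[OF that]] unfolding sol_def by auto
  have DN: "DN_map s \<Omega> (add_form L q) (trace_class s \<Omega> (dist_of f)) (trace_class s \<Omega> (dist_of g))
      = L (exterior_solution s \<Omega> (add_form L q) (dist_of f)) (dist_of g)"
    if f: "f \<in> test_functions W\<^sub>1" and g: "g \<in> test_functions W\<^sub>2"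
      and q: "bounded_bilinear_form s q" "local_form s q" "coercive_form s \<Omega> (add_form L q)" for f g q
  proof -
    let ?u = "exterior_solution s \<Omega> (add_form L q) (dist_of f)"
    note fH = dist_of_in_Hs[OF f, of s] and gH = dist_of_in_Hs[OF g, of s]
    note u = exterior_solution[OF bounded_bilinear_form_add[OF L q(1)] q(3) fH]
    \<comment> \<open>The solution is split into a part supported in the closure of \<Omega> and the
      datum supported in \<open>W\<^sub>1\<close>. Disjointness of \<open>W\<^sub>1\<close> and
      \<open>W\<^sub>2\<close> disposes of the second part.\<close>
    have "q (?u - dist_of f) (dist_of g) = 0"
      by (rule local_form_exterior(2)[OF q(2) W2 g u(2)])
    moreover have "q (dist_of f) (dist_of g) = 0"
      using q(2) fH gH dist_support_dist_of[OF f] dist_support_dist_of[OF g] \<open>W\<^sub>1 \<inter> W\<^sub>2 = {}\<close>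
      unfolding local_form_def by blast
    ultimately have "q ?u (dist_of g) = 0"
      using form_add_diff(3)[OF q(1) u(1) fH gH] by simp
    then show ?thesis
      unfolding DN_map_trace_class[OF bounded_bilinear_form_add[OF L q(1)] q(3) fH gH]
      by (simp add: add_form_def)
  qed
  have sol2: "?B2 (sol f) v = 0" if f: "f \<in> test_functions W\<^sub>1" and v: "v \<in> ?V" for f v
  proof -
    let ?u = "exterior_solution s \<Omega> ?B2 (dist_of f)"
    note u = exterior_solution[OF B2 c2 dist_of_in_Hs[OF f]]
    have d: "sol f - ?u \<in> ?V"
      using Htilde_diff[OF sol1(2)[OF f] u(2)] by simp
    have "L (sol f - ?u) (dist_of g) = 0" if g: "g \<in> test_functions W\<^sub>2" for g
      using assms(19)[OF f g] sol1(1)[OF f] u(1) dist_of_in_Hs[OF g, of s]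
      unfolding DN[OF f g q1 l1 c1] DN[OF f g q2 l2 c2] sol_def by (simp add: form_add_diff[OF L])
    moreover have "vanishes_on (sol f - ?u) W\<^sub>2"
      by (rule vanishes_on_subset[OF Htilde_vanishes_on[OF d] W2])
    ultimately have "sol f - ?u = 0"
      using \<open>left_UCP s L W\<^sub>2\<close> Htilde_Hs[OF d] unfolding left_UCP_def by blast
    then show ?thesis using u(3)[OF v] by simp
  qed
  \<comment> \<open>\<open>sol f\<close> solves both equations, so the terms with \<open>L\<close>
    cancel. The datum may be subtracted because locality makes both \<open>q\<^sub>1\<close> and
    \<open>q\<^sub>2\<close> vanish on it against \<open>v\<close>.\<close>
  have agree: "q\<^sub>1 (sol f - dist_of f) v = q\<^sub>2 (sol f - dist_of f) v"
    if f: "f \<in> test_functions W\<^sub>1" and v: "v \<in> ?V" for f v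
  proof -
    note h = sol1(1)[OF f] dist_of_in_Hs[OF f] Htilde_Hs[OF v]
    have "q\<^sub>1 (sol f) v = q\<^sub>2 (sol f) v"
      using sol1(3)[OF f v] sol2[OF f v] by (simp add: add_form_def)
    then show ?thesis
      using local_form_exterior(1)[OF l1 W1 f v] local_form_exterior(1)[OF l2 W1 f v]
      by (simp add: form_add_diff(3)[OF q1 h] form_add_diff(3)[OF q2 h])
  qed
  show ?thesis
  proof (intro ballI)
    fix u v assume u: "u \<in> ?V" and v: "v \<in> ?V"
    let ?l = "\<lambda>u. q\<^sub>1 u v - q\<^sub>2 u v"
    obtain C1 where C1: "\<And>u v. u \<in> Hs s \<Longrightarrow> v \<in> Hs s \<Longrightarrow> \<bar>q\<^sub>1 u v\<bar> \<le> C1 * Hs_norm s u * Hs_norm s v"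
      using form_bound[OF q1] by blast
    obtain C2 where C2: "\<And>u v. u \<in> Hs s \<Longrightarrow> v \<in> Hs s \<Longrightarrow> \<bar>q\<^sub>2 u v\<bar> \<le> C2 * Hs_norm s u * Hs_norm s v"
      using form_bound[OF q2] by blast
    have "\<exists>w\<in>?V. \<forall>x\<in>?V. ?B1 x w = ?l x"
    proof (rule lax_milgram_Htilde(1)[OF B1 c1])
      show "?l (c *\<^sub>R x + y) = c * ?l x + ?l y" if "x \<in> ?V" "y \<in> ?V" for x y c
        unfolding form_lin(1)[OF q1 that[THEN Htilde_Hs] Htilde_Hs[OF v]]
          form_lin(1)[OF q2 that[THEN Htilde_Hs] Htilde_Hs[OF v]]
        by (simp add: algebra_simps)
      show "\<bar>?l x\<bar> \<le> ((C1 + C2) * Hs_norm s v) * Hs_norm s x" if "x \<in> ?V" for x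
        using C1[OF Htilde_Hs[OF that] Htilde_Hs[OF v]] C2[OF Htilde_Hs[OF that] Htilde_Hs[OF v]]
        by (simp add: algebra_simps)
    qed
    then obtain w where w: "w \<in> ?V" and wB: "\<And>x. x \<in> ?V \<Longrightarrow> ?B1 x w = ?l x" by blast
    have "L (dist_of f) w = 0" if f: "f \<in> test_functions W\<^sub>1" for f
    proof -
      have "?B1 (sol f - dist_of f) w = 0"
        using wB[OF sol1(2)[OF f]] agree[OF f v] by simp
      \<comment> \<open>\<open>w\<close> is itself an admissible test element in the equation for
        \<open>sol f\<close>, so only the term with the datum is left.\<close>
      then have "?B1 (dist_of f) w = 0"
        using sol1(3)[OF f w] form_add_diff(3)[OF B1 sol1(1)[OF f] dist_of_in_Hs[OF f] Htilde_Hs[OF w]]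
          by simp
      then show ?thesis
        using local_form_exterior(1)[OF l1 W1 f w] by (simp add: add_form_def)
    qed
    moreover have "vanishes_on w W\<^sub>1"
      by (rule vanishes_on_subset[OF Htilde_vanishes_on[OF w] W1])
    ultimately have "w = 0"
      using \<open>right_UCP s L W\<^sub>1\<close> Htilde_Hs[OF w] unfolding right_UCP_def by blast
    \<comment> \<open>Additivity at 0 + 0 yields that the form vanishes at a zero second
      argument.\<close>
    moreover have "?B1 u (0 + 0) = ?B1 u 0 + ?B1 u 0"
      by (rule form_add_diff(2)[OF B1 Hs_zero Hs_zero Htilde_Hs[OF u]])
    ultimately show "q\<^sub>1 u v = q\<^sub>2 u v" using wB[OF u] by simp
  qed
qed

end
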